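(* (i) Fix $n\in\mathbb N$, and assume that $2n<p\le2(n+1)$. Then there is a closed subspace $Z_n\subset c_0$ without the approximation property and a closed subalgebra $\mathcal M_n$ of $\overline{\mathcal{QN}_p(Z_n)}$ (closure in operator norm) such that $$\mathcal M_n\in\mathcal{SI}_{n+1}(\mathcal L(Z_n))\setminus\mathcal{SI}_n(\mathcal L(Z_n)).$$ (ii) Moreover, for any choice of $p_n\in(2n,2(n+1)]$, $n\in\mathbb N$, the spaces $Z_n$ in (i) (with $p=p_n$) can be chosen such that for $Z=\big(\bigoplus_{n=1}^\infty Z_n\big)_{c_0}$ one has $$\mathcal{SI}_n(\mathcal L(Z))\subsetneq\mathcal{SI}_{n+1}(\mathcal L(Z))$$ for all $n\in\mathbb N$.
   Context: Scalars are real or complex; $\mathbb N=\{1,2,\ldots\}$. $\mathcal L(X)$ is the Banach algebra of bounded operators on the Banach space $X$. $n$-subideals: let $\mathcal A$ be a Banach algebra and $n\in\mathbb N$. A subalgebra $\mathcal I\subset\mathcal A$ is an $n$-subideal of $\mathcal A$ if there are subalgebras $\mathcal I=\mathcal J_n\subset\cdots\subset\mathcal J_1\subset\mathcal J_0=\mathcal A$ such that $\mathcal J_k$ is an ideal of $\mathcal J_{k-1}$ for each $k=1,\ldots,n$. It is a closed $n$-subideal if $\mathcal I$ and all $\mathcal J_k$ are closed in $\mathcal A$ (it suffices that $\mathcal I$ is closed). $\mathcal{SI}_n(\mathcal A)$ denotes the set of all closed $n$-subideals of $\mathcal A$. Quasi $p$-nuclear operators: for Banach spaces $X,Y$ and $p\in[1,\infty)$,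 $T\in\mathcal L(X,Y)$ belongs to $\mathcal{QN}_p(X,Y)$ if there is a sequence $(x_k^* )$ in $X^*$ with $\sum_k\|x_k^*\|^p<\infty$ such that $\|Tx\|\le\big(\sum_{k=1}^\infty|x_k^*(x)|^p\big)^{1/p}$ for all $x\in X$. $\mathcal{QN}_p(X)=\mathcal{QN}_p(X,X)$, which is an ideal of $\mathcal L(X)$ contained in the compact operators. *)

theory Defs
  imports "HOL-Analysis.Analysis"
begin

subsection \<open>Scalars\<close>

text \<open>
  A type of class \<open>rc_field\<close> is, up to isometric isomorphism, the real field
  or the complex field.
\<close>

class rc_field = real_normed_field + banach +
  assumes real_or_complex:
    "(\<forall>x. \<exists>a. x = a *\<^sub>R 1) \<or>
     (\<exists>i. i * i = - 1 \<and>
        (\<forall>x. \<exists>a b. x = a *\<^sub>R 1 + b *\<^sub>R i \<and> norm x = sqrt (a\<^sup>2 + b\<^sup>2)))"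

instance real :: rc_field
  by standard auto

instance complex :: rc_field
proof
  have "\<exists>a b. x = a *\<^sub>R 1 + b *\<^sub>R \<i> \<and> norm x = sqrt (a\<^sup>2 + b\<^sup>2)" for x :: complex
    by (rule exI[of _ "Re x"], rule exI[of _ "Im x"])
       (simp add: cmod_def complex_eq_iff)
  then show "(\<forall>x::complex. \<exists>a. x = a *\<^sub>R 1) \<or>
     (\<exists>i::complex. i * i = - 1 \<and>
        (\<forall>x. \<exists>a b. x = a *\<^sub>R 1 + b *\<^sub>R i \<and> norm x = sqrt (a\<^sup>2 + b\<^sup>2)))"
    by (intro disjI2 exI[of _ \<i>]) simp
qed


subsection \<open>Subideals of normed algebras\<close>

record ('k, 'a) normed_algebra =
  carr :: "'a set"
  add :: "'a \<Rightarrow> 'a \<Rightarrow> 'a"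
  smul :: "'k \<Rightarrow> 'a \<Rightarrow> 'a"
  mul :: "'a \<Rightarrow> 'a \<Rightarrow> 'a"
  nrm :: "'a \<Rightarrow> real"

definition linear_subset :: "('k, 'a) normed_algebra \<Rightarrow> 'a set \<Rightarrow> bool" where
  "linear_subset A S \<longleftrightarrow> S \<subseteq> carr A \<and> S \<noteq> {} \<and>
     (\<forall>x\<in>S. \<forall>y\<in>S. add A x y \<in> S) \<and> (\<forall>c. \<forall>x\<in>S. smul A c x \<in> S)"

definition subalgebra :: "('k, 'a) normed_algebra \<Rightarrow> 'a set \<Rightarrow> bool" where
  "subalgebra A S \<longleftrightarrow> linear_subset A S \<and> (\<forall>x\<in>S. \<forall>y\<in>S. mul A x y \<in> S)"

definition ideal_of :: "('k, 'a) normed_algebra \<Rightarrow> 'a set \<Rightarrow> 'a set \<Rightarrow> bool" where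
  "ideal_of A J B \<longleftrightarrow> linear_subset A J \<and> J \<subseteq> B \<and>
     (\<forall>x\<in>J. \<forall>b\<in>B. mul A b x \<in> J \<and> mul A x b \<in> J)"

text \<open>Here \<open>add A x (smul A (- 1) y)\<close> is the difference of \<open>x\<close> and \<open>y\<close>.\<close>

definition norm_closure ::
  "('k::ring_1, 'a) normed_algebra \<Rightarrow> 'a set \<Rightarrow> 'a set" where
  "norm_closure A S =
     {x \<in> carr A. \<forall>e>0. \<exists>y\<in>S. nrm A (add A x (smul A (- 1) y)) < e}"

definition norm_closed :: "('k::ring_1, 'a) normed_algebra \<Rightarrow> 'a set \<Rightarrow> bool" where
  "norm_closed A S \<longleftrightarrow> S \<subseteq> carr A \<and> norm_closure A S \<subseteq> S"

definition closed_subideals ::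
  "nat \<Rightarrow> ('k::ring_1, 'a) normed_algebra \<Rightarrow> 'a set set" where
  "closed_subideals n A = {I. \<exists>J. J 0 = carr A \<and> J n = I \<and>
     (\<forall>k\<le>n. subalgebra A (J k) \<and> norm_closed A (J k)) \<and>
     (\<forall>k\<in>{1..n}. ideal_of A (J k) (J (k - 1)))}"


subsection \<open>Bounded operators on subspaces\<close>

text \<open>
  A normed space over the scalars \<open>'k\<close> is given by a carrier \<open>X\<close> in an ambient type
  \<open>'a::real_normed_vector\<close>, which supplies addition and norm, together with a scalar
  multiplication \<open>s :: 'k \<Rightarrow> 'a \<Rightarrow> 'a\<close>. An operator on \<open>X\<close> is represented by its extension
  by \<open>0\<close> to the whole type. In this way distinct functions are distinct operators, the
  algebraic operations are the pointwise ones and composition, and \<open>onorm\<close> is the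
  operator norm over \<open>X\<close> (see \<open>onorm_bounded_ops_le\<close> and \<open>norm_bounded_ops_le\<close> below).
\<close>

definition bounded_ops ::
  "('k \<Rightarrow> 'a \<Rightarrow> 'a) \<Rightarrow> 'a set \<Rightarrow> ('k \<Rightarrow> 'b \<Rightarrow> 'b) \<Rightarrow> 'b set \<Rightarrow>
   ('a::real_normed_vector \<Rightarrow> 'b::real_normed_vector) set" where
  "bounded_ops s X t Y = {T. T ` X \<subseteq> Y \<and> (\<forall>x. x \<notin> X \<longrightarrow> T x = 0) \<and>
     (\<forall>x\<in>X. \<forall>y\<in>X. T (x + y) = T x + T y) \<and>
     (\<forall>c. \<forall>x\<in>X. T (s c x) = t c (T x)) \<and>
     (\<exists>K. \<forall>x\<in>X. norm (T x) \<le> K * norm x)}"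

definition op_algebra ::
  "('k \<Rightarrow> 'a \<Rightarrow> 'a) \<Rightarrow> 'a set \<Rightarrow> ('k, 'a::real_normed_vector \<Rightarrow> 'a) normed_algebra" where
  "op_algebra s X =
     \<lparr>carr = bounded_ops s X s X,
      add = (\<lambda>S T x. S x + T x),
      smul = (\<lambda>c T x. s c (T x)),
      mul = (\<lambda>S T. S \<circ> T),
      nrm = onorm\<rparr>"

definition dual_space ::
  "('k \<Rightarrow> 'a \<Rightarrow> 'a) \<Rightarrow> 'a set \<Rightarrow> ('a::real_normed_vector \<Rightarrow> 'k::real_normed_field) set" where
  "dual_space s X = bounded_ops s X (*) UNIV"

definition quasi_nuclear ::
  "real \<Rightarrow> ('k::real_normed_field \<Rightarrow> 'a \<Rightarrow> 'a) \<Rightarrow> 'a set \<Rightarrow> ('k \<Rightarrow> 'b \<Rightarrow> 'b) \<Rightarrow> 'b set \<Rightarrow>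
   ('a::real_normed_vector \<Rightarrow> 'b::real_normed_vector) set" where
  "quasi_nuclear p s X t Y = {T \<in> bounded_ops s X t Y.
     \<exists>\<phi>::nat \<Rightarrow> 'a \<Rightarrow> 'k. (\<forall>k. \<phi> k \<in> dual_space s X) \<and>
        summable (\<lambda>k. onorm (\<phi> k) powr p) \<and>
        (\<forall>x\<in>X. norm (T x) \<le> (\<Sum>k. norm (\<phi> k x) powr p) powr (1 / p))}"

definition finite_rank ::
  "('k::comm_ring_1 \<Rightarrow> 'a::real_normed_vector \<Rightarrow> 'a) \<Rightarrow> 'a set \<Rightarrow> ('a \<Rightarrow> 'a) \<Rightarrow> bool" where
  "finite_rank s X T \<longleftrightarrow> (\<exists>B. finite B \<and> B \<subseteq> X \<and> T ` X \<subseteq> module.span s B)"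

definition approximation_property ::
  "('k::comm_ring_1 \<Rightarrow> 'a::real_normed_vector \<Rightarrow> 'a) \<Rightarrow> 'a set \<Rightarrow> bool" where
  "approximation_property s X \<longleftrightarrow>
     (\<forall>K e. compact K \<and> K \<subseteq> X \<and> 0 < e \<longrightarrow>
        (\<exists>T \<in> bounded_ops s X s X. finite_rank s X T \<and> (\<forall>x\<in>K. norm (T x - x) < e)))"

lemma norm_bounded_ops_le:
  assumes T: "T \<in> bounded_ops s X t Y"
  shows "norm (T x) \<le> onorm T * norm x"
proof (cases "x = 0")
  case True
  have "T 0 = 0"
    using T unfolding bounded_ops_def
    by (cases "0 \<in> X") (force dest: bspec[of X _ 0])+
  with True show ?thesis by simp
next
  case False
  obtain K where K: "\<forall>x\<in>X. norm (T x) \<le> K * norm x"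
    using T unfolding bounded_ops_def by blast
  have "norm (T y) / norm y \<le> max K 0" for y
  proof (cases "y \<in> X \<and> y \<noteq> 0")
    case True
    then have "norm (T y) / norm y \<le> K" using K by (simp add: divide_le_eq)
    then show ?thesis by simp
  next
    case False
    then have "norm (T y) / norm y = 0"
      using T unfolding bounded_ops_def by (cases "y = 0") auto
    then show ?thesis by auto
  qed
  then have "bdd_above (range (\<lambda>y. norm (T y) / norm y))"
    by (intro bdd_aboveI2)
  then have "norm (T x) / norm x \<le> onorm T"
    unfolding onorm_def by (rule cSUP_upper2[OF _ UNIV_I order_refl])
  with False show ?thesis by (simp add: divide_le_eq)
qed

lemma onorm_bounded_ops_le:
  assumes T: "T \<in> bounded_ops s X t Y" and "0 \<le> K"
    and "\<And>x. x \<in> X \<Longrightarrow> norm (T x) \<le> K * norm x"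
  shows "onorm T \<le> K"
proof (rule onorm_bound[OF \<open>0 \<le> K\<close>])
  show "norm (T x) \<le> K * norm x" for x
    using assms unfolding bounded_ops_def by (cases "x \<in> X") auto
qed


subsection \<open>The space of null sequences and sums of its subspaces\<close>

text \<open>
  Since \<open>nat\<close> is discrete, \<open>nat \<Rightarrow>\<^sub>C 'b\<close> is the space of all bounded sequences in \<open>'b\<close>
  with the supremum norm.
\<close>

definition c0 :: "(nat \<Rightarrow>\<^sub>C 'k::rc_field) set" where
  "c0 = {f. apply_bcontfun f \<longlonglongrightarrow> 0}"

definition c0_scale :: "'k::rc_field \<Rightarrow> (nat \<Rightarrow>\<^sub>C 'k) \<Rightarrow> (nat \<Rightarrow>\<^sub>C 'k)" where
  "c0_scale c f = Bcontfun (\<lambda>i. c * f i)"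

definition c0_sum ::
  "(nat \<Rightarrow> (nat \<Rightarrow>\<^sub>C 'k::rc_field) set) \<Rightarrow> (nat \<Rightarrow>\<^sub>C (nat \<Rightarrow>\<^sub>C 'k)) set" where
  "c0_sum Z = {f. (\<forall>n. apply_bcontfun f n \<in> Z n) \<and> apply_bcontfun f \<longlonglongrightarrow> 0}"

definition c0_sum_scale ::
  "'k::rc_field \<Rightarrow> (nat \<Rightarrow>\<^sub>C (nat \<Rightarrow>\<^sub>C 'k)) \<Rightarrow> (nat \<Rightarrow>\<^sub>C (nat \<Rightarrow>\<^sub>C 'k))" where
  "c0_sum_scale c f = Bcontfun (\<lambda>n. c0_scale c (f n))"

lemma apply_Bcontfun_nat:
  fixes f :: "nat \<Rightarrow> 'b::real_normed_vector"
  assumes "\<And>i. norm (f i) \<le> K"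
  shows "apply_bcontfun (Bcontfun f) = f"
  using assms
  by (intro Bcontfun_inverse) (auto simp: bcontfun_def bounded_iff)

lemma apply_c0_scale [simp]: "apply_bcontfun (c0_scale c f) i = c * f i"
proof -
  have "norm (c * f j) \<le> norm c * norm f" for j
    by (simp add: norm_mult mult_left_mono norm_bounded)
  from apply_Bcontfun_nat[OF this] show ?thesis by (simp add: c0_scale_def)
qed

lemma norm_c0_scale: "norm (c0_scale c f) \<le> norm c * norm f"
  by (rule norm_bound) (simp add: norm_mult mult_left_mono norm_bounded)

lemma apply_c0_sum_scale [simp]:
  "apply_bcontfun (c0_sum_scale c f) n = c0_scale c (f n)"
proof -
  have "norm (c0_scale c (f j)) \<le> norm c * norm f" for j
    by (rule order_trans[OF norm_c0_scale]) (simp add: mult_left_mono norm_bounded)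
  from apply_Bcontfun_nat[OF this] show ?thesis by (simp add: c0_sum_scale_def)
qed

interpretation c0: vector_space c0_scale
  by standard (auto intro!: bcontfun_eqI simp: algebra_simps)

interpretation c0_sum: vector_space c0_sum_scale
  by standard
     (auto intro!: bcontfun_eqI simp: algebra_simps)

end

theory Submission
  imports Defs "HOL-Real_Asymp.Real_Asymp"
begin

text \<open>
  The obstruction that separates \<open>n\<close>-subideals from \<open>(n + 1)\<close>-subideals is a trace. Following Davie,
  there is an infinite matrix \<open>Y\<close> with square zero and trace one whose \<open>i\<close>-th row has a norm of the
  order \<open>i powr (- 3 / 2)\<close>, up to a logarithm (\<open>nilpotent_matrix_with_trace_one\<close>). Let \<open>D\<close> be a
  diagonal operator with entries of the order \<open>i powr (- \<alpha>)\<close>, where \<open>1 / p < \<alpha> < 1 / (2 * n)\<close>,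
  and let \<open>Z\<^sub>m\<close> be the closed span in \<open>c\<^sub>0\<close> of the images of the rows under the \<open>m\<close>-th power of \<open>D\<close>.
  For operators \<open>T\<close> from \<open>Z\<^sub>0\<close> to \<open>Z\<^sub>n\<close> one can apply \<open>T\<close> to the \<open>i\<close>-th row, divide the \<open>i\<close>-th
  coordinate of the result by the \<open>n\<close>-th power of the \<open>i\<close>-th entry of \<open>D\<close>, and sum over \<open>i\<close>. The sum
  converges because \<open>n * \<alpha> < 1 / 2\<close>. It is zero for operators of finite rank because the square of \<open>Y\<close>
  is zero, and it is one for the \<open>n\<close>-th power of \<open>D\<close> because the trace of \<open>Y\<close> is one. For \<open>n = 0\<close>
  this is the failure of the approximation property. On the other hand, \<open>D\<close> itself is quasi
  \<open>p\<close>-nuclear, because \<open>p * \<alpha> > 1\<close>.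

  Now let \<open>W\<close> be the direct sum of \<open>Z\<^sub>0, \<dots>, Z\<^sub>n\<close> and a second copy of \<open>Z\<^sub>n\<close>, let \<open>S\<close> map each
  \<open>Z\<^sub>m\<close> with \<open>m < n\<close> to the next one by \<open>D\<close>, and let \<open>R\<close> map \<open>Z\<^sub>n\<close> identically to its copy. The algebra
  in question is the closed span of the powers of \<open>S\<close> and of all products of operators in which \<open>S\<close> occurs
  at least \<open>n + 1\<close> times. Letting the number of occurrences vary from \<open>0\<close> to \<open>n + 1\<close> gives a chain
  that shows that it is an \<open>(n + 1)\<close>-subideal (\<open>subideal_chain\<close>). Every \<open>n\<close>-subideal containing \<open>S\<close>
  contains the product of \<open>R\<close> with the \<open>n\<close>-th power of \<open>S\<close> (\<open>subideal_absorbs\<close>), whose trace from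
  \<open>Z\<^sub>0\<close> to the copy of \<open>Z\<^sub>n\<close> is one. This trace is zero on the powers of \<open>S\<close>. So it remains to see that
  it is zero on products with \<open>n + 1\<close> factors \<open>S\<close> (\<open>\<beta>_words\<close>).

  This is the case because such products are norm limits of operators of finite rank, as a consequence of
  \<open>(n + 1) * \<alpha> > 1 / 2\<close>. If the factors between the shifts are extended to all bounded sequences,
  the coordinates can be cut into dyadic levels. Comparing the products in which all shifts are restricted to levels
  from \<open>t\<close> on, for consecutive \<open>t\<close>, one obtains differences that pass through about \<open>2 ^ t\<close> coordinates and
  gain the size of the entries of \<open>D\<close> on level \<open>t\<close> in each of the \<open>n + 1\<close> factors
  (\<open>dominated_step\<close>). Hence the product is dominated by a Hilbertian seminorm given by a square summable
  family of functionals, and for such seminorms orthogonal projections provide approximations of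
  finite rank with values in the right subspace (\<open>finite_rank_projection\<close>).

  The argument applies to the operators on every space that contains \<open>W\<close> as a retract
  (\<open>retract_subideal\<close>), in particular to \<open>W\<close> itself and to the sum of a sequence of such spaces.
\<close>

section \<open>Balancing signs and Walsh matrices\<close>

text \<open>
  For \<open>\<bar>b\<bar> \<le> 1\<close> the exponentials of \<open>b\<close> and \<open>- b\<close> are at most \<open>1 + b + b\<^sup>2\<close> and \<open>1 - b + b\<^sup>2\<close>.
\<close>

lemma cosh_le_exp_square:
  fixes b :: real
  assumes "\<bar>b\<bar> \<le> 1"
  shows "cosh b \<le> exp (b\<^sup>2)"
proof -
  have "exp x \<le> 1 + x + x\<^sup>2" if "\<bar>x\<bar> \<le> 1" for x :: real
  proof (cases "0 \<le> x")
    case True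
    with that show ?thesis using exp_bound[of x] by simp
  next
    case False
    have "1 + (- x) \<le> exp (- x)" by (rule exp_ge_add_one_self)
    then have "exp x \<le> 1 / (1 - x)"
      using False by (simp add: exp_minus field_simps)
    also have "\<dots> \<le> 1 + x + x\<^sup>2"
    proof -
      have "1 \<le> (1 + x + x\<^sup>2) * (1 - x)"
      proof -
        have "(1 + x + x\<^sup>2) * (1 - x) = 1 - x ^ 3"
          by (simp add: algebra_simps power2_eq_square power3_eq_cube)
        moreover have "x ^ 3 \<le> 0"
          using False by (simp add: power3_eq_cube mult_nonneg_nonpos)
        ultimately show ?thesis by simp
      qed
      then show ?thesis using False by (simp add: divide_le_eq)
    qed
    finally show ?thesis .
  qed
  from this[of b] this[of "- b"] assms have "cosh b \<le> 1 + b\<^sup>2"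
    by (simp add: cosh_field_def)
  also have "\<dots> \<le> exp (b\<^sup>2)" by (rule exp_ge_add_one_self)
  finally show ?thesis .
qed

text \<open>
  The signs are chosen one after the other. For \<open>l = 1 / sqrt N\<close> the potential
  \<open>\<Sum>i. cosh (l * (\<Sum>j<n. s j * v i j))\<close> is multiplied on average over the two choices of
  \<open>s n\<close> by at most \<open>exp (l\<^sup>2)\<close>, so one choice does not do worse. After \<open>N\<close> steps the
  potential is at most \<open>M * exp 1\<close>, and a single large sum would already exceed this.
\<close>

lemma balancing_signs:
  fixes v :: "'i \<Rightarrow> nat \<Rightarrow> real" and M :: real
  assumes fin: "finite I" and v: "\<And>i j. i \<in> I \<Longrightarrow> j < N \<Longrightarrow> \<bar>v i j\<bar> \<le> 1"
    and M: "real (card I) \<le> M" "0 < M" and N: "0 < N"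
  shows "\<exists>s. (\<forall>j. \<bar>s j\<bar> = (1 :: real)) \<and>
     (\<forall>i\<in>I. \<bar>\<Sum>j<N. s j * v i j\<bar> \<le> sqrt N * (1 + ln (2 * M)))"
proof -
  \<comment> \<open>This scale makes the total growth of the potential equal to \<open>exp 1\<close>.\<close>
  define l where "l = 1 / sqrt N"
  have l: "0 < l" "l \<le> 1" "l\<^sup>2 = 1 / N"
    using N by (auto simp: l_def power_divide)
  have "\<exists>s. (\<forall>j. \<bar>s j\<bar> = (1 :: real)) \<and>
     (\<Sum>i\<in>I. cosh (l * (\<Sum>j<n. s j * v i j))) \<le> card I * exp (l\<^sup>2) ^ n"
    if "n \<le> N" for n
    using that
  proof (induction n)
    case 0
    show ?case by (intro exI[of _ "\<lambda>_. 1"]) simp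
  next
    case (Suc n)
    then obtain s where s: "\<And>j. \<bar>s j\<bar> = (1 :: real)"
      and le: "(\<Sum>i\<in>I. cosh (l * (\<Sum>j<n. s j * v i j))) \<le> card I * exp (l\<^sup>2) ^ n"
      by auto
    define a where "a i = l * (\<Sum>j<n. s j * v i j)" for i
    define \<Phi> where "\<Phi> e = (\<Sum>i\<in>I. cosh (a i + e * (l * v i n)))" for e
    have "\<Phi> 1 + \<Phi> (- 1) = (\<Sum>i\<in>I. 2 * (cosh (a i) * cosh (l * v i n)))"
      by (simp add: \<Phi>_def sum.distrib[symmetric] cosh_add cosh_diff)
    also have "\<dots> \<le> (\<Sum>i\<in>I. 2 * (cosh (a i) * exp (l\<^sup>2)))"
    proof (intro sum_mono mult_left_mono)
      fix i assume "i \<in> I"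
      with v Suc.prems have vi: "\<bar>v i n\<bar> \<le> 1" by simp
      have "\<bar>l * v i n\<bar> \<le> l * 1"
        unfolding abs_mult using l vi by (intro mult_mono) auto
      with l have lv: "\<bar>l * v i n\<bar> \<le> l" by simp
      with l have "cosh (l * v i n) \<le> exp ((l * v i n)\<^sup>2)"
        by (intro cosh_le_exp_square) simp
      also have "\<dots> \<le> exp (l\<^sup>2)"
        using power_mono[OF lv, of 2] by simp
      finally show "cosh (l * v i n) \<le> exp (l\<^sup>2)" .
    qed auto
    also have "\<dots> = 2 * (exp (l\<^sup>2) * (\<Sum>i\<in>I. cosh (a i)))"
      by (subst sum_distrib_left)+ (simp only: mult_ac)
    also have "\<dots> \<le> 2 * (card I * exp (l\<^sup>2) ^ Suc n)"
      using le by (simp add: a_def mult_ac)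
    finally have "\<Phi> 1 \<le> card I * exp (l\<^sup>2) ^ Suc n \<or> \<Phi> (- 1) \<le> card I * exp (l\<^sup>2) ^ Suc n"
      by linarith
    then obtain e where e: "\<bar>e\<bar> = (1 :: real)" "\<Phi> e \<le> card I * exp (l\<^sup>2) ^ Suc n"
      by (metis abs_minus_cancel abs_one)
    have "(\<Sum>i\<in>I. cosh (l * (\<Sum>j<Suc n. (s(n := e)) j * v i j))) = \<Phi> e"
      unfolding \<Phi>_def a_def by (intro sum.cong refl arg_cong[where f = cosh])
        (simp add: algebra_simps)
    with e s show ?case by (intro exI[of _ "s(n := e)"]) simp
  qed
  from this[OF order_refl] obtain s where s: "\<And>j. \<bar>s j\<bar> = (1 :: real)"
    and le: "(\<Sum>i\<in>I. cosh (l * (\<Sum>j<N. s j * v i j))) \<le> card I * exp (l\<^sup>2) ^ N"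
    by blast
  have "exp (l\<^sup>2) ^ N = exp 1"
    using l N by (simp add: exp_of_nat_mult[symmetric])
  with le have le: "(\<Sum>i\<in>I. cosh (l * (\<Sum>j<N. s j * v i j))) \<le> card I * exp 1" by simp
  have "\<bar>\<Sum>j<N. s j * v i j\<bar> \<le> sqrt N * (1 + ln (2 * M))" if i: "i \<in> I" for i
  proof -
    define x where "x = (\<Sum>j<N. s j * v i j)"
    have "exp (l * \<bar>x\<bar>) / 2 \<le> cosh (l * \<bar>x\<bar>)" by (simp add: cosh_field_def)
    also have "\<dots> = cosh (l * x)" by (cases "x \<ge> 0") auto
    also have "\<dots> \<le> (\<Sum>i\<in>I. cosh (l * (\<Sum>j<N. s j * v i j)))"
      unfolding x_def by (rule member_le_sum[OF i _ fin, where f = "\<lambda>i. cosh (l * (\<Sum>j<N. s j * v i j))"])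
        (simp add: cosh_real_nonneg)
    also have "\<dots> \<le> card I * exp 1" by (rule le)
    also have "\<dots> \<le> M * exp 1" using M by simp
    finally have "exp (l * \<bar>x\<bar>) \<le> exp (1 + ln (2 * M))"
      using M by (simp add: exp_add mult_ac)
    then have "l * \<bar>x\<bar> \<le> 1 + ln (2 * M)" by simp
    then show ?thesis using N by (simp add: l_def x_def field_simps)
  qed
  with s show ?thesis by blast
qed

lemma sum_lessThan_add:
  fixes f :: "nat \<Rightarrow> 'a::comm_monoid_add"
  shows "(\<Sum>j<a + b. f j) = (\<Sum>j<a. f j) + (\<Sum>j<b. f (a + j))"
  by (induction b) (auto simp: add.assoc)

lemma sum_lessThan_mult:
  fixes f :: "nat \<Rightarrow> 'a::comm_monoid_add"
  shows "(\<Sum>c<r * N. f c) = (\<Sum>t<r. \<Sum>g<N. f (t * N + g))"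
  by (induction r) (auto simp: sum_lessThan_add add.commute[of N])

text \<open>
  The Sylvester-Hadamard matrix of order \<open>2 ^ k\<close>: for \<open>j, g < 2 ^ k\<close> the entry is \<open>- 1\<close>
  to the number of positions at which both \<open>j\<close> and \<open>g\<close> have the binary digit one.
\<close>

fun walsh :: "nat \<Rightarrow> nat \<Rightarrow> nat \<Rightarrow> real" where
  "walsh 0 j g = 1"
| "walsh (Suc k) j g =
     walsh k (j mod 2 ^ k) (g mod 2 ^ k) * (if 2 ^ k \<le> j \<and> 2 ^ k \<le> g then - 1 else 1)"

lemma walsh_sign: "\<bar>walsh k j g\<bar> = 1"
  by (induction k j g rule: walsh.induct) auto

lemma walsh_zero_row: "walsh k 0 g = 1"
  by (induction k arbitrary: g) simp_all

lemma walsh_commute: "walsh k j g = walsh k g j"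
  by (induction k j g rule: walsh.induct) auto

lemma walsh_orthogonal:
  "g < 2 ^ k \<Longrightarrow> h < 2 ^ k \<Longrightarrow>
    (\<Sum>j<2 ^ k. walsh k j g * walsh k j h) = (if g = h then 2 ^ k else 0)"
proof (induction k arbitrary: g h)
  case (Suc k)
  let ?s = "\<lambda>g. if 2 ^ k \<le> g then - 1 else 1 :: real"
  have m: "g mod 2 ^ k < 2 ^ k" for g :: nat by simp
  have "(\<Sum>j<2 ^ Suc k. walsh (Suc k) j g * walsh (Suc k) j h) =
     (\<Sum>j<2 ^ k. walsh k j (g mod 2 ^ k) * walsh k j (h mod 2 ^ k)) * (1 + ?s g * ?s h)"
    unfolding power_Suc mult_2 sum_lessThan_add sum_distrib_right sum.distrib[symmetric]
    by (intro sum.cong refl) (simp add: algebra_simps)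
  also have "\<dots> = (if g mod 2 ^ k = h mod 2 ^ k then 2 ^ k else 0) * (1 + ?s g * ?s h)"
    by (simp add: Suc.IH[OF m m])
  also have "\<dots> = (if g = h then 2 ^ Suc k else 0)"
  proof -
    have red: "x mod 2 ^ k = (if 2 ^ k \<le> x then x - 2 ^ k else x)" if "x < 2 ^ Suc k" for x :: nat
      using that by (cases "2 ^ k \<le> x") (simp_all add: le_mod_geq[of "2 ^ k" x])
    show ?thesis
      unfolding red[OF Suc.prems(1)] red[OF Suc.prems(2)]
      by (cases "2 ^ k \<le> g"; cases "2 ^ k \<le> h"; force)
  qed
  finally show ?case .
qed simp

text \<open>
  Multiplying the rows of the Walsh matrix by different sign vectors gives orthogonal bases that
  are almost unbiased to each other: up to a logarithm, the mixed products have the square root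
  of the trivial size. The four sign vectors are found successively, each one balanced against
  the products of Walsh columns with the earlier ones.
\<close>

lemma pairwise_flat_signs:
  "\<exists>\<epsilon>. (\<forall>t j. \<bar>\<epsilon> t j\<bar> = (1 :: real)) \<and>
     (\<forall>t<4. \<forall>t'<4. \<forall>g<2 ^ k. \<forall>h<2 ^ k. t \<noteq> (t' :: nat) \<longrightarrow>
        \<bar>\<Sum>j<2 ^ k. \<epsilon> t j * \<epsilon> t' j * (walsh k j g * walsh k j h)\<bar>
          \<le> 4 * (real k + 1) * sqrt (2 ^ k))"
proof -
  let ?B = "4 * (real k + 1) * sqrt (2 ^ k)"
  define flat where "flat \<epsilon> t t' g h \<longleftrightarrow>
    \<bar>\<Sum>j<2 ^ k. \<epsilon> t j * \<epsilon> t' j * (walsh k j g * walsh k j h)\<bar> \<le> ?B"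
    for \<epsilon> :: "nat \<Rightarrow> nat \<Rightarrow> real" and t t' g h :: nat
  have "\<exists>\<epsilon>. (\<forall>t j. \<bar>\<epsilon> t j\<bar> = (1 :: real)) \<and>
     (\<forall>t<r. \<forall>t'<t. \<forall>g<2 ^ k. \<forall>h<2 ^ k. flat \<epsilon> t t' g h)"
    if "r \<le> 4" for r :: nat
    using that
  proof (induction r)
    case 0
    show ?case by (intro exI[of _ "\<lambda>_ _. 1"]) simp
  next
    case (Suc r)
    have "r \<le> 4" using Suc.prems by simp
    from Suc.IH[OF this] obtain \<epsilon> where *: "(\<forall>t j. \<bar>\<epsilon> t j\<bar> = (1 :: real)) \<and>
      (\<forall>t<r. \<forall>t'<t. \<forall>g<2 ^ k. \<forall>h<2 ^ k. flat \<epsilon> t t' g h)" ..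
    note \<epsilon> = conjunct1[OF *, rule_format] and flat = conjunct2[OF *, rule_format]
    define I :: "(nat \<times> nat \<times> nat) set" where "I = {..<r} \<times> {..<2 ^ k} \<times> {..<2 ^ k}"
    define v where "v = (\<lambda>(t, g, h) j. \<epsilon> t j * (walsh k j g * walsh k j h))"
    have "\<bar>v i j\<bar> \<le> 1" for i j
      using \<epsilon>[of "fst i" j] walsh_sign[of k j "fst (snd i)"] walsh_sign[of k j "snd (snd i)"]
      by (auto simp: v_def abs_mult split: prod.splits)
    moreover have "real (card I) \<le> 2 ^ (2 * k + 2)"
    proof -
      have "real (card I) = real r * (2 ^ k * 2 ^ k)" by (simp add: I_def)
      also have "\<dots> \<le> 4 * (2 ^ k * 2 ^ k)"
        using Suc.prems by (intro mult_right_mono) auto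
      also have "\<dots> = 2 ^ (2 * k + 2)"
        by (simp add: power_add power_mult power_mult_distrib[symmetric])
      finally show ?thesis .
    qed
    moreover have "finite I" by (simp add: I_def)
    ultimately have "\<exists>s. (\<forall>j. \<bar>s j\<bar> = (1 :: real)) \<and> (\<forall>i\<in>I. \<bar>\<Sum>j<2 ^ k. s j * v i j\<bar>
           \<le> sqrt (real (2 ^ k)) * (1 + ln (2 * 2 ^ (2 * k + 2))))"
      by (intro balancing_signs) auto
    then obtain s where s: "\<And>j. \<bar>s j\<bar> = (1 :: real)" and
      fl: "\<And>i. i \<in> I \<Longrightarrow> \<bar>\<Sum>j<2 ^ k. s j * v i j\<bar>
           \<le> sqrt (2 ^ k) * (1 + ln (2 * 2 ^ (2 * k + 2)))"
      unfolding of_nat_power of_nat_numeral by blast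
    have "ln (2 * 2 ^ (2 * k + 2)) = ln ((2::real) ^ (2 * k + 3))" by (simp add: power_add)
    also have "\<dots> = real (2 * k + 3) * ln 2" by (rule ln_realpow)
    also have "\<dots> \<le> real (2 * k + 3) * 1"
      using ln_le_minus_one[of 2] by (intro mult_left_mono) auto
    finally have "1 + ln (2 * 2 ^ (2 * k + 2)) \<le> 4 * (real k + 1)" by simp
    then have "sqrt (2 ^ k) * (1 + ln (2 * 2 ^ (2 * k + 2))) \<le> ?B"
      unfolding mult.commute[of "sqrt _"] by (rule mult_right_mono) simp
    with fl have fl: "\<bar>\<Sum>j<2 ^ k. s j * v i j\<bar> \<le> ?B" if "i \<in> I" for i
      using that order_trans by blast
    define \<epsilon>' where "\<epsilon>' = \<epsilon>(r := s)"
    have "flat \<epsilon>' t t' g h"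
      if "t < Suc r" "t' < t" "g < 2 ^ k" "h < 2 ^ k" for t t' g h
    proof (cases "t = r")
      case True
      with that fl[of "(t', g, h)"] show ?thesis
        by (simp add: \<epsilon>'_def v_def I_def flat_def mult.assoc)
    next
      case False
      with that flat[of t t' g h] show ?thesis by (simp add: \<epsilon>'_def flat_def)
    qed
    moreover have "\<bar>\<epsilon>' t j\<bar> = 1" for t j
      using \<epsilon>[of t j] s[of j] by (simp add: \<epsilon>'_def)
    ultimately show ?case by blast
  qed
  from this[OF order_refl] obtain \<epsilon> where *: "(\<forall>t j. \<bar>\<epsilon> t j\<bar> = (1 :: real)) \<and>
      (\<forall>t<4. \<forall>t'<t. \<forall>g<2 ^ k. \<forall>h<2 ^ k. flat \<epsilon> t t' g h)" ..
  note \<epsilon> = conjunct1[OF *, rule_format] and flat = conjunct2[OF *, rule_format]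
  have "flat \<epsilon> t t' g h"
    if "t < 4" "t' < 4" "g < 2 ^ k" "h < 2 ^ k" "t \<noteq> t'" for t t' g h
  proof (cases "t' < t")
    case False
    with that have "flat \<epsilon> t' t g h" by (intro flat) auto
    then show ?thesis by (simp add: flat_def mult.commute[of "\<epsilon> t _"])
  qed (use that flat in blast)
  with \<epsilon> show ?thesis unfolding flat_def by blast
qed

section \<open>A matrix with square zero and trace one\<close>

text \<open>
  The columns at level \<open>k\<close> form four blocks, each carrying the Walsh matrix of order \<open>2 ^ k\<close>
  with its own signs. Tensoring with a row \<open>s\<close> of the Walsh matrix of order four gives \<open>2 ^ k\<close>
  rows; \<open>s = 0\<close> gives \<open>P\<close> and \<open>s = 1, 2\<close> give \<open>Q\<close>. So there are twice as many rows \<open>Q\<close> as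
  rows \<open>P\<close>, and \<open>Q\<close> at level \<open>k\<close> has the same index set as \<open>P\<close> at level \<open>k + 1\<close>. Inside a block
  the two averages of products of columns are both the identity matrix, so that their difference
  is zero; between different blocks both are small by the choice of the signs. The last property
  compares consecutive levels; it is achieved by further signs \<open>\<theta>\<close> in front of the rows \<open>P\<close>.
\<close>

lemma flat_orthogonal_rows:
  obtains Q P :: "nat \<Rightarrow> nat \<Rightarrow> nat \<Rightarrow> real" where
    "\<And>k j c. \<bar>Q k j c\<bar> = 1" "\<And>k j c. \<bar>P k j c\<bar> = 1"
    "\<And>k i j. i < 2 ^ (k + 1) \<Longrightarrow> j < 2 ^ (k + 1) \<Longrightarrow>
       (\<Sum>c<2 ^ (k + 2). Q k i c * Q k j c) = (if i = j then 2 ^ (k + 2) else 0)"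
    "\<And>k i j. i < 2 ^ k \<Longrightarrow> j < 2 ^ k \<Longrightarrow>
       (\<Sum>c<2 ^ (k + 2). P k i c * P k j c) = (if i = j then 2 ^ (k + 2) else 0)"
    "\<And>k i j. i < 2 ^ (k + 1) \<Longrightarrow> j < 2 ^ k \<Longrightarrow> (\<Sum>c<2 ^ (k + 2). Q k i c * P k j c) = 0"
    "\<And>k c d. c < 2 ^ (k + 2) \<Longrightarrow> d < 2 ^ (k + 2) \<Longrightarrow>
       \<bar>(\<Sum>j<2 ^ (k + 1). Q k j c * Q k j d) / 2 ^ (k + 1) - (\<Sum>j<2 ^ k. P k j c * P k j d) / 2 ^ k\<bar>
         \<le> 8 * (real k + 1) / sqrt (2 ^ k)"
    "\<And>k c d. c < 2 ^ (k + 2) \<Longrightarrow> d < 2 ^ (k + 3) \<Longrightarrow>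
       \<bar>\<Sum>j<2 ^ (k + 1). Q k j c * P (k + 1) j d\<bar> / 2 ^ (k + 1) \<le> 8 * (real k + 1) / sqrt (2 ^ k)"
proof -
  have "\<exists>\<epsilon>. \<forall>k. (\<forall>t j. \<bar>\<epsilon> k t j\<bar> = (1 :: real)) \<and>
     (\<forall>t<4. \<forall>t'<4. \<forall>g<2 ^ k. \<forall>h<2 ^ k. t \<noteq> (t' :: nat) \<longrightarrow>
        \<bar>\<Sum>j<2 ^ k. \<epsilon> k t j * \<epsilon> k t' j * (walsh k j g * walsh k j h)\<bar>
          \<le> 4 * (real k + 1) * sqrt (2 ^ k))"
    by (rule choice) (use pairwise_flat_signs in blast)
  then obtain \<epsilon> where E: "\<forall>k. (\<forall>t j. \<bar>\<epsilon> k t j\<bar> = (1 :: real)) \<and>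
     (\<forall>t<4. \<forall>t'<4. \<forall>g<2 ^ k. \<forall>h<2 ^ k. t \<noteq> (t' :: nat) \<longrightarrow>
        \<bar>\<Sum>j<2 ^ k. \<epsilon> k t j * \<epsilon> k t' j * (walsh k j g * walsh k j h)\<bar>
          \<le> 4 * (real k + 1) * sqrt (2 ^ k))" ..
  have \<epsilon>: "\<bar>\<epsilon> k t j\<bar> = 1" for k t j using E by blast
  have \<epsilon>2: "\<epsilon> k t j * \<epsilon> k t j = 1" for k t j
    using abs_mult_self_eq[of "\<epsilon> k t j"] by (simp add: \<epsilon>)
  have flat: "\<bar>\<Sum>j<2 ^ k. \<epsilon> k t j * \<epsilon> k t' j * (walsh k j g * walsh k j h)\<bar>
          \<le> 4 * (real k + 1) * sqrt (2 ^ k)"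
    if "t < 4" "t' < 4" "g < 2 ^ k" "h < 2 ^ k" "t \<noteq> t'" for k t t' g h
    using E that by blast
  define X where "X k s j c = walsh 2 s (c div 2 ^ k) * (walsh k j (c mod 2 ^ k) * \<epsilon> k (c div 2 ^ k) j)"
    for k s j c :: nat
  have X_abs: "\<bar>X k s j c\<bar> = 1" for k s j c
    by (simp add: X_def abs_mult walsh_sign \<epsilon>)
  have X_orth: "(\<Sum>c<2 ^ (k + 2). X k s i c * X k s' j c) = (if s = s' \<and> i = j then 2 ^ (k + 2) else 0)"
    if "s < 4" "s' < 4" "i < 2 ^ k" "j < 2 ^ k" for k s s' i j
  proof -
    have "(\<Sum>c<2 ^ (k + 2). X k s i c * X k s' j c) = (\<Sum>c<4 * 2 ^ k. X k s i c * X k s' j c)"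
      by (simp add: power_add mult.commute)
    also have "\<dots> = (\<Sum>t<4. walsh 2 s t * walsh 2 s' t * (\<epsilon> k t i * \<epsilon> k t j) *
                  (\<Sum>g<2 ^ k. walsh k i g * walsh k j g))"
      unfolding sum_lessThan_mult sum_distrib_left
      by (intro sum.cong refl) (simp add: X_def mult_ac)
    also have "\<dots> = (\<Sum>t<4. walsh 2 s t * walsh 2 s' t * (\<epsilon> k t i * \<epsilon> k t j) * (if i = j then 2 ^ k else 0))"
      using walsh_orthogonal[of i k j] that by (simp add: walsh_commute[of k _ i] walsh_commute[of k _ j])
    also have "\<dots> = (if i = j then 2 ^ k else 0) * (\<Sum>t<2 ^ 2. walsh 2 t s * walsh 2 t s')"
    proof (cases "i = j")
      case True
      show ?thesis
        unfolding True \<epsilon>2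
        by (simp add: sum_distrib_left mult_ac walsh_commute[of 2 s] walsh_commute[of 2 s'])
    qed simp
    also have "\<dots> = (if s = s' \<and> i = j then 2 ^ (k + 2) else 0)"
      using walsh_orthogonal[of s 2 s'] that by (simp add: power_add)
    finally show ?thesis .
  qed
  define Y where "Y k c d = (\<Sum>j<2 ^ k. \<epsilon> k (c div 2 ^ k) j * \<epsilon> k (d div 2 ^ k) j *
      (walsh k j (c mod 2 ^ k) * walsh k j (d mod 2 ^ k)))" for k c d :: nat
  have X_sum: "(\<Sum>j<2 ^ k. X k s j c * X k s j d) =
      walsh 2 s (c div 2 ^ k) * walsh 2 s (d div 2 ^ k) * Y k c d" for k s c d
    unfolding Y_def sum_distrib_left by (intro sum.cong refl) (simp add: X_def mult_ac)
  define Q where "Q k j c = X k (1 + j div 2 ^ k) (j mod 2 ^ k) c" for k j c :: nat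
  have "\<exists>\<theta>. \<forall>k. (\<forall>j. \<bar>\<theta> k j\<bar> = (1 :: real)) \<and> (\<forall>i\<in>{..<2 ^ (k + 2)} \<times> {..<2 ^ (k + 3)}.
      \<bar>\<Sum>j<2 ^ (k + 1). \<theta> k j * (Q k j (fst i) * X (k + 1) 0 j (snd i))\<bar>
        \<le> sqrt (2 ^ (k + 1)) * (1 + ln (2 * 2 ^ (2 * k + 5))))"
  proof (rule choice, rule allI)
    fix k
    show "\<exists>\<theta>. (\<forall>j. \<bar>\<theta> j\<bar> = (1 :: real)) \<and> (\<forall>i\<in>{..<2 ^ (k + 2)} \<times> {..<2 ^ (k + 3)}.
      \<bar>\<Sum>j<2 ^ (k + 1). \<theta> j * (Q k j (fst i) * X (k + 1) 0 j (snd i))\<bar>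
        \<le> sqrt (2 ^ (k + 1)) * (1 + ln (2 * 2 ^ (2 * k + 5))))"
      using balancing_signs[of "{..<2 ^ (k + 2)} \<times> {..<2 ^ (k + 3)}" "2 ^ (k + 1)"
          "\<lambda>i j. Q k j (fst i) * X (k + 1) 0 j (snd i)" "2 ^ (2 * k + 5)"]
      by (simp add: Q_def X_abs abs_mult power_add power_mult power_mult_distrib[symmetric])
  qed
  then obtain \<theta> where T: "\<forall>k. (\<forall>j. \<bar>\<theta> k j\<bar> = (1 :: real)) \<and> (\<forall>i\<in>{..<2 ^ (k + 2)} \<times> {..<2 ^ (k + 3)}.
      \<bar>\<Sum>j<2 ^ (k + 1). \<theta> k j * (Q k j (fst i) * X (k + 1) 0 j (snd i))\<bar>
        \<le> sqrt (2 ^ (k + 1)) * (1 + ln (2 * 2 ^ (2 * k + 5))))" ..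
  have \<theta>: "\<bar>\<theta> k j\<bar> = 1" for k j using T by blast
  have \<theta>_flat: "\<bar>\<Sum>j<2 ^ (k + 1). \<theta> k j * (Q k j c * X (k + 1) 0 j d)\<bar>
        \<le> sqrt (2 ^ (k + 1)) * (1 + ln (2 * 2 ^ (2 * k + 5)))"
    if "c < 2 ^ (k + 2)" "d < 2 ^ (k + 3)" for k c d
    using T[rule_format, of k] bspec[OF conjunct2[OF T[rule_format, of k]], of "(c, d)"] that
    unfolding fst_conv snd_conv by blast
  have \<theta>2: "\<theta> k j * \<theta> k j = 1" for k j
    using abs_mult_self_eq[of "\<theta> k j"] by (simp add: \<theta>)
  \<comment> \<open>The signs of level \<open>k - 1\<close> belong to the pairing of \<open>Q (k - 1)\<close> with \<open>P k\<close>.\<close>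
  define P where "P k j c = \<theta> (k - 1) j * X k 0 j c" for k j c :: nat
  have Q_sum: "(\<Sum>j<2 ^ (k + 1). Q k j c * Q k j d) =
      (\<Sum>s<2. walsh 2 (1 + s) (c div 2 ^ k) * walsh 2 (1 + s) (d div 2 ^ k)) * Y k c d" for k c d
  proof -
    have "(\<Sum>j<2 ^ (k + 1). Q k j c * Q k j d) = (\<Sum>j<2 * 2 ^ k. Q k j c * Q k j d)" by simp
    also have "\<dots> = (\<Sum>s<2. \<Sum>j<2 ^ k. X k (1 + s) j c * X k (1 + s) j d)"
      unfolding sum_lessThan_mult by (intro sum.cong refl) (simp add: Q_def)
    finally show ?thesis by (simp only: X_sum sum_distrib_right)
  qed
  have P_sum: "(\<Sum>j<2 ^ k. P k j c * P k j d) = Y k c d" for k c d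
  proof -
    have "(\<Sum>j<2 ^ k. P k j c * P k j d) = (\<Sum>j<2 ^ k. (\<theta> (k - 1) j * \<theta> (k - 1) j) * (X k 0 j c * X k 0 j d))"
      by (intro sum.cong refl) (simp add: P_def mult_ac)
    also have "\<dots> = Y k c d" unfolding \<theta>2 by (simp add: X_sum walsh_zero_row)
    finally show ?thesis .
  qed
  have small: "x < 4 \<and> y < 4" if "x = 1 + i div 2 ^ k" "y = 1 + j div 2 ^ k"
    "i < 2 ^ (k + 1)" "j < 2 ^ (k + 1)" for i j k x y :: nat
    using that less_mult_imp_div_less[of i 2 "2 ^ k"] less_mult_imp_div_less[of j 2 "2 ^ k"] by simp
  show ?thesis
  proof (rule that[of Q P])
    fix k
    show "\<bar>Q k j c\<bar> = 1" "\<bar>P k j c\<bar> = 1" for j c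
      by (simp_all add: Q_def P_def X_abs abs_mult \<theta>)
    show "(\<Sum>c<2 ^ (k + 2). Q k i c * Q k j c) = (if i = j then 2 ^ (k + 2) else 0)"
      if "i < 2 ^ (k + 1)" "j < 2 ^ (k + 1)" for i j
    proof -
      have "(i div 2 ^ k = j div 2 ^ k \<and> i mod 2 ^ k = j mod 2 ^ k) = (i = j)"
        by (metis div_mult_mod_eq)
      then show ?thesis
        unfolding Q_def using small[OF refl refl that] by (subst X_orth) auto
    qed
    show "(\<Sum>c<2 ^ (k + 2). P k i c * P k j c) = (if i = j then 2 ^ (k + 2) else 0)"
      if "i < 2 ^ k" "j < 2 ^ k" for i j
    proof -
      have "(\<Sum>c<2 ^ (k + 2). P k i c * P k j c) =
         \<theta> (k - 1) i * \<theta> (k - 1) j * (\<Sum>c<2 ^ (k + 2). X k 0 i c * X k 0 j c)"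
        unfolding sum_distrib_left by (intro sum.cong refl) (simp add: P_def mult_ac)
      then show ?thesis using X_orth[of 0 0 i k j] that by (auto simp: \<theta>2)
    qed
    show "(\<Sum>c<2 ^ (k + 2). Q k i c * P k j c) = 0" if "i < 2 ^ (k + 1)" "j < 2 ^ k" for i j
    proof -
      have "(\<Sum>c<2 ^ (k + 2). Q k i c * P k j c) =
         \<theta> (k - 1) j * (\<Sum>c<2 ^ (k + 2). X k (1 + i div 2 ^ k) (i mod 2 ^ k) c * X k 0 j c)"
        unfolding sum_distrib_left by (intro sum.cong refl) (simp add: P_def Q_def mult_ac)
      then show ?thesis using small[OF refl refl that(1) that(1)] that by (subst (asm) X_orth) auto
    qed
    show "\<bar>(\<Sum>j<2 ^ (k + 1). Q k j c * Q k j d) / 2 ^ (k + 1) - (\<Sum>j<2 ^ k. P k j c * P k j d) / 2 ^ k\<bar>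
         \<le> 8 * (real k + 1) / sqrt (2 ^ k)"
      if cd: "c < 2 ^ (k + 2)" "d < 2 ^ (k + 2)" for c d
    proof -
      let ?t = "c div 2 ^ k" and ?t' = "d div 2 ^ k"
      define w where "w = (\<Sum>s<2. walsh 2 (1 + s) ?t * walsh 2 (1 + s) ?t')"
      have eq: "(\<Sum>j<2 ^ (k + 1). Q k j c * Q k j d) / 2 ^ (k + 1) - (\<Sum>j<2 ^ k. P k j c * P k j d) / 2 ^ k
          = (w / 2 - 1) * (Y k c d / 2 ^ k)"
        unfolding Q_sum P_sum w_def by (simp add: field_simps)
      have ww: "walsh k j g * walsh k j g = 1" for k j g
        using abs_mult_self_eq[of "walsh k j g"] by (simp add: walsh_sign)
      have t: "?t < 4" "?t' < 4"
        using cd less_mult_imp_div_less[of c 4 "2 ^ k"] less_mult_imp_div_less[of d 4 "2 ^ k"]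
        by (simp_all add: power_add)
      show ?thesis
      proof (cases "?t = ?t'")
        case True
        then have "w = 2" by (simp add: w_def ww)
        then show ?thesis unfolding eq by simp
      next
        case False
        have "\<bar>w\<bar> \<le> (\<Sum>s<2. \<bar>walsh 2 (1 + s) ?t * walsh 2 (1 + s) ?t'\<bar>)"
          unfolding w_def by (rule sum_abs)
        then have "\<bar>w\<bar> \<le> 2" by (simp add: abs_mult walsh_sign)
        then have w: "\<bar>w / 2 - 1\<bar> \<le> 2" by simp
        have "\<bar>Y k c d\<bar> \<le> 4 * (real k + 1) * sqrt (2 ^ k)"
          unfolding Y_def using False t by (intro flat) auto
        then have "\<bar>Y k c d / 2 ^ k\<bar> \<le> 4 * (real k + 1) * sqrt (2 ^ k) / 2 ^ k"
          by (simp add: divide_right_mono)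
        also have "\<dots> = 4 * (real k + 1) / sqrt (2 ^ k)"
          by (simp add: field_simps)
        finally have "\<bar>w / 2 - 1\<bar> * \<bar>Y k c d / 2 ^ k\<bar> \<le> 2 * (4 * (real k + 1) / sqrt (2 ^ k))"
          using w by (intro mult_mono) auto
        then show ?thesis unfolding eq abs_mult by simp
      qed
    qed
    show "\<bar>\<Sum>j<2 ^ (k + 1). Q k j c * P (k + 1) j d\<bar> / 2 ^ (k + 1) \<le> 8 * (real k + 1) / sqrt (2 ^ k)"
      if cd: "c < 2 ^ (k + 2)" "d < 2 ^ (k + 3)" for c d
    proof -
      have "ln (2 * 2 ^ (2 * k + 5)) = ln ((2::real) ^ (2 * k + 6))" by (simp add: power_add)
      also have "\<dots> = real (2 * k + 6) * ln 2" by (rule ln_realpow)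
      also have "\<dots> \<le> real (2 * k + 6) * 1"
        using ln_le_minus_one[of 2] by (intro mult_left_mono) auto
      finally have ln: "1 + ln (2 * 2 ^ (2 * k + 5)) \<le> 8 * (real k + 1)" by simp
      have "(\<Sum>j<2 ^ (k + 1). Q k j c * P (k + 1) j d) = (\<Sum>j<2 ^ (k + 1). \<theta> k j * (Q k j c * X (k + 1) 0 j d))"
        by (intro sum.cong refl) (simp add: P_def mult_ac)
      then have "\<bar>\<Sum>j<2 ^ (k + 1). Q k j c * P (k + 1) j d\<bar>
           \<le> sqrt (2 ^ (k + 1)) * (1 + ln (2 * 2 ^ (2 * k + 5)))"
        using \<theta>_flat[OF cd] by simp
      also have "\<dots> \<le> sqrt (2 ^ (k + 1)) * (8 * (real k + 1))"
        using ln by (rule mult_left_mono) simp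
      finally have "\<bar>\<Sum>j<2 ^ (k + 1). Q k j c * P (k + 1) j d\<bar> / 2 ^ (k + 1)
          \<le> sqrt (2 ^ (k + 1)) * (8 * (real k + 1)) / 2 ^ (k + 1)"
        by (rule divide_right_mono) simp
      also have "\<dots> = 8 * (real k + 1) / sqrt (2 ^ (k + 1))"
        using real_sqrt_mult_self[of "2 ^ (k + 1)"] by (simp add: field_simps del: power_Suc)
      also have "\<dots> \<le> 8 * (real k + 1) / sqrt (2 ^ k)"
        by (intro divide_left_mono) (auto intro: mult_pos_pos)
      finally show ?thesis .
    qed
  qed
qed

lemma sum_combination_mult:
  fixes f :: "'i \<Rightarrow> 'x \<Rightarrow> real"
  shows "(\<Sum>x\<in>S. (\<Sum>j\<in>J. q j * f j x) * y x) = (\<Sum>j\<in>J. q j * (\<Sum>x\<in>S. f j x * y x))"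
  unfolding sum_distrib_left sum_distrib_right by (subst sum.swap) (simp add: mult.assoc)

text \<open>
  Let \<open>e l j\<close> be the vector that is \<open>Q l j\<close> at level \<open>l\<close> and \<open>P (l + 1) j\<close> at level \<open>l + 1\<close>.
  Row \<open>(k, c)\<close> of \<open>Y\<close> is the average of \<open>e k j\<close> with weights \<open>Q k j c\<close> minus the average of
  \<open>e (k - 1) j\<close> with weights \<open>P k j c\<close>, divided by the number of columns. By orthogonality, the rows
  of level \<open>l\<close> combined with weights \<open>Q l j\<close> give a multiple of \<open>e l j\<close>, and the rows of level
  \<open>l + 1\<close> combined with weights \<open>P (l + 1) j\<close> give its negative. So \<open>e l j\<close>, as a row vector,
  is annihilated by \<open>Y\<close>, and as every row of \<open>Y\<close> is a combination of such vectors, the square of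
  \<open>Y\<close> is zero. On the diagonal the two averages cancel, except at level zero, where there is only
  the first one; this makes the trace equal to one.
\<close>

theorem nilpotent_matrix_with_trace_one:
  obtains Y :: "nat \<Rightarrow> nat \<Rightarrow> nat \<Rightarrow> nat \<Rightarrow> real" where
    "\<And>k c k' c'. 2 ^ (k' + 2) \<le> c' \<Longrightarrow> Y k c k' c' = 0"
    "\<And>k c k' c'. k + 1 < k' \<Longrightarrow> Y k c k' c' = 0"
    "\<And>k c k' c'. c < 2 ^ (k + 2) \<Longrightarrow> \<bar>Y k c k' c'\<bar> \<le> 4 * (real k + 1) / (2 ^ k * sqrt (2 ^ k))"
    "\<And>k c. c < 2 ^ (k + 2) \<Longrightarrow> Y k c k c = (if k = 0 then 1 / 4 else 0)"
    "\<And>k c k'' c''. (\<Sum>k'\<le>k + 1. \<Sum>c'<2 ^ (k' + 2). Y k c k' c' * Y k' c' k'' c'') = 0"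
proof -
  obtain Q P :: "nat \<Rightarrow> nat \<Rightarrow> nat \<Rightarrow> real" where
    Q: "\<And>k j c. \<bar>Q k j c\<bar> = 1" and P: "\<And>k j c. \<bar>P k j c\<bar> = 1" and
    QQ: "\<And>k i j. i < 2 ^ (k + 1) \<Longrightarrow> j < 2 ^ (k + 1) \<Longrightarrow>
       (\<Sum>c<2 ^ (k + 2). Q k i c * Q k j c) = (if i = j then 2 ^ (k + 2) else 0)" and
    PP: "\<And>k i j. i < 2 ^ k \<Longrightarrow> j < 2 ^ k \<Longrightarrow>
       (\<Sum>c<2 ^ (k + 2). P k i c * P k j c) = (if i = j then 2 ^ (k + 2) else 0)" and
    QP: "\<And>k i j. i < 2 ^ (k + 1) \<Longrightarrow> j < 2 ^ k \<Longrightarrow> (\<Sum>c<2 ^ (k + 2). Q k i c * P k j c) = 0" and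
    diag: "\<And>k c d. c < 2 ^ (k + 2) \<Longrightarrow> d < 2 ^ (k + 2) \<Longrightarrow>
       \<bar>(\<Sum>j<2 ^ (k + 1). Q k j c * Q k j d) / 2 ^ (k + 1) - (\<Sum>j<2 ^ k. P k j c * P k j d) / 2 ^ k\<bar>
         \<le> 8 * (real k + 1) / sqrt (2 ^ k)" and
    off: "\<And>k c d. c < 2 ^ (k + 2) \<Longrightarrow> d < 2 ^ (k + 3) \<Longrightarrow>
       \<bar>\<Sum>j<2 ^ (k + 1). Q k j c * P (k + 1) j d\<bar> / 2 ^ (k + 1) \<le> 8 * (real k + 1) / sqrt (2 ^ k)"
    by (rule flat_orthogonal_rows, rule that) assumption+
  have Q2: "Q k j c * Q k j c = 1" and P2: "P k j c * P k j c = 1" for k j c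
    using abs_mult_self_eq[of "Q k j c"] abs_mult_self_eq[of "P k j c"] by (simp_all add: Q P)
  define e where "e l j k c = (if c < 2 ^ (k + 2) then
      if k = l then Q l j c else if k = l + 1 then P (l + 1) j c else 0 else 0)" for l j k c :: nat
  define R where "R k = (1 / 2 ^ (k + 2) :: real)" for k :: nat
  define A where "A k c k' c' = (\<Sum>j<2 ^ (k + 1). Q k j c * e k j k' c') / 2 ^ (k + 1)" for k c k' c'
  define B where "B k c k' c' = (if k = 0 then 0 else (\<Sum>j<2 ^ k. P k j c * e (k - 1) j k' c') / 2 ^ k)"
    for k c k' c'
  define Y where "Y k c k' c' = R k * (A k c k' c' - B k c k' c')" for k c k' c'
  have R: "0 < R k" for k by (simp add: R_def)
  have vanish: "(\<Sum>k'\<le>k + 1. \<Sum>c'<2 ^ (k' + 2). e l j k' c' * Y k' c' k'' c'') = 0"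
    if "l \<le> k" "j < 2 ^ (l + 1)" for l j k k'' c''
  proof -
    have "(\<Sum>c<2 ^ (l + 2). Q l j c * Y l c k'' c'') = e l j k'' c'' / 2 ^ (l + 1)"
    proof -
      have 1: "(\<Sum>c<2 ^ (l + 2). A l c k'' c'' * Q l j c) =
         (\<Sum>i<2 ^ (l + 1). e l i k'' c'' * (\<Sum>c<2 ^ (l + 2). Q l i c * Q l j c)) / 2 ^ (l + 1)"
        unfolding A_def sum_combination_mult[symmetric] sum_divide_distrib[of _ "{..<2 ^ (l + 2)}"]
        by (intro sum.cong refl) (simp add: mult_ac sum_distrib_left)
      also have "\<dots> = (\<Sum>i<2 ^ (l + 1). if i = j then e l j k'' c'' * 2 ^ (l + 2) else 0) / 2 ^ (l + 1)"
        using that QQ[of _ l j] by (intro arg_cong2[where f = "(/)"] sum.cong refl) auto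
      also have "\<dots> = e l j k'' c'' * 2 ^ (l + 2) / 2 ^ (l + 1)"
        using that by (simp add: sum.delta)
      finally have 1: "(\<Sum>c<2 ^ (l + 2). A l c k'' c'' * Q l j c) = e l j k'' c'' * 2 ^ (l + 2) / 2 ^ (l + 1)" .
      have 2: "(\<Sum>c<2 ^ (l + 2). B l c k'' c'' * Q l j c) = 0"
      proof (cases "l = 0")
        case False
        have "(\<Sum>c<2 ^ (l + 2). B l c k'' c'' * Q l j c) =
          (\<Sum>i<2 ^ l. e (l - 1) i k'' c'' * (\<Sum>c<2 ^ (l + 2). P l i c * Q l j c)) / 2 ^ l"
          unfolding B_def sum_combination_mult[symmetric] sum_divide_distrib[of _ "{..<2 ^ (l + 2)}"]
          using False by (intro sum.cong refl) (simp add: mult_ac sum_distrib_left)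
        also have "\<dots> = (\<Sum>i<2 ^ l. e (l - 1) i k'' c'' * 0) / 2 ^ l"
          using that QP[of j l] by (intro arg_cong2[where f = "(/)"] sum.cong refl) (auto simp: mult.commute)
        finally show ?thesis by simp
      qed (simp add: B_def)
      have "(\<Sum>c<2 ^ (l + 2). Q l j c * Y l c k'' c'') =
         R l * ((\<Sum>c<2 ^ (l + 2). A l c k'' c'' * Q l j c) - (\<Sum>c<2 ^ (l + 2). B l c k'' c'' * Q l j c))"
        unfolding sum_subtractf[symmetric] sum_distrib_left
        by (intro sum.cong refl) (simp add: Y_def algebra_simps)
      then show ?thesis unfolding 1 2 R_def by simp
    qed
    moreover have "(\<Sum>c<2 ^ (l + 3). P (l + 1) j c * Y (l + 1) c k'' c'') = - (e l j k'' c'' / 2 ^ (l + 1))"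
    proof -
      have "(\<Sum>c<2 ^ (l + 3). A (l + 1) c k'' c'' * P (l + 1) j c) =
         (\<Sum>i<2 ^ (l + 2). e (l + 1) i k'' c'' * (\<Sum>c<2 ^ (l + 3). Q (l + 1) i c * P (l + 1) j c)) / 2 ^ (l + 2)"
        unfolding A_def sum_combination_mult[symmetric] sum_divide_distrib[of _ "{..<2 ^ (l + 3)}"]
        by (intro sum.cong) (simp_all add: mult_ac sum_distrib_left)
      also have "\<dots> = (\<Sum>i<2 ^ (l + 2). e (l + 1) i k'' c'' * 0) / 2 ^ (l + 2)"
        using that QP[of _ "l + 1" j] by (intro arg_cong2[where f = "(/)"] sum.cong refl) (auto simp: numeral_3_eq_3)
      finally have 1: "(\<Sum>c<2 ^ (l + 3). A (l + 1) c k'' c'' * P (l + 1) j c) = 0" by simp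
      have "(\<Sum>c<2 ^ (l + 3). B (l + 1) c k'' c'' * P (l + 1) j c) =
         (\<Sum>i<2 ^ (l + 1). e l i k'' c'' * (\<Sum>c<2 ^ (l + 3). P (l + 1) i c * P (l + 1) j c)) / 2 ^ (l + 1)"
        unfolding B_def sum_combination_mult[symmetric] sum_divide_distrib[of _ "{..<2 ^ (l + 3)}"]
        by (intro sum.cong refl) (simp add: mult_ac sum_distrib_left)
      also have "\<dots> = (\<Sum>i<2 ^ (l + 1). if i = j then e l j k'' c'' * 2 ^ (l + 3) else 0) / 2 ^ (l + 1)"
        using that PP[of _ "l + 1" j]
        by (intro arg_cong2[where f = "(/)"] sum.cong refl) (auto simp: numeral_3_eq_3)
      also have "\<dots> = e l j k'' c'' * 2 ^ (l + 3) / 2 ^ (l + 1)"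
        using that by (simp add: sum.delta)
      finally have 2: "(\<Sum>c<2 ^ (l + 3). B (l + 1) c k'' c'' * P (l + 1) j c) =
          e l j k'' c'' * 2 ^ (l + 3) / 2 ^ (l + 1)" .
      have "(\<Sum>c<2 ^ (l + 3). P (l + 1) j c * Y (l + 1) c k'' c'') =
         R (l + 1) * ((\<Sum>c<2 ^ (l + 3). A (l + 1) c k'' c'' * P (l + 1) j c) -
           (\<Sum>c<2 ^ (l + 3). B (l + 1) c k'' c'' * P (l + 1) j c))"
        unfolding sum_subtractf[symmetric] sum_distrib_left
        by (intro sum.cong refl) (simp add: Y_def algebra_simps)
      then show ?thesis unfolding 1 2 R_def by (simp add: power_add)
    qed
    moreover have "(\<Sum>k'\<le>k + 1. \<Sum>c'<2 ^ (k' + 2). e l j k' c' * Y k' c' k'' c'') =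
      (\<Sum>k'\<in>{l, l + 1}. \<Sum>c'<2 ^ (k' + 2). e l j k' c' * Y k' c' k'' c'')"
      using that by (intro sum.mono_neutral_right) (auto simp: e_def intro!: sum.neutral)
    moreover have "\<dots> = (\<Sum>c<2 ^ (l + 2). Q l j c * Y l c k'' c'') + (\<Sum>c<2 ^ (l + 3). P (l + 1) j c * Y (l + 1) c k'' c'')"
      by (simp add: e_def numeral_3_eq_3)
    ultimately show ?thesis by simp
  qed
  show ?thesis
  proof (rule that[of Y])
    show "Y k c k' c' = 0" if "2 ^ (k' + 2) \<le> c'" for k c k' c'
      using that by (simp add: Y_def A_def B_def e_def)
    show "Y k c k' c' = 0" if "k + 1 < k'" for k c k' c'
    proof -
      have "e k j k' c' = 0" "e (k - 1) j k' c' = 0" for j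
        using that by (auto simp: e_def)
      then show ?thesis by (simp add: Y_def A_def B_def)
    qed
    show "\<bar>Y k c k' c'\<bar> \<le> 4 * (real k + 1) / (2 ^ k * sqrt (2 ^ k))" if c: "c < 2 ^ (k + 2)" for k c k' c'
    proof -
      have "\<bar>A k c k' c' - B k c k' c'\<bar> \<le> 16 * (real k + 1) / sqrt (2 ^ k)"
      proof (cases "c' < 2 ^ (k' + 2)")
        case False
        then show ?thesis by (simp add: A_def B_def e_def)
      next
        case c': True
        consider "k' = k" "k = 0" | "k' = k" "k \<noteq> 0" | "k' = k + 1" | "k = k' + 1" | "k' \<noteq> k" "k' \<noteq> k + 1" "k \<noteq> k' + 1"
          by blast
        then show ?thesis
        proof cases
          case 1
          have "\<bar>\<Sum>j<2. Q 0 j c * Q 0 j c'\<bar> \<le> (\<Sum>j<2. \<bar>Q 0 j c * Q 0 j c'\<bar>)" by (rule sum_abs)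
          also have "\<dots> = 2" by (simp add: abs_mult Q)
          finally show ?thesis using 1 c' by (simp add: A_def B_def e_def)
        next
          case 2
          have "\<bar>A k c k' c' - B k c k' c'\<bar> \<le> 8 * (real k + 1) / sqrt (2 ^ k)"
            using 2 c' diag[OF c, of c'] by (cases k) (simp_all add: A_def B_def e_def)
          also have "\<dots> \<le> 16 * (real k + 1) / sqrt (2 ^ k)" by (intro divide_right_mono) auto
          finally show ?thesis .
        next
          case 3
          have "\<bar>A k c k' c' - B k c k' c'\<bar> \<le> 8 * (real k + 1) / sqrt (2 ^ k)"
            using 3 c' off[OF c, of c'] by (cases k) (simp_all add: A_def B_def e_def numeral_3_eq_3)
          also have "\<dots> \<le> 16 * (real k + 1) / sqrt (2 ^ k)" by (intro divide_right_mono) auto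
          finally show ?thesis .
        next
          case 4
          then have "\<bar>A k c k' c' - B k c k' c'\<bar> =
             \<bar>\<Sum>j<2 ^ (k' + 1). Q k' j c' * P (k' + 1) j c\<bar> / 2 ^ (k' + 1)"
            using c' by (simp add: A_def B_def e_def mult.commute)
          also have "\<dots> \<le> 8 * (real k' + 1) / sqrt (2 ^ k')"
            using c c' 4 by (intro off) (simp_all add: numeral_3_eq_3)
          also have "\<dots> = 8 * (real k' + 1) * sqrt 2 / sqrt (2 ^ k)"
            using 4 by (simp add: real_sqrt_mult)
          also have "\<dots> \<le> 8 * (real k + 1) * 2 / sqrt (2 ^ k)"
            using 4 sqrt2_less_2 by (intro divide_right_mono mult_mono) auto
          finally show ?thesis by simp
        next
          case 5
          then have "e k j k' c' = 0" "k \<noteq> 0 \<Longrightarrow> e (k - 1) j k' c' = 0" for j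
            by (auto simp: e_def)
          then show ?thesis by (simp add: A_def B_def)
        qed
      qed
      then have "R k * \<bar>A k c k' c' - B k c k' c'\<bar> \<le> R k * (16 * (real k + 1) / sqrt (2 ^ k))"
        using R[of k] by (intro mult_left_mono) auto
      also have "\<dots> = 4 * (real k + 1) / (2 ^ k * sqrt (2 ^ k))"
        by (simp add: R_def field_simps)
      finally show ?thesis using R[of k] by (simp add: Y_def abs_mult)
    qed
    show "Y k c k c = (if k = 0 then 1 / 4 else 0)" if "c < 2 ^ (k + 2)" for k c
      using that by (cases k) (simp_all add: Y_def A_def B_def e_def R_def Q2 P2)
    show "(\<Sum>k'\<le>k + 1. \<Sum>c'<2 ^ (k' + 2). Y k c k' c' * Y k' c' k'' c'') = 0" for k c k'' c''
    proof -
      let ?S = "SIGMA k':{..k + 1}. {..<2 ^ (k' + 2) :: nat}"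
      have conv: "(\<Sum>k'\<le>k + 1. \<Sum>c'<2 ^ (k' + 2). f k' c') = (\<Sum>x\<in>?S. f (fst x) (snd x))"
        for f :: "nat \<Rightarrow> nat \<Rightarrow> real"
        by (subst sum.Sigma) (auto simp: case_prod_beta)
      have ev: "(\<Sum>x\<in>?S. e l j (fst x) (snd x) * Y (fst x) (snd x) k'' c'') = 0"
        if "l \<le> k" "j < 2 ^ (l + 1)" for l j
        using vanish[OF that] unfolding conv .
      have "(\<Sum>x\<in>?S. A k c (fst x) (snd x) * Y (fst x) (snd x) k'' c'') =
         (\<Sum>j<2 ^ (k + 1). Q k j c * (\<Sum>x\<in>?S. e k j (fst x) (snd x) * Y (fst x) (snd x) k'' c'')) / 2 ^ (k + 1)"
        unfolding A_def sum_combination_mult[symmetric] sum_divide_distrib[of _ ?S] by simp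
      also have "\<dots> = (\<Sum>j<2 ^ (k + 1). Q k j c * 0) / 2 ^ (k + 1)"
        by (intro arg_cong2[where f = "(/)"] sum.cong refl) (simp only: lessThan_iff ev order_refl)
      finally have 1: "(\<Sum>x\<in>?S. A k c (fst x) (snd x) * Y (fst x) (snd x) k'' c'') = 0"
        by simp
      have 2: "(\<Sum>x\<in>?S. B k c (fst x) (snd x) * Y (fst x) (snd x) k'' c'') = 0"
      proof (cases "k = 0")
        case False
        have "(\<Sum>x\<in>?S. B k c (fst x) (snd x) * Y (fst x) (snd x) k'' c'') =
           (\<Sum>j<2 ^ k. P k j c * (\<Sum>x\<in>?S. e (k - 1) j (fst x) (snd x) * Y (fst x) (snd x) k'' c'')) / 2 ^ k"
          unfolding B_def sum_combination_mult[symmetric] sum_divide_distrib[of _ ?S] using False by simp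
        also have "\<dots> = (\<Sum>j<2 ^ k. P k j c * 0) / 2 ^ k"
          using False by (intro arg_cong2[where f = "(/)"] sum.cong refl) (subst ev, auto)
        finally show ?thesis by simp
      qed (simp add: B_def)
      have "(\<Sum>k'\<le>k + 1. \<Sum>c'<2 ^ (k' + 2). Y k c k' c' * Y k' c' k'' c'') =
         (\<Sum>x\<in>?S. Y k c (fst x) (snd x) * Y (fst x) (snd x) k'' c'')"
        by (rule conv)
      also have "\<dots> = R k * ((\<Sum>x\<in>?S. A k c (fst x) (snd x) * Y (fst x) (snd x) k'' c'') -
          (\<Sum>x\<in>?S. B k c (fst x) (snd x) * Y (fst x) (snd x) k'' c''))"
        unfolding sum_subtractf[symmetric] sum_distrib_left
        by (intro sum.cong refl) (subst Y_def, simp add: algebra_simps)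
      finally show ?thesis unfolding 1 2 by simp
    qed
  qed
qed

section \<open>Extension of operators to spaces of bounded sequences\<close>

text \<open>
  A functional is treated as its graph. A linear subspace \<open>G\<close> of the product with the real line
  on which \<open>r \<le> K * norm x\<close> holds is automatically a graph, because \<open>(0, r) \<in> G\<close> and
  \<open>(0, - r) \<in> G\<close> force \<open>r = 0\<close>; so Zorn's lemma can be applied to such subspaces, ordered by
  inclusion. A maximal one projects onto the whole space by the usual one-step extension.
\<close>

lemma hahn_banach_norm:
  fixes f :: "'a::real_normed_vector \<Rightarrow> real"
  assumes W: "subspace W" and K: "0 \<le> K"
    and add: "\<And>x y. x \<in> W \<Longrightarrow> y \<in> W \<Longrightarrow> f (x + y) = f x + f y"
    and scale: "\<And>r x. x \<in> W \<Longrightarrow> f (r *\<^sub>R x) = r * f x"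
    and le: "\<And>x. x \<in> W \<Longrightarrow> f x \<le> K * norm x"
  obtains F where "linear F" "\<And>x. x \<in> W \<Longrightarrow> F x = f x" "\<And>x. \<bar>F x\<bar> \<le> K * norm x"
proof -
  define P where "P = {G :: ('a \<times> real) set. subspace G \<and> (\<lambda>x. (x, f x)) ` W \<subseteq> G \<and>
    (\<forall>z\<in>G. snd z \<le> K * norm (fst z))}"
  have "(\<lambda>x. (x, f x)) ` W \<in> P"
  proof -
    have "subspace ((\<lambda>x. (x, f x)) ` W)"
      unfolding subspace_def
    proof (intro conjI ballI allI)
      have "f 0 = 0" using scale[of 0 0] W by (simp add: subspace_0)
      then show "0 \<in> (\<lambda>x. (x, f x)) ` W" using W by (auto simp: zero_prod_def subspace_0 intro!: image_eqI[of _ _ 0])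
    next
      fix u v assume "u \<in> (\<lambda>x. (x, f x)) ` W" "v \<in> (\<lambda>x. (x, f x)) ` W"
      then obtain x y where xy: "x \<in> W" "y \<in> W" "u = (x, f x)" "v = (y, f y)" by blast
      then have "u + v = (x + y, f (x + y))" by (simp add: add)
      then show "u + v \<in> (\<lambda>x. (x, f x)) ` W" using W xy by (auto simp: subspace_add)
    next
      fix c :: real and u assume "u \<in> (\<lambda>x. (x, f x)) ` W"
      then obtain x where xy: "x \<in> W" "u = (x, f x)" by blast
      then have "c *\<^sub>R u = (c *\<^sub>R x, f (c *\<^sub>R x))" by (simp add: scale)
      then show "c *\<^sub>R u \<in> (\<lambda>x. (x, f x)) ` W" using W xy by (auto simp: subspace_scale)
    qed
    then show ?thesis using le by (auto simp: P_def)
  qed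
  moreover have "\<Union>\<C> \<in> P" if C: "subset.chain P \<C>" "\<C> \<noteq> {}" for \<C>
  proof -
    from C have sub: "G \<in> P" if "G \<in> \<C>" for G using that by (auto simp: subset.chain_def)
    have "subspace (\<Union>\<C>)"
      unfolding subspace_def
    proof (intro conjI ballI allI)
      from C(2) obtain G where "G \<in> \<C>" by blast
      with sub show "0 \<in> \<Union>\<C>" by (auto simp: P_def subspace_0)
    next
      fix u v assume "u \<in> \<Union>\<C>" "v \<in> \<Union>\<C>"
      then obtain G H where GH: "G \<in> \<C>" "u \<in> G" "H \<in> \<C>" "v \<in> H" by blast
      then have "G \<subseteq> H \<or> H \<subseteq> G" using C(1) by (auto simp: subset.chain_def)
      then obtain E where "E \<in> \<C>" "u \<in> E" "v \<in> E" using GH by blast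
      then have "u + v \<in> E" using sub[of E] by (simp add: P_def subspace_add)
      with \<open>E \<in> \<C>\<close> show "u + v \<in> \<Union>\<C>" by blast
    next
      fix c :: real and u assume "u \<in> \<Union>\<C>"
      then obtain G where "G \<in> \<C>" "u \<in> G" by blast
      moreover from this have "c *\<^sub>R u \<in> G" using sub[of G] by (simp add: P_def subspace_scale)
      ultimately show "c *\<^sub>R u \<in> \<Union>\<C>" by blast
    qed
    moreover from C(2) obtain G where "G \<in> \<C>" by blast
    ultimately show ?thesis using sub unfolding P_def by auto
  qed
  ultimately obtain G where G: "G \<in> P" and max: "\<And>H. H \<in> P \<Longrightarrow> G \<subseteq> H \<Longrightarrow> H = G"
    using subset_Zorn_nonempty[of P] by blast
  have sG: "subspace G" and gr: "\<And>x. x \<in> W \<Longrightarrow> (x, f x) \<in> G"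
    and bd: "\<And>x r. (x, r) \<in> G \<Longrightarrow> r \<le> K * norm x"
    using G by (auto simp: P_def)
  have G_add: "(x + y, r + s) \<in> G" if "(x, r) \<in> G" "(y, s) \<in> G" for x y r s
    using subspace_add[OF sG that] by simp
  have G_scale: "(c *\<^sub>R x, c * r) \<in> G" if "(x, r) \<in> G" for x r c
    using subspace_scale[OF sG that, of c] by simp
  have uniq: "r = s" if "(x, r) \<in> G" "(x, s) \<in> G" for x r s
  proof -
    have "(0, r - s) \<in> G" "(0, s - r) \<in> G"
      using G_add[OF that(1) G_scale[OF that(2), of "- 1"]] G_add[OF that(2) G_scale[OF that(1), of "- 1"]]
      by simp_all
    then show ?thesis using bd[of 0 "r - s"] bd[of 0 "s - r"] by simp
  qed
  have ex: "\<exists>r. (z, r) \<in> G" for z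
  proof -
    have sep: "r - K * norm (x - z) \<le> K * norm (y + z) - s" if "(x, r) \<in> G" "(y, s) \<in> G" for x y r s
    proof -
      have "r + s \<le> K * norm (x + y)" using bd[OF G_add[OF that]] .
      also have "\<dots> \<le> K * (norm (x - z) + norm (y + z))"
        using norm_triangle_ineq[of "x - z" "y + z"]
        by (intro mult_left_mono[OF _ K]) auto
      finally show ?thesis by (simp add: algebra_simps)
    qed
    \<comment> \<open>The admissible values at \<open>z\<close> lie between the supremum \<open>a\<close> and the upper bounds in \<open>sep\<close>.\<close>
    define S where "S = (\<lambda>(x, r). r - K * norm (x - z)) ` G"
    define a where "a = Sup S"
    have "(0, 0) \<in> G" using subspace_0[OF sG] by (simp add: zero_prod_def)
    then have ne: "S \<noteq> {}" by (auto simp: S_def)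
    have "bdd_above S"
      using sep[OF _ \<open>(0, 0) \<in> G\<close>] by (intro bdd_aboveI[of _ "K * norm (0 + z) - 0"]) (auto simp: S_def)
    then have lower: "r - K * norm (x - z) \<le> a" if "(x, r) \<in> G" for x r
      unfolding a_def using that by (intro cSup_upper) (auto simp: S_def intro!: image_eqI[of _ _ "(x, r)"])
    have upper: "a \<le> K * norm (y + z) - s" if "(y, s) \<in> G" for y s
      unfolding a_def using ne sep[OF _ that] by (intro cSup_least) (auto simp: S_def)
    have bound: "r + t * a \<le> K * norm (x + t *\<^sub>R z)" if "(x, r) \<in> G" for x r t
    proof (cases t "0 :: real" rule: linorder_cases)
      case greater
      define N where "N = norm ((1 / t) *\<^sub>R x + z)"
      have "x + t *\<^sub>R z = t *\<^sub>R ((1 / t) *\<^sub>R x + z)"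
        using greater by (simp add: scaleR_add_right)
      then have N: "norm (x + t *\<^sub>R z) = t * N" using greater by (simp add: N_def)
      have "a \<le> K * N - r / t" using upper[OF G_scale[OF that, of "1 / t"]] by (simp add: N_def)
      then have "a * t \<le> (K * N - r / t) * t" using greater by (intro mult_right_mono) auto
      moreover have "(K * N - r / t) * t = K * (t * N) - r"
        using greater by (simp add: left_diff_distrib)
      ultimately show ?thesis unfolding N mult.commute[of t a] by linarith
    next
      case equal
      then show ?thesis using bd[OF that] by simp
    next
      case less
      define u where "u = - t"
      have u: "0 < u" and t: "t = - u" using less by (simp_all add: u_def)
      define N where "N = norm ((1 / u) *\<^sub>R x - z)"
      have "x + t *\<^sub>R z = u *\<^sub>R ((1 / u) *\<^sub>R x - z)"
        using u by (simp add: scaleR_diff_right t)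
      then have N: "norm (x + t *\<^sub>R z) = u * N" using u by (simp add: N_def)
      have "r / u - K * N \<le> a" using lower[OF G_scale[OF that, of "1 / u"]] by (simp add: N_def)
      then have "(r / u - K * N) * u \<le> a * u" using u by (intro mult_right_mono) auto
      moreover have "(r / u - K * N) * u = r - K * (u * N)"
        using u by (simp add: left_diff_distrib)
      moreover have "t * a = - (a * u)" by (simp add: t)
      ultimately show ?thesis unfolding N by linarith
    qed
    define H where "H = {g + h | g h. g \<in> G \<and> h \<in> range (\<lambda>t. t *\<^sub>R (z, a))}"
    have "subspace (range (\<lambda>t. t *\<^sub>R (z, a)))"
      by (rule linear_subspace_image[OF _ subspace_UNIV]) (simp add: linear_iff algebra_simps)
    then have "subspace H" unfolding H_def by (intro subspace_sums sG)
    moreover have GH: "G \<subseteq> H"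
    proof
      fix g assume "g \<in> G"
      moreover have "g = g + 0 *\<^sub>R (z, a)" by (simp add: zero_prod_def)
      ultimately show "g \<in> H" unfolding H_def by blast
    qed
    moreover have "snd w \<le> K * norm (fst w)" if "w \<in> H" for w
      using that bound by (auto simp: H_def)
    ultimately have "H \<in> P" using G by (auto simp: P_def)
    with GH have "H = G" by (intro max)
    moreover have "(z, a) \<in> H"
    proof -
      have "(z, a) = (0, 0) + 1 *\<^sub>R (z, a)" by (simp add: zero_prod_def)
      with \<open>(0, 0) \<in> G\<close> show ?thesis unfolding H_def by blast
    qed
    ultimately show ?thesis by blast
  qed
  define F where "F z = (THE r. (z, r) \<in> G)" for z
  have FG: "(z, F z) \<in> G" for z
    unfolding F_def using ex[of z] uniq by (metis theI)
  have F_eq: "F z = r" if "(z, r) \<in> G" for z r using uniq[OF FG that] .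
  have "linear F"
    using F_eq[OF G_add[OF FG FG]] F_eq[OF G_scale[OF FG]] by (auto simp: linear_iff)
  moreover have "\<bar>F x\<bar> \<le> K * norm x" for x
  proof -
    have "- F x = F (- x)" using \<open>linear F\<close> by (simp add: linear_neg)
    then show ?thesis using bd[OF FG, of x] bd[OF FG, of "- x"] by (auto simp: abs_le_iff)
  qed
  ultimately show ?thesis using gr F_eq by (intro that[of F]) auto
qed

text \<open>
  Real and imaginary parts for the abstract scalar field; over the reals \<open>v\<close> and \<open>\<iota>\<close> are zero.
\<close>

lemma rc_field_components:
  obtains u v :: "'k::rc_field \<Rightarrow> real" and \<iota> :: 'k where
    "linear u" "linear v" "\<And>z. \<bar>u z\<bar> \<le> norm z" "\<And>z. \<bar>v z\<bar> \<le> norm z"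
    "\<And>z. z = u z *\<^sub>R 1 + v z *\<^sub>R \<iota>" "norm \<iota> \<le> 1"
proof (cases "\<forall>x::'k. \<exists>a. x = a *\<^sub>R 1")
  case True
  then obtain u :: "'k \<Rightarrow> real" where u: "\<And>x. x = u x *\<^sub>R 1" by metis
  have inj: "a = b" if "a *\<^sub>R (1::'k) = b *\<^sub>R 1" for a b using that by simp
  show ?thesis
  proof (rule that[of u "\<lambda>_. 0" 0])
    show "linear u"
    proof (rule linearI)
      show "u (x + y) = u x + u y" for x y
        by (rule inj) (metis scaleR_add_left u)
      show "u (r *\<^sub>R x) = r *\<^sub>R u x" for r x
        by (rule inj) (metis scaleR_scaleR u real_scaleR_def)
    qed
    show "\<bar>u z\<bar> \<le> norm z" for z
    proof -
      have "norm z = norm (u z *\<^sub>R (1::'k))" using u[of z] by simp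
      then show ?thesis by simp
    qed
  qed (use u in \<open>auto simp: linear_iff\<close>)
next
  case False
  with real_or_complex[where 'a = 'k] obtain i :: 'k where i: "i * i = - 1"
    and ex: "\<forall>x. \<exists>a b. x = a *\<^sub>R 1 + b *\<^sub>R i \<and> norm x = sqrt (a\<^sup>2 + b\<^sup>2)" by blast
  from ex obtain u v :: "'k \<Rightarrow> real" where uv: "\<And>x. x = u x *\<^sub>R 1 + v x *\<^sub>R i"
    and nrm: "\<And>x. norm x = sqrt ((u x)\<^sup>2 + (v x)\<^sup>2)" by metis
  have inj0: "a = 0 \<and> b = 0" if "a *\<^sub>R (1::'k) + b *\<^sub>R i = 0" for a b
  proof -
    have "(a *\<^sub>R (1::'k) + b *\<^sub>R i) * (a *\<^sub>R 1 - b *\<^sub>R i) = (a * a + b * b) *\<^sub>R 1"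
      using i by (simp add: algebra_simps)
    with that have "a * a + b * b = 0" by simp
    then show ?thesis by (simp add: sum_squares_eq_zero_iff)
  qed
  have inj: "a = c \<and> b = d" if "a *\<^sub>R (1::'k) + b *\<^sub>R i = c *\<^sub>R 1 + d *\<^sub>R i" for a b c d
    using inj0[of "a - c" "b - d"] that by (simp add: algebra_simps)
  have add: "u (x + y) = u x + u y \<and> v (x + y) = v x + v y" for x y
  proof (rule inj)
    have "u (x + y) *\<^sub>R 1 + v (x + y) *\<^sub>R i = x + y" using uv[of "x + y"] by simp
    also have "\<dots> = (u x *\<^sub>R 1 + v x *\<^sub>R i) + (u y *\<^sub>R 1 + v y *\<^sub>R i)" using uv[of x] uv[of y] by simp
    finally show "u (x + y) *\<^sub>R 1 + v (x + y) *\<^sub>R i = (u x + u y) *\<^sub>R 1 + (v x + v y) *\<^sub>R i"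
      by (simp add: algebra_simps)
  qed
  have scale: "u (r *\<^sub>R x) = r * u x \<and> v (r *\<^sub>R x) = r * v x" for r x
  proof (rule inj)
    have "u (r *\<^sub>R x) *\<^sub>R 1 + v (r *\<^sub>R x) *\<^sub>R i = r *\<^sub>R x" using uv[of "r *\<^sub>R x"] by simp
    also have "\<dots> = r *\<^sub>R (u x *\<^sub>R 1 + v x *\<^sub>R i)" using uv[of x] by simp
    finally show "u (r *\<^sub>R x) *\<^sub>R 1 + v (r *\<^sub>R x) *\<^sub>R i = (r * u x) *\<^sub>R 1 + (r * v x) *\<^sub>R i"
      by (simp add: algebra_simps)
  qed
  show ?thesis
  proof (rule that[of u v i])
    show "linear u" "linear v" using add scale by (auto simp: linear_iff)
    show "\<bar>u z\<bar> \<le> norm z" "\<bar>v z\<bar> \<le> norm z" for z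
      unfolding nrm by (rule real_sqrt_sum_squares_ge1 real_sqrt_sum_squares_ge2 | simp add: real_le_rsqrt)+
    have "norm i * norm i = 1" using i by (metis norm_mult norm_minus_cancel norm_one)
    then show "norm i \<le> 1" by (metis abs_norm_cancel norm_ge_zero real_sqrt_abs2 real_sqrt_one order_refl)
  qed (rule uv)
qed

text \<open>
  The Hahn-Banach theorem is applied to the real and the imaginary part of each coordinate. The
  extension is only real-linear and its norm may double. Both are harmless, because the extension
  serves only to estimate the norm of the given operator.
\<close>

lemma extend_bounded_operator:
  fixes T :: "(nat \<Rightarrow>\<^sub>C 'k::rc_field) \<Rightarrow> (nat \<Rightarrow>\<^sub>C 'k)"
  assumes W: "subspace W" and K: "0 \<le> K"
    and add: "\<And>x y. x \<in> W \<Longrightarrow> y \<in> W \<Longrightarrow> T (x + y) = T x + T y"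
    and scale: "\<And>r x. x \<in> W \<Longrightarrow> T (r *\<^sub>R x) = r *\<^sub>R T x"
    and le: "\<And>x. x \<in> W \<Longrightarrow> norm (T x) \<le> K * norm x"
  obtains U where "bounded_linear U" "\<And>x. x \<in> W \<Longrightarrow> U x = T x"
proof -
  obtain u v :: "'k \<Rightarrow> real" and \<iota> :: 'k where uv: "linear u" "linear v"
    "\<And>z. \<bar>u z\<bar> \<le> norm z" "\<And>z. \<bar>v z\<bar> \<le> norm z" "\<And>z. z = u z *\<^sub>R 1 + v z *\<^sub>R \<iota>" "norm \<iota> \<le> 1"
    by (rule rc_field_components, rule that) assumption+
  have ext: "\<exists>F. linear F \<and> (\<forall>x\<in>W. F x = f (T x i)) \<and> (\<forall>x. \<bar>F x\<bar> \<le> K * norm x)"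
    if f: "linear f" "\<And>z. \<bar>f z\<bar> \<le> norm z" for f :: "'k \<Rightarrow> real" and i
  proof -
    have "f (T x i) \<le> K * norm x" if "x \<in> W" for x
    proof -
      have "f (T x i) \<le> norm (T x i)" using f(2)[of "T x i"] by simp
      also have "\<dots> \<le> norm (T x)" by (rule norm_bounded)
      finally show ?thesis using le[OF that] by simp
    qed
    then obtain F where "linear F" "\<And>x. x \<in> W \<Longrightarrow> F x = f (T x i)" "\<And>x. \<bar>F x\<bar> \<le> K * norm x"
      using hahn_banach_norm[OF W K, of "\<lambda>x. f (T x i)"] f(1)
      by (auto simp: add scale linear_add linear_scale)
    then show ?thesis by blast
  qed
  from ext[OF uv(1,3)] obtain F where F: "\<And>i. linear (F i)" "\<And>i x. x \<in> W \<Longrightarrow> F i x = u (T x i)"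
    "\<And>i x. \<bar>F i x\<bar> \<le> K * norm x" by metis
  from ext[OF uv(2,4)] obtain G where G: "\<And>i. linear (G i)" "\<And>i x. x \<in> W \<Longrightarrow> G i x = v (T x i)"
    "\<And>i x. \<bar>G i x\<bar> \<le> K * norm x" by metis
  define U where "U x = Bcontfun (\<lambda>i. F i x *\<^sub>R 1 + G i x *\<^sub>R \<iota>)" for x
  have bd: "norm (F i x *\<^sub>R 1 + G i x *\<^sub>R \<iota>) \<le> norm x * (2 * K)" for i x
  proof -
    have "norm (F i x *\<^sub>R 1 + G i x *\<^sub>R \<iota>) \<le> norm (F i x *\<^sub>R (1::'k)) + norm (G i x *\<^sub>R \<iota>)"
      by (rule norm_triangle_ineq)
    also have "\<dots> \<le> \<bar>F i x\<bar> + \<bar>G i x\<bar>"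
      using uv(6) by (simp add: mult_left_le)
    also have "\<dots> \<le> K * norm x + K * norm x" using F(3)[of i x] G(3)[of i x] by (rule add_mono)
    also have "\<dots> = norm x * (2 * K)" by simp
    finally show ?thesis .
  qed
  have U: "apply_bcontfun (U x) i = F i x *\<^sub>R 1 + G i x *\<^sub>R \<iota>" for x i
    unfolding U_def by (subst apply_Bcontfun_nat[OF bd]) simp
  show ?thesis
  proof (rule that[of U])
    show "bounded_linear U"
    proof (rule bounded_linear_intro[where K = "2 * K"])
      show "U (x + y) = U x + U y" for x y
        using F(1) G(1) by (intro bcontfun_eqI) (simp add: U linear_add algebra_simps)
      show "U (r *\<^sub>R x) = r *\<^sub>R U x" for r x
        using F(1) G(1) by (intro bcontfun_eqI) (simp add: U linear_scale algebra_simps)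
      show "norm (U x) \<le> norm x * (2 * K)" for x
        by (rule norm_bound) (simp only: U bd)
    qed
    show "U x = T x" if "x \<in> W" for x
    proof (rule bcontfun_eqI)
      show "apply_bcontfun (U x) i = apply_bcontfun (T x) i" for i
        unfolding U F(2)[OF that] G(2)[OF that] using uv(5)[of "T x i"] by simp
    qed
  qed
qed

section \<open>Projections of finite rank for Hilbertian seminorms\<close>

locale semi_inner_product =
  fixes B :: "'a::real_vector \<Rightarrow> 'a \<Rightarrow> real"
  assumes sym: "B x y = B y x" and lin: "linear (B x)" and nonneg: "0 \<le> B x x"
begin

lemma add_right: "B x (y + z) = B x y + B x z" and scale_right: "B x (r *\<^sub>R y) = r * B x y"
  and diff_right: "B x (y - z) = B x y - B x z"
  using lin[of x] by (simp_all add: linear_add linear_scale linear_diff)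

lemma add_left: "B (y + z) x = B y x + B z x" and scale_left: "B (r *\<^sub>R y) x = r * B y x"
  and diff_left: "B (y - z) x = B y x - B z x"
  by (simp_all add: sym[of _ x] add_right scale_right diff_right)

lemma sum_left: "B (\<Sum>i\<in>I. f i) x = (\<Sum>i\<in>I. B (f i) x)"
  using linear_sum[OF lin[of x], of f I] by (simp add: sym)

lemma sum_right: "B x (\<Sum>i\<in>I. f i) = (\<Sum>i\<in>I. B x (f i))"
  by (rule linear_sum[OF lin])

text \<open>
  The case of the Cauchy-Schwarz inequality in which one vector has seminorm zero.
\<close>

lemma null_orthogonal:
  assumes "B n n = 0"
  shows "B n y = 0"
proof (rule ccontr)
  assume ne: "B n y \<noteq> 0"
  \<comment> \<open>For this \<open>t\<close> the square of the seminorm of \<open>t *\<^sub>R n + y\<close> would be \<open>- 1\<close>.\<close>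
  define t where "t = - (B y y + 1) / (2 * B n y)"
  have "0 \<le> B (t *\<^sub>R n + y) (t *\<^sub>R n + y)" by (rule nonneg)
  also have "\<dots> = 2 * t * B n y + B y y"
    using assms by (simp add: add_left add_right scale_left scale_right sym[of y n])
  also have "2 * t * B n y = - (B y y + 1)" using ne by (simp add: t_def)
  finally show False by simp
qed

definition project :: "'a set \<Rightarrow> 'a \<Rightarrow> 'a" where
  "project I x = (\<Sum>b\<in>I. B x b *\<^sub>R b)"

definition orthonormal :: "'a set \<Rightarrow> bool" where
  "orthonormal I \<longleftrightarrow> finite I \<and> (\<forall>b\<in>I. \<forall>c\<in>I. B b c = (if b = c then 1 else 0))"

lemma project_inner:
  assumes "orthonormal I" "c \<in> I"
  shows "B (project I x) c = B x c"
proof -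
  have "B (project I x) c = (\<Sum>b\<in>I. if b = c then B x c else 0)"
    unfolding project_def sum_left using assms
    by (intro sum.cong refl) (auto simp: scale_left orthonormal_def)
  then show ?thesis using assms by (simp add: orthonormal_def)
qed

lemma project_residual_orthogonal:
  assumes "orthonormal I"
  shows "B (x - project I x) (project I y) = 0"
proof -
  have "B (x - project I x) b = 0" if "b \<in> I" for b
    using project_inner[OF assms that] by (simp add: diff_left)
  then show ?thesis
    unfolding project_def[of I y] sum_right scale_right by (intro sum.neutral) simp
qed

lemma project_diff: "project I (x - y) = project I x - project I y"
  by (simp add: project_def diff_left scaleR_diff_left sum_subtractf)

lemma project_scale: "project I (r *\<^sub>R x) = r *\<^sub>R project I x"
  by (simp add: project_def scale_left scaleR_sum_right)

text \<open>
  Gram-Schmidt orthonormalisation, in which vectors with a residue of seminorm zero are skipped.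
\<close>

lemma orthonormal_hull:
  assumes "finite A" "A \<subseteq> W" "subspace W"
  shows "\<exists>I. orthonormal I \<and> I \<subseteq> W \<and> (\<forall>a\<in>A. B (a - project I a) (a - project I a) = 0)"
  using assms(1,2)
proof (induction A)
  case empty
  show ?case by (intro exI[of _ "{}"]) (simp add: orthonormal_def)
next
  case (insert a A)
  then obtain I where I: "orthonormal I" "I \<subseteq> W"
    and A: "\<And>x. x \<in> A \<Longrightarrow> B (x - project I x) (x - project I x) = 0" by auto
  define r where "r = a - project I a"
  show ?case
  proof (cases "B r r = 0")
    case True
    with I A show ?thesis by (intro exI[of _ I]) (auto simp: r_def)
  next
    case False
    with nonneg[of r] have pos: "0 < B r r" by simp
    define b where "b = (1 / sqrt (B r r)) *\<^sub>R r"
    have bb: "B b b = 1"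
      using pos by (simp add: b_def scale_left scale_right real_sqrt_mult_self)
    have rc: "B r c = 0" if "c \<in> I" for c
      using project_inner[OF I(1) that, of a] by (simp add: r_def diff_left)
    have bc: "B b c = 0" if "c \<in> I" for c
      using rc[OF that] by (simp add: b_def scale_left)
    have cb: "B c b = 0" if "c \<in> I" for c
      using bc[OF that] sym[of c b] by simp
    have bI: "b \<notin> I" using bc[of b] bb by auto
    have "orthonormal (insert b I)"
      using I(1) bb bc cb unfolding orthonormal_def by auto
    moreover have "insert b I \<subseteq> W"
    proof -
      have "project I a \<in> W"
        unfolding project_def using I(2) assms(3) by (intro subspace_sum subspace_scale) auto
      then have "r \<in> W" using insert.prems assms(3) by (simp add: r_def subspace_diff)
      then show ?thesis using I(2) assms(3) by (simp add: b_def subspace_scale)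
    qed
    moreover have proj: "project (insert b I) x = B x b *\<^sub>R b + project I x" for x
      using I(1) bI by (simp add: project_def orthonormal_def)
    moreover have pb: "B (project I x) b = 0" for x
      unfolding project_def sum_left by (intro sum.neutral) (simp add: scale_left cb)
    moreover have "B x b = 0" if "x \<in> A" for x
      using null_orthogonal[OF A[OF that], of b] pb by (simp add: diff_left)
    moreover have "a - project (insert b I) a = 0"
    proof -
      have "B a b = B r b" by (simp add: r_def diff_left pb)
      also have "\<dots> = B r r / sqrt (B r r)" by (simp add: b_def scale_right)
      also have "\<dots> = sqrt (B r r)" using pos by (simp add: real_div_sqrt)
      finally have "B a b *\<^sub>R b = r" using pos by (simp add: b_def)
      then show ?thesis unfolding proj by (simp add: r_def)
    qed
    ultimately show ?thesis
      using A scale_left[of 0 0 0] by (intro exI[of _ "insert b I"]) auto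
  qed
qed

text \<open>
  Pythagoras: modulo a vector of seminorm zero, \<open>a\<close> lies in the range of the projection.
\<close>

lemma project_minimal:
  assumes I: "orthonormal I" and a: "B (a - project I a) (a - project I a) = 0"
  shows "B (x - project I x) (x - project I x) \<le> B (x - a) (x - a)"
proof -
  define n where "n = a - project I a"
  define p where "p = x - project I x"
  define d where "d = project I x - project I a"
  have "B n y = 0" "B y n = 0" for y
    using null_orthogonal[OF a, of y] by (simp_all add: n_def sym[of y])
  moreover have "B p d = 0" "B d p = 0"
    using project_residual_orthogonal[OF I, of x "x - a"]
    by (simp_all add: p_def d_def project_diff[symmetric] sym[of "project _ _"])
  moreover have "x - a = p + d - n" by (simp add: p_def d_def n_def)
  ultimately have "B (x - a) (x - a) = B p p + B d d"
    by (simp add: add_left add_right diff_left diff_right)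
  with nonneg[of d] show ?thesis by (simp add: p_def)
qed

end

text \<open>
  Level \<open>m\<close> contributes at most of the order of \<open>2 ^ m\<close> functionals of norm one, with the weight
  \<open>q ^ m\<close>. As \<open>2 * q < 1\<close>, the weights are summable over all functionals; the associated map into
  a Hilbert space is of Hilbert-Schmidt type, and in particular compact.
\<close>

locale weighted_functionals =
  fixes F :: "nat \<Rightarrow> ('a::real_normed_vector \<Rightarrow> real) set" and q C :: real
  assumes finite_F: "finite (F m)" and card_F: "real (card (F m)) \<le> C * 2 ^ m"
    and linear_F: "g \<in> F m \<Longrightarrow> linear g" and bound_F: "g \<in> F m \<Longrightarrow> \<bar>g x\<bar> \<le> norm x"
    and q: "0 < q" "2 * q < 1"
begin

definition B :: "'a \<Rightarrow> 'a \<Rightarrow> real" where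
  "B x y = (\<Sum>m. q ^ m * (\<Sum>g\<in>F m. g x * g y))"

lemma C_nonneg: "0 \<le> C"
  using card_F[of 0] by simp

lemma level_bound:
  assumes "\<And>g. g \<in> F m \<Longrightarrow> \<bar>h g\<bar> \<le> K" "0 \<le> K"
  shows "\<bar>q ^ m * (\<Sum>g\<in>F m. h g)\<bar> \<le> C * K * (2 * q) ^ m"
proof -
  have "\<bar>\<Sum>g\<in>F m. h g\<bar> \<le> (\<Sum>g\<in>F m. K)"
    by (rule order_trans[OF sum_abs sum_mono]) (rule assms)
  also have "\<dots> \<le> C * 2 ^ m * K" using card_F[of m] assms(2) by (simp add: mult_right_mono)
  finally have "q ^ m * \<bar>\<Sum>g\<in>F m. h g\<bar> \<le> q ^ m * (C * 2 ^ m * K)" using q by (intro mult_left_mono) auto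
  then show ?thesis using q by (simp add: abs_mult power_mult_distrib mult_ac)
qed

lemma summable_geometric_2q: "summable (\<lambda>m. K * (2 * q) ^ m)"
  using q by (intro summable_mult summable_geometric) auto

lemma summable_B: "summable (\<lambda>m. q ^ m * (\<Sum>g\<in>F m. g x * g y))"
proof (rule summable_comparison_test'[OF summable_geometric_2q[of "C * (norm x * norm y)"]])
  show "norm (q ^ m * (\<Sum>g\<in>F m. g x * g y)) \<le> C * (norm x * norm y) * (2 * q) ^ m" for m
    unfolding real_norm_def
    by (rule level_bound) (auto simp: abs_mult intro!: mult_mono bound_F)
qed

lemma level_nonneg: "0 \<le> q ^ m * (\<Sum>g\<in>F m. g x * g x)"
  using q by (intro mult_nonneg_nonneg sum_nonneg zero_le_square) auto

sublocale semi_inner_product B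
proof
  show "B x y = B y x" for x y by (simp add: B_def mult.commute)
  show "0 \<le> B x x" for x
    unfolding B_def by (intro suminf_nonneg summable_B level_nonneg)
  show "B x (y + z) = B x y + B x z" for x y z
    unfolding B_def suminf_add[OF summable_B summable_B]
    by (intro suminf_cong) (simp add: linear_add[OF linear_F] distrib_left sum.distrib)
  show "B x (r *\<^sub>R y) = r *\<^sub>R B x y" for x r y
    unfolding B_def real_scaleR_def suminf_mult[OF summable_B, symmetric]
    by (intro suminf_cong) (simp add: linear_scale[OF linear_F] sum_distrib_left mult_ac)
qed

lemma B_bound: "\<bar>B x y\<bar> \<le> C / (1 - 2 * q) * norm x * norm y"
proof -
  have le: "\<bar>q ^ m * (\<Sum>g\<in>F m. g x * g y)\<bar> \<le> C * (norm x * norm y) * (2 * q) ^ m" for m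
    by (rule level_bound) (auto simp: abs_mult intro!: mult_mono bound_F)
  have S: "(\<lambda>m. C * (norm x * norm y) * (2 * q) ^ m) sums (C * (norm x * norm y) * (1 / (1 - 2 * q)))"
    using q by (intro sums_mult geometric_sums) auto
  have B: "(\<lambda>m. q ^ m * (\<Sum>g\<in>F m. g x * g y)) sums B x y"
    unfolding B_def by (rule summable_sums[OF summable_B])
  have "B x y \<le> C * (norm x * norm y) * (1 / (1 - 2 * q))"
    using le by (intro sums_le[OF _ B S]) (auto simp: abs_le_iff)
  moreover have "- B x y \<le> C * (norm x * norm y) * (1 / (1 - 2 * q))"
    using le by (intro sums_le[OF _ sums_minus[OF B] S]) (auto simp: abs_le_iff)
  ultimately show ?thesis by (simp add: abs_le_iff)
qed

lemma level_le_B: "q ^ m * (\<Sum>g\<in>F m. (g x)\<^sup>2) \<le> B x x"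
proof -
  have "(\<Sum>i\<in>{m}. q ^ i * (\<Sum>g\<in>F i. g x * g x)) \<le> B x x"
    unfolding B_def by (intro sum_le_suminf summable_B level_nonneg) auto
  then show ?thesis by (simp add: power2_eq_square)
qed

text \<open>
  The unit ball is totally bounded for the Hilbertian seminorm. The values of the finitely many
  functionals of levels below \<open>M\<close> are rounded to multiples of \<open>\<delta>\<close>, and one representative is
  kept for each pattern that occurs. The levels from \<open>M\<close> on contribute little, since
  \<open>(2 * q) ^ m \<le> s ^ M * s ^ m\<close> for \<open>m \<ge> M\<close> and \<open>s = sqrt (2 * q)\<close>.
\<close>

lemma finite_net:
  assumes "0 < \<eta>"
  shows "\<exists>A. finite A \<and> A \<subseteq> {x \<in> W. norm x \<le> 1} \<and>
    (\<forall>x\<in>W. norm x \<le> 1 \<longrightarrow> (\<exists>a\<in>A. B (x - a) (x - a) \<le> \<eta>))"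
proof -
  define s where "s = sqrt (2 * q)"
  have s: "0 < s" "s < 1" "s * s = 2 * q" using q by (auto simp: s_def)
  have "(\<lambda>M. 4 * C / (1 - s) * s ^ M) \<longlonglongrightarrow> 4 * C / (1 - s) * 0"
    using s by (intro tendsto_mult_left LIMSEQ_realpow_zero) auto
  then have "eventually (\<lambda>M. 4 * C / (1 - s) * s ^ M < \<eta> / 2) sequentially"
    using assms by (intro order_tendstoD(2)[where a = "\<eta> / 2"]) auto
  then obtain M where M: "4 * C / (1 - s) * s ^ M < \<eta> / 2"
    by (auto simp: eventually_sequentially)
  define D where "D = C / (1 - 2 * q) + 1"
  have D: "0 < D" using C_nonneg q by (simp add: D_def add_nonneg_pos)
  define \<delta> where "\<delta> = min 1 (\<eta> / (2 * D))"
  have \<delta>: "0 < \<delta>" "\<delta> * \<delta> * D \<le> \<eta> / 2"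
  proof -
    show "0 < \<delta>" using assms D by (simp add: \<delta>_def)
    have "\<delta> * \<delta> * D \<le> 1 * (\<eta> / (2 * D)) * D"
      using D \<open>0 < \<delta>\<close> by (intro mult_right_mono mult_mono) (auto simp: \<delta>_def)
    then show "\<delta> * \<delta> * D \<le> \<eta> / 2" using D by simp
  qed
  define G where "G = (\<Union>m<M. F m)"
  have finG: "finite G" by (simp add: G_def finite_F)
  define U where "U = {x \<in> W. norm x \<le> 1}"
  define \<phi> where "\<phi> x = restrict (\<lambda>g. \<lfloor>g x / \<delta>\<rfloor>) G" for x
  have "\<phi> ` U \<subseteq> G \<rightarrow>\<^sub>E {- \<lceil>1 / \<delta>\<rceil> - 1..\<lceil>1 / \<delta>\<rceil>}"
  proof (rule image_subsetI, rule PiE_I)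
    fix x g assume "x \<in> U" "g \<in> G"
    then obtain m where "g \<in> F m" by (auto simp: G_def)
    with \<open>x \<in> U\<close> have "\<bar>g x\<bar> \<le> 1"
      using order_trans[OF bound_F] unfolding U_def by blast
    then have "\<bar>g x / \<delta>\<bar> \<le> 1 / \<delta>"
      using \<delta>(1) by (simp add: divide_right_mono)
    then have "- \<lceil>1 / \<delta>\<rceil> - 1 \<le> \<lfloor>g x / \<delta>\<rfloor>" "\<lfloor>g x / \<delta>\<rfloor> \<le> \<lceil>1 / \<delta>\<rceil>" by linarith+
    then show "\<phi> x g \<in> {- \<lceil>1 / \<delta>\<rceil> - 1..\<lceil>1 / \<delta>\<rceil>}"
      using \<open>g \<in> G\<close> by (simp add: \<phi>_def)
  qed (simp add: \<phi>_def)
  then have fin: "finite (\<phi> ` U)" by (rule finite_subset) (intro finite_PiE finG finite_atLeastAtMost_int)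
  define A where "A = inv_into U \<phi> ` \<phi> ` U"
  have "\<exists>a\<in>A. B (x - a) (x - a) \<le> \<eta>" if x: "x \<in> U" for x
  proof -
    define a where "a = inv_into U \<phi> (\<phi> x)"
    have a: "a \<in> A" "a \<in> U" "\<phi> a = \<phi> x"
      using x by (auto simp: a_def A_def inv_into_into f_inv_into_f)
    have close: "\<bar>g (x - a)\<bar> \<le> \<delta>" if "g \<in> G" for g
    proof -
      have "\<lfloor>g x / \<delta>\<rfloor> = \<lfloor>g a / \<delta>\<rfloor>" using fun_cong[OF a(3), of g] that by (simp add: \<phi>_def)
      then have "\<bar>g x / \<delta> - g a / \<delta>\<bar> \<le> 1" by linarith
      then have "\<bar>g x - g a\<bar> \<le> \<delta>"
        using \<delta>(1) by (simp add: diff_divide_distrib[symmetric] abs_divide divide_le_eq)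
      moreover have "g (x - a) = g x - g a" using that linear_F by (auto simp: G_def linear_diff)
      ultimately show ?thesis by simp
    qed
    have n2: "norm (x - a) \<le> 2" using x a(2) norm_triangle_ineq4[of x a] by (simp add: U_def)
    have level: "q ^ m * (\<Sum>g\<in>F m. g (x - a) * g (x - a))
        \<le> C * (\<delta> * \<delta>) * (2 * q) ^ m + 4 * C * s ^ M * s ^ m" for m
    proof (cases "m < M")
      case True
      have "\<bar>q ^ m * (\<Sum>g\<in>F m. g (x - a) * g (x - a))\<bar> \<le> C * (\<delta> * \<delta>) * (2 * q) ^ m"
        using True \<delta>(1) close
        by (intro level_bound) (auto simp: abs_mult G_def simp del: abs_mult_self_eq intro!: mult_mono)
      moreover have "0 \<le> 4 * C * s ^ M * s ^ m" using C_nonneg s by simp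
      ultimately show ?thesis by linarith
    next
      case False
      have "\<bar>q ^ m * (\<Sum>g\<in>F m. g (x - a) * g (x - a))\<bar> \<le> C * (2 * 2) * (2 * q) ^ m"
      proof (rule level_bound)
        show "\<bar>g (x - a) * g (x - a)\<bar> \<le> 2 * 2" if "g \<in> F m" for g
          using order_trans[OF bound_F[OF that] n2] unfolding abs_mult by (intro mult_mono) auto
      qed simp
      also have "(2 * q) ^ m = s ^ m * s ^ m" by (simp add: s(3)[symmetric] power_mult_distrib)
      also have "s ^ m * s ^ m \<le> s ^ M * s ^ m"
        using s False by (intro mult_right_mono power_decreasing) auto
      finally have "\<bar>q ^ m * (\<Sum>g\<in>F m. g (x - a) * g (x - a))\<bar> \<le> C * (2 * 2) * (s ^ M * s ^ m)"
        using C_nonneg by (simp add: mult_left_mono)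
      moreover have "0 \<le> C * (\<delta> * \<delta>) * (2 * q) ^ m" using C_nonneg q by simp
      ultimately show ?thesis by (simp add: mult_ac)
    qed
    have sums: "(\<lambda>m. C * (\<delta> * \<delta>) * (2 * q) ^ m + 4 * C * s ^ M * s ^ m) sums
       (C * (\<delta> * \<delta>) * (1 / (1 - 2 * q)) + 4 * C * s ^ M * (1 / (1 - s)))"
      using q s by (intro sums_add sums_mult geometric_sums) auto
    have "B (x - a) (x - a) \<le> C * (\<delta> * \<delta>) * (1 / (1 - 2 * q)) + 4 * C * s ^ M * (1 / (1 - s))"
      unfolding B_def using level by (intro sums_le[OF _ summable_sums[OF summable_B] sums]) auto
    also have "4 * C * s ^ M * (1 / (1 - s)) \<le> \<eta> / 2" using M by simp
    also have "C * (\<delta> * \<delta>) * (1 / (1 - 2 * q)) \<le> \<delta> * \<delta> * D"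
      by (simp add: D_def algebra_simps)
    also have "\<dots> \<le> \<eta> / 2" by (rule \<delta>(2))
    finally show ?thesis using a(1) by auto
  qed
  moreover have "A \<subseteq> U" by (auto simp: A_def inv_into_into)
  moreover have "finite A" unfolding A_def using fin by simp
  ultimately show ?thesis unfolding U_def by (intro exI[of _ A]) auto
qed

text \<open>
  Projecting orthogonally onto the span of a finite net moves each vector by at most its distance
  to the net. The projection has finite rank, and its range lies in \<open>W\<close> because the net does; this
  is where Hilbertian seminorms are superior to others.
\<close>

theorem finite_rank_projection:
  assumes W: "subspace W" and \<eta>: "0 < \<eta>"
  obtains I where "finite I" "I \<subseteq> W"
    "\<And>x. x \<in> W \<Longrightarrow> B (x - project I x) (x - project I x) \<le> (\<eta> * norm x)\<^sup>2"
proof -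
  obtain A where A: "finite A" "A \<subseteq> {x \<in> W. norm x \<le> 1}"
    and net: "\<And>x. x \<in> W \<Longrightarrow> norm x \<le> 1 \<Longrightarrow> \<exists>a\<in>A. B (x - a) (x - a) \<le> \<eta>\<^sup>2"
    using finite_net[of "\<eta>\<^sup>2" W] \<eta> by auto
  obtain I where I: "orthonormal I" "I \<subseteq> W" "\<And>a. a \<in> A \<Longrightarrow> B (a - project I a) (a - project I a) = 0"
    using orthonormal_hull[OF A(1) _ W] A(2) by blast
  have unit: "B (x - project I x) (x - project I x) \<le> \<eta>\<^sup>2" if "x \<in> W" "norm x \<le> 1" for x
    using net[OF that] project_minimal[OF I(1) I(3)] order_trans by blast
  show ?thesis
  proof (rule that[of I])
    show "finite I" using I(1) by (simp add: orthonormal_def)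
    show "B (x - project I x) (x - project I x) \<le> (\<eta> * norm x)\<^sup>2" if x: "x \<in> W" for x
    proof (cases "x = 0")
      case True
      have "project I 0 = 0" using project_scale[of I 0 0] by simp
      then show ?thesis using True scale_left[of 0 0 0] by simp
    next
      case False
      define y where "y = (1 / norm x) *\<^sub>R x"
      have "y \<in> W" "norm y \<le> 1" using False x W by (simp_all add: y_def subspace_scale)
      then have "(norm x)\<^sup>2 * B (y - project I y) (y - project I y) \<le> (norm x)\<^sup>2 * \<eta>\<^sup>2"
        by (intro mult_left_mono unit) auto
      moreover have "x - project I x = norm x *\<^sub>R (y - project I y)"
        using False by (simp add: y_def scaleR_diff_right project_scale)
      ultimately show ?thesis
        by (simp add: scale_left scale_right power2_eq_square mult_ac)
    qed
  qed (rule I(2))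
qed

end

section \<open>Subideals generated by an operator\<close>

locale op_space = vector_space s
  for s :: "'k::rc_field \<Rightarrow> 'b::real_normed_vector \<Rightarrow> 'b" +
  fixes X :: "'b set"
  assumes norm_scale: "norm (s c x) \<le> norm c * norm x"
    and zero_X: "0 \<in> X"
    and add_X: "x \<in> X \<Longrightarrow> y \<in> X \<Longrightarrow> x + y \<in> X"
    and scale_X: "x \<in> X \<Longrightarrow> s c x \<in> X"
begin

abbreviation L :: "('b \<Rightarrow> 'b) set" where "L \<equiv> bounded_ops s X s X"
abbreviation A :: "('k, 'b \<Rightarrow> 'b) normed_algebra" where "A \<equiv> op_algebra s X"

lemma scale_minus_one: "s (- 1) x = - x"
  by simp

lemma diff_X: "x \<in> X \<Longrightarrow> y \<in> X \<Longrightarrow> x - y \<in> X"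
  using add_X[of x "- y"] scale_X[of y "- 1"] by (simp add: scale_minus_one)

lemma op_mem: "T \<in> L \<Longrightarrow> x \<in> X \<Longrightarrow> T x \<in> X"
  and op_outside: "T \<in> L \<Longrightarrow> x \<notin> X \<Longrightarrow> T x = 0"
  and op_add: "T \<in> L \<Longrightarrow> x \<in> X \<Longrightarrow> y \<in> X \<Longrightarrow> T (x + y) = T x + T y"
  and op_scale: "T \<in> L \<Longrightarrow> x \<in> X \<Longrightarrow> T (s c x) = s c (T x)"
  by (auto simp: bounded_ops_def)

lemma op_zero: "T \<in> L \<Longrightarrow> T 0 = 0"
  using op_add[OF _ zero_X zero_X, of T] by simp

lemma op_diff: "T \<in> L \<Longrightarrow> x \<in> X \<Longrightarrow> y \<in> X \<Longrightarrow> T (x - y) = T x - T y"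
  using op_add[of T "x - y" y] by (simp add: diff_X)

lemma op_bound:
  assumes "T \<in> L"
  obtains K where "0 < K" "\<And>x. norm (T x) \<le> K * norm x"
proof (rule that[of "max 1 (onorm T)"])
  show "norm (T x) \<le> max 1 (onorm T) * norm x" for x
    using norm_bounded_ops_le[OF assms, of x] by (rule order_trans) (simp add: mult_right_mono)
qed simp

lemma bounded_opI:
  assumes "\<And>x. x \<in> X \<Longrightarrow> T x \<in> X" "\<And>x. x \<notin> X \<Longrightarrow> T x = 0"
    "\<And>x y. x \<in> X \<Longrightarrow> y \<in> X \<Longrightarrow> T (x + y) = T x + T y"
    "\<And>c x. x \<in> X \<Longrightarrow> T (s c x) = s c (T x)" "\<And>x. x \<in> X \<Longrightarrow> norm (T x) \<le> K * norm x"
  shows "T \<in> L"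
  using assms unfolding bounded_ops_def by blast

lemma L_add: assumes "T \<in> L" "U \<in> L" shows "(\<lambda>x. T x + U x) \<in> L"
proof -
  obtain K where K: "\<And>x. norm (T x) \<le> K * norm x" using op_bound[OF assms(1)] by blast
  obtain M where M: "\<And>x. norm (U x) \<le> M * norm x" using op_bound[OF assms(2)] by blast
  show ?thesis
  proof (rule bounded_opI[where K = "K + M"])
    show "norm (T x + U x) \<le> (K + M) * norm x" for x
      using norm_triangle_ineq[of "T x" "U x"] K[of x] M[of x] by (simp add: distrib_right)
  qed (use assms in \<open>simp_all add: op_mem op_outside op_add op_scale add_X scale_right_distrib\<close>)
qed

lemma L_scale: assumes "T \<in> L" shows "(\<lambda>x. s c (T x)) \<in> L"
proof -
  obtain K where K: "\<And>x. norm (T x) \<le> K * norm x" using op_bound[OF assms(1)] by blast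
  show ?thesis
  proof (rule bounded_opI[where K = "norm c * K"])
    show "norm (s c (T x)) \<le> norm c * K * norm x" for x
    proof -
      have "norm (s c (T x)) \<le> norm c * norm (T x)" by (rule norm_scale)
      also have "\<dots> \<le> norm c * (K * norm x)" by (intro mult_left_mono K) simp
      finally show ?thesis by (simp only: mult.assoc)
    qed
    show "s c (T x) \<in> X" if "x \<in> X" for x
      using op_mem[OF assms that] by (rule scale_X)
    show "s c (T x) = 0" if "x \<notin> X" for x
      using op_outside[OF assms that] by simp
    show "s c (T (x + y)) = s c (T x) + s c (T y)" if "x \<in> X" "y \<in> X" for x y
      by (simp only: op_add[OF assms that] scale_right_distrib)
    show "s c (T (s d x)) = s d (s c (T x))" if "x \<in> X" for d x
      by (simp only: op_scale[OF assms that] scale_left_commute)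
  qed
qed

lemma L_diff: "T \<in> L \<Longrightarrow> U \<in> L \<Longrightarrow> (\<lambda>x. T x - U x) \<in> L"
  using L_add[OF _ L_scale[of U "- 1"], of T] by (simp add: scale_minus_one)

lemma L_comp: assumes "T \<in> L" "U \<in> L" shows "T \<circ> U \<in> L"
proof -
  obtain K where K: "0 < K" "\<And>x. norm (T x) \<le> K * norm x" using op_bound[OF assms(1)] by blast
  obtain M where M: "\<And>x. norm (U x) \<le> M * norm x" using op_bound[OF assms(2)] by blast
  show ?thesis
  proof (rule bounded_opI[where K = "K * M"])
    show "norm ((T \<circ> U) x) \<le> K * M * norm x" for x
    proof -
      have "norm (T (U x)) \<le> K * norm (U x)" by (rule K(2))
      also have "\<dots> \<le> K * (M * norm x)" using K(1) by (intro mult_left_mono M) simp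
      finally show ?thesis by (simp add: mult.assoc)
    qed
  qed (use assms in \<open>simp_all add: op_mem op_outside op_add op_scale op_zero\<close>)
qed

definition one :: "'b \<Rightarrow> 'b" where "one x = (if x \<in> X then x else 0)"

lemma L_one: "one \<in> L"
  by (rule bounded_opI[where K = 1]) (auto simp: one_def add_X scale_X)

lemma op_range: "T \<in> L \<Longrightarrow> T x \<in> X"
  by (cases "x \<in> X") (simp_all add: op_mem op_outside zero_X)

lemma one_comp: "T \<in> L \<Longrightarrow> one \<circ> T = T" and comp_one: "T \<in> L \<Longrightarrow> T \<circ> one = T"
  by (auto simp: fun_eq_iff one_def op_outside op_zero op_range)

lemma comp_add: "T \<in> L \<Longrightarrow> U \<in> L \<Longrightarrow> V \<in> L \<Longrightarrow> T \<circ> (\<lambda>x. U x + V x) = (\<lambda>x. (T \<circ> U) x + (T \<circ> V) x)"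
proof
  fix x assume "T \<in> L" "U \<in> L" "V \<in> L"
  then show "(T \<circ> (\<lambda>x. U x + V x)) x = (T \<circ> U) x + (T \<circ> V) x"
    by (cases "x \<in> X") (simp_all add: op_add op_mem op_outside op_zero)
qed

lemma comp_scale: "T \<in> L \<Longrightarrow> U \<in> L \<Longrightarrow> T \<circ> (\<lambda>x. s c (U x)) = (\<lambda>x. s c ((T \<circ> U) x))"
proof
  fix x assume "T \<in> L" "U \<in> L"
  then show "(T \<circ> (\<lambda>x. s c (U x))) x = s c ((T \<circ> U) x)"
    by (cases "x \<in> X") (simp_all add: op_scale op_mem op_outside op_zero)
qed

lemma op_algebra_simps [simp]:
  "carr A = L" "add A T U = (\<lambda>x. T x + U x)" "smul A c T = (\<lambda>x. s c (T x))"
  "mul A T U = T \<circ> U" "nrm A T = onorm T"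
  by (simp_all add: op_algebra_def)

text \<open>
  From here on, approximation in operator norm is expressed by pointwise estimates.
\<close>

lemma closure_iff:
  assumes G: "G \<subseteq> L"
  shows "T \<in> norm_closure A G \<longleftrightarrow>
    T \<in> L \<and> (\<forall>e>0. \<exists>U\<in>G. \<forall>x. norm (T x - U x) \<le> e * norm x)"
proof (intro iffI conjI allI impI)
  assume T: "T \<in> norm_closure A G"
  then show TL: "T \<in> L" by (simp add: norm_closure_def)
  fix e :: real assume "0 < e"
  with T obtain U where U: "U \<in> G" "onorm (\<lambda>x. T x - U x) < e"
    by (auto simp: norm_closure_def scale_minus_one)
  have "U \<in> L" using U G by auto
  have "norm (T x - U x) \<le> e * norm x" for x
  proof -
    have "norm (T x - U x) \<le> onorm (\<lambda>x. T x - U x) * norm x"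
      using norm_bounded_ops_le[OF L_diff[OF TL \<open>U \<in> L\<close>], of x] .
    also have "\<dots> \<le> e * norm x" using U(2) by (intro mult_right_mono) auto
    finally show ?thesis .
  qed
  with U show "\<exists>U\<in>G. \<forall>x. norm (T x - U x) \<le> e * norm x" by blast
next
  assume T: "T \<in> L \<and> (\<forall>e>0. \<exists>U\<in>G. \<forall>x. norm (T x - U x) \<le> e * norm x)"
  have "\<exists>U\<in>G. onorm (\<lambda>x. T x - U x) < e" if "0 < e" for e
  proof -
    have "0 < e / 2" using that by simp
    with T obtain U where U: "U \<in> G" "\<And>x. norm (T x - U x) \<le> e / 2 * norm x" by blast
    have "onorm (\<lambda>x. T x - U x) \<le> e / 2"
      using T U G that by (intro onorm_bounded_ops_le[OF L_diff]) auto
    with U that show ?thesis by (intro bexI[of _ U]) auto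
  qed
  with T show "T \<in> norm_closure A G" by (simp add: norm_closure_def scale_minus_one)
qed

lemma closure_subset_L: "norm_closure A G \<subseteq> L"
  by (auto simp: norm_closure_def)

lemma subset_closure:
  assumes "G \<subseteq> L"
  shows "G \<subseteq> norm_closure A G"
proof
  fix T assume T: "T \<in> G"
  have "\<forall>x. norm (T x - T x) \<le> e * norm x" if "0 < e" for e
    using that by simp
  with T assms show "T \<in> norm_closure A G" unfolding closure_iff[OF assms] by blast
qed

lemma closure_closed:
  assumes G: "G \<subseteq> L"
  shows "norm_closed A (norm_closure A G)"
  unfolding norm_closed_def
proof (intro conjI subsetI)
  show "x \<in> carr A" if "x \<in> norm_closure A G" for x using that closure_subset_L by auto
  fix T assume T: "T \<in> norm_closure A (norm_closure A G)"
  show "T \<in> norm_closure A G"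
    unfolding closure_iff[OF G]
  proof (intro conjI allI impI)
    show "T \<in> L" using T closure_subset_L by auto
    fix e :: real assume "0 < e"
    then have "0 < e / 2" by simp
    with T obtain U where U: "U \<in> norm_closure A G" "\<And>x. norm (T x - U x) \<le> e / 2 * norm x"
      unfolding closure_iff[OF closure_subset_L] by blast
    from U(1) \<open>0 < e / 2\<close> obtain V where V: "V \<in> G" "\<And>x. norm (U x - V x) \<le> e / 2 * norm x"
      unfolding closure_iff[OF G] by blast
    have "norm (T x - V x) \<le> e * norm x" for x
      using norm_triangle_ineq[of "T x - U x" "U x - V x"] U(2)[of x] V(2)[of x] by simp
    with V show "\<exists>U\<in>G. \<forall>x. norm (T x - U x) \<le> e * norm x" by blast
  qed
qed

lemma closure_linear:
  assumes G: "linear_subset A G"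
  shows "linear_subset A (norm_closure A G)"
proof -
  have GL: "G \<subseteq> L" and ne: "G \<noteq> {}" and add: "\<And>T U. T \<in> G \<Longrightarrow> U \<in> G \<Longrightarrow> (\<lambda>x. T x + U x) \<in> G"
    and sc: "\<And>c T. T \<in> G \<Longrightarrow> (\<lambda>x. s c (T x)) \<in> G"
    using G by (auto simp: linear_subset_def)
  have "(\<lambda>x. T x + U x) \<in> norm_closure A G" if TU: "T \<in> norm_closure A G" "U \<in> norm_closure A G" for T U
    unfolding closure_iff[OF GL]
  proof (intro conjI allI impI)
    show "(\<lambda>x. T x + U x) \<in> L" using TU closure_subset_L by (intro L_add) auto
    fix e :: real assume "0 < e"
    then have "0 < e / 2" by simp
    with TU(1) obtain T' where T': "T' \<in> G" "\<And>x. norm (T x - T' x) \<le> e / 2 * norm x"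
      unfolding closure_iff[OF GL] by blast
    from TU(2) \<open>0 < e / 2\<close> obtain U' where U': "U' \<in> G" "\<And>x. norm (U x - U' x) \<le> e / 2 * norm x"
      unfolding closure_iff[OF GL] by blast
    have "norm ((T x + U x) - (T' x + U' x)) \<le> e * norm x" for x
      using norm_triangle_ineq[of "T x - T' x" "U x - U' x"] T'(2)[of x] U'(2)[of x]
      by (simp add: algebra_simps)
    then show "\<exists>V\<in>G. \<forall>x. norm ((T x + U x) - V x) \<le> e * norm x"
      by (intro bexI[OF _ add[OF T'(1) U'(1)]] allI)
  qed
  moreover have "(\<lambda>x. s c (T x)) \<in> norm_closure A G" if T: "T \<in> norm_closure A G" for c T
    unfolding closure_iff[OF GL]
  proof (intro conjI allI impI)
    show "(\<lambda>x. s c (T x)) \<in> L" using T closure_subset_L by (intro L_scale) auto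
    fix e :: real assume e: "0 < e"
    \<comment> \<open>Adding one avoids a separate treatment of the scalar zero.\<close>
    define d where "d = e / (norm c + 1)"
    have c: "0 < norm c + 1" by (simp add: add_nonneg_pos)
    then have d: "0 < d" using e by (simp add: d_def)
    have "norm c * d \<le> (norm c + 1) * d" using d by (intro mult_right_mono) auto
    also have "\<dots> = e" using c by (simp add: d_def)
    finally have d: "0 < d" "norm c * d \<le> e" using d by auto
    from T d(1) obtain T' where T': "T' \<in> G" "\<And>x. norm (T x - T' x) \<le> d * norm x"
      unfolding closure_iff[OF GL] by blast
    have "norm (s c (T x) - s c (T' x)) \<le> e * norm x" for x
    proof -
      have "norm (s c (T x) - s c (T' x)) \<le> norm c * norm (T x - T' x)"
        using norm_scale[of c "T x - T' x"] by (simp add: scale_right_diff_distrib)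
      also have "\<dots> \<le> norm c * (d * norm x)" by (intro mult_left_mono T') auto
      also have "\<dots> \<le> e * norm x" using mult_right_mono[OF d(2), of "norm x"] by (simp add: mult.assoc)
      finally show ?thesis .
    qed
    then show "\<exists>V\<in>G. \<forall>x. norm (s c (T x) - V x) \<le> e * norm x"
      by (intro bexI[OF _ sc[OF T'(1)]] allI)
  qed
  ultimately show ?thesis
    using subset_closure[OF GL] ne closure_subset_L[of G] unfolding linear_subset_def by auto
qed

lemma closure_mono: "G \<subseteq> H \<Longrightarrow> norm_closure A G \<subseteq> norm_closure A H"
  unfolding norm_closure_def by blast

text \<open>
  A product \<open>T \<circ> B\<close> is approximated by \<open>U \<circ> V\<close>, where \<open>U\<close> is chosen first, depending on the norm
  of \<open>B\<close>, and then \<open>V\<close>, depending on the norm of \<open>U\<close>.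
\<close>

lemma closure_ideal:
  assumes G: "linear_subset A G" and H: "H \<subseteq> L" and GH: "G \<subseteq> H"
    and ideal: "\<And>f h. f \<in> G \<Longrightarrow> h \<in> H \<Longrightarrow> f \<circ> h \<in> G \<and> h \<circ> f \<in> G"
  shows "ideal_of A (norm_closure A G) (norm_closure A H)"
proof -
  have GL: "G \<subseteq> L" using G by (simp add: linear_subset_def)
  have "T \<circ> B \<in> norm_closure A G \<and> B \<circ> T \<in> norm_closure A G"
    if T: "T \<in> norm_closure A G" and B: "B \<in> norm_closure A H" for T B
  proof -
    have TL: "T \<in> L" and BL: "B \<in> L" using T B closure_subset_L by auto
    obtain K where K: "0 < K" "\<And>x. norm (B x) \<le> K * norm x" using op_bound[OF BL] by blast
    have approx: "\<exists>U\<in>G. \<exists>V\<in>H. \<forall>x. norm ((T \<circ> B) x - (U \<circ> V) x) \<le> e * norm x \<and>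
        norm ((B \<circ> T) x - (V \<circ> U) x) \<le> e * norm x" if e: "0 < e" for e
    proof -
      have "0 < e / (2 * K)" using e K by simp
      with T obtain U where U: "U \<in> G" "\<And>x. norm (T x - U x) \<le> e / (2 * K) * norm x"
        unfolding closure_iff[OF GL] by blast
      have UL: "U \<in> L" using U GL by auto
      obtain M where M: "0 < M" "\<And>x. norm (U x) \<le> M * norm x" using op_bound[OF UL] by blast
      have "0 < e / (2 * M)" using e M by simp
      with B obtain V where V: "V \<in> H" "\<And>x. norm (B x - V x) \<le> e / (2 * M) * norm x"
        unfolding closure_iff[OF H] by blast
      have VL: "V \<in> L" using V H by auto
      have "norm (T (B x) - U (V x)) \<le> e * norm x" for x
      proof -
        have "U (B x - V x) = U (B x) - U (V x)"
          by (cases "x \<in> X") (simp_all add: op_diff[OF UL] op_mem[OF BL] op_mem[OF VL]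
              op_outside[OF BL] op_outside[OF VL] op_zero[OF UL])
        then have "T (B x) - U (V x) = (T (B x) - U (B x)) + U (B x - V x)" by simp
        then have "norm (T (B x) - U (V x)) \<le> norm (T (B x) - U (B x)) + norm (U (B x - V x))"
          using norm_triangle_ineq by metis
        also have "\<dots> \<le> e / (2 * K) * (K * norm x) + M * (e / (2 * M) * norm x)"
          using e K(1) M(1)
          by (intro add_mono order_trans[OF U(2) mult_left_mono[OF K(2)]]
              order_trans[OF M(2) mult_left_mono[OF V(2)]]) auto
        also have "\<dots> = e * norm x" using K(1) M(1) by simp
        finally show ?thesis .
      qed
      moreover have "norm (B (T x) - V (U x)) \<le> e * norm x" for x
      proof -
        have "B (T x - U x) = B (T x) - B (U x)"
          by (cases "x \<in> X") (simp_all add: op_diff[OF BL] op_mem[OF TL] op_mem[OF UL]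
              op_outside[OF TL] op_outside[OF UL] op_zero[OF BL])
        then have "B (T x) - V (U x) = B (T x - U x) + (B (U x) - V (U x))" by simp
        then have "norm (B (T x) - V (U x)) \<le> norm (B (T x - U x)) + norm (B (U x) - V (U x))"
          using norm_triangle_ineq by metis
        also have "\<dots> \<le> K * (e / (2 * K) * norm x) + e / (2 * M) * (M * norm x)"
          using e K(1) M(1)
          by (intro add_mono order_trans[OF K(2) mult_left_mono[OF U(2)]]
              order_trans[OF V(2) mult_left_mono[OF M(2)]]) auto
        also have "\<dots> = e * norm x" using K(1) M(1) by simp
        finally show ?thesis .
      qed
      ultimately show ?thesis using U(1) V(1) by (intro bexI[of _ U] bexI[of _ V]) auto
    qed
    show ?thesis
      unfolding closure_iff[OF GL] using L_comp[OF TL BL] L_comp[OF BL TL] approx ideal by meson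
  qed
  then show ?thesis
    using closure_linear[OF G] closure_mono[OF GH] by (simp add: ideal_of_def)
qed

inductive_set lin :: "('b \<Rightarrow> 'b) set \<Rightarrow> ('b \<Rightarrow> 'b) set" for G where
  base: "f \<in> G \<Longrightarrow> f \<in> lin G"
| add: "f \<in> lin G \<Longrightarrow> g \<in> lin G \<Longrightarrow> (\<lambda>x. f x + g x) \<in> lin G"
| scale: "f \<in> lin G \<Longrightarrow> (\<lambda>x. s c (f x)) \<in> lin G"

lemma lin_subset_L: "G \<subseteq> L \<Longrightarrow> lin G \<subseteq> L"
proof
  fix f assume "G \<subseteq> L" "f \<in> lin G"
  from this(2,1) show "f \<in> L" by induction (auto intro: L_add L_scale)
qed

lemma lin_mono: "G \<subseteq> H \<Longrightarrow> lin G \<subseteq> lin H"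
proof
  fix f assume "G \<subseteq> H" "f \<in> lin G"
  from this(2,1) show "f \<in> lin H" by induction (auto intro: lin.intros)
qed

lemma lin_linear: "G \<subseteq> L \<Longrightarrow> G \<noteq> {} \<Longrightarrow> linear_subset A (lin G)"
  using lin_subset_L[of G] by (auto simp: linear_subset_def intro: lin.intros)

lemma lin_comp:
  assumes GL: "G \<subseteq> L" and HL: "H \<subseteq> L" and EL: "E \<subseteq> L"
    and GH: "\<And>f h. f \<in> G \<Longrightarrow> h \<in> H \<Longrightarrow> f \<circ> h \<in> E"
    and f: "f \<in> lin G" and h: "h \<in> lin H"
  shows "f \<circ> h \<in> lin E"
  using f
proof induction
  case (base f)
  from h show ?case
  proof induction
    case (base h)
    with GH[OF \<open>f \<in> G\<close>] show ?case by (intro lin.base)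
  next
    case (add g h)
    have "f \<circ> (\<lambda>x. g x + h x) = (\<lambda>x. (f \<circ> g) x + (f \<circ> h) x)"
      using base GL add lin_subset_L[OF HL] by (intro comp_add) auto
    then show ?case using lin.add[OF add.IH] by simp
  next
    case (scale h c)
    have "f \<circ> (\<lambda>x. s c (h x)) = (\<lambda>x. s c ((f \<circ> h) x))"
      using base GL scale lin_subset_L[OF HL] by (intro comp_scale) auto
    then show ?case using lin.scale[OF scale.IH] by simp
  qed
next
  case (add f g)
  then show ?case using lin.add[OF add.IH] by (simp add: comp_def)
next
  case (scale f c)
  then show ?case using lin.scale[OF scale.IH] by (simp add: comp_def)
qed

text \<open>
  The products of operators in which \<open>S\<close> occurs at least \<open>k\<close> times as a factor.
\<close>

fun words :: "('b \<Rightarrow> 'b) \<Rightarrow> nat \<Rightarrow> ('b \<Rightarrow> 'b) set" where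
  "words S 0 = L"
| "words S (Suc k) = {a \<circ> S \<circ> b | a b. a \<in> L \<and> b \<in> words S k}"

definition generating_ops :: "('b \<Rightarrow> 'b) \<Rightarrow> nat \<Rightarrow> ('b \<Rightarrow> 'b) set" where
  "generating_ops S k = {S ^^ Suc j | j. True} \<union> words S k"

context
  fixes S assumes S: "S \<in> L"
begin

lemma words_subset_L: "words S k \<subseteq> L"
  by (induction k) (auto intro!: L_comp S)

lemma words_left: "a \<in> L \<Longrightarrow> w \<in> words S k \<Longrightarrow> a \<circ> w \<in> words S k"
proof (cases k)
  case (Suc i)
  assume "a \<in> L" "w \<in> words S k"
  then obtain c b where "w = c \<circ> S \<circ> b" "c \<in> L" "b \<in> words S i" using Suc by auto
  moreover have "a \<circ> (c \<circ> S \<circ> b) = (a \<circ> c) \<circ> S \<circ> b" by (simp add: comp_assoc)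
  ultimately show ?thesis using L_comp[OF \<open>a \<in> L\<close>] unfolding Suc words.simps by blast
qed (auto intro: L_comp)

lemma words_right: "b \<in> L \<Longrightarrow> w \<in> words S k \<Longrightarrow> w \<circ> b \<in> words S k"
proof (induction k arbitrary: w)
  case (Suc k)
  then obtain c w' where "w = c \<circ> S \<circ> w'" "c \<in> L" "w' \<in> words S k" by auto
  moreover have "(c \<circ> S \<circ> w') \<circ> b = c \<circ> S \<circ> (w' \<circ> b)" by (simp add: comp_assoc)
  ultimately show ?case using Suc.IH[OF Suc.prems(1)] unfolding words.simps by blast
qed (auto intro: L_comp)

lemma words_Suc_subset: "words S (Suc k) \<subseteq> words S k"
proof (induction k)
  case 0
  then show ?case using words_subset_L[of 1] by simp
next
  case (Suc k)
  show ?case using Suc.IH by (auto simp del: words.simps(2) simp: words.simps(2)[of S k] words.simps(2)[of S "Suc k"]) blast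
qed

lemma words_S_left: "w \<in> words S k \<Longrightarrow> S \<circ> w \<in> words S (Suc k)"
proof -
  assume w: "w \<in> words S k"
  have "S \<circ> w = one \<circ> S \<circ> w" by (simp only: one_comp[OF S])
  with w L_one show ?thesis unfolding words.simps by blast
qed

lemma words_S_right: "w \<in> words S k \<Longrightarrow> w \<circ> S \<in> words S (Suc k)"
proof (induction k arbitrary: w)
  case 0
  then have "w \<circ> S = w \<circ> S \<circ> one" by (simp only: comp_assoc comp_one[OF S])
  with 0 L_one show ?case unfolding words.simps by blast
next
  case (Suc k)
  then obtain c w' where w: "w = c \<circ> S \<circ> w'" "c \<in> L" "w' \<in> words S k" by auto
  have "(c \<circ> S \<circ> w') \<circ> S = c \<circ> S \<circ> (w' \<circ> S)" by (simp add: comp_assoc)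
  with w Suc.IH[OF w(3)] show ?case unfolding words.simps(2)[of S "Suc k"] by blast
qed

lemma pow_L: "S ^^ Suc j \<in> L"
proof (induction j)
  case 0
  show ?case using S by simp
next
  case (Suc j)
  then show ?case using L_comp[OF S Suc.IH] by (simp only: funpow.simps(2)[of "Suc j"])
qed

lemma pow_words: "S ^^ Suc j \<in> words S 1"
proof (cases j)
  case 0
  have "S = one \<circ> S \<circ> one" by (simp add: one_comp[OF S] comp_one[OF S])
  with L_one show ?thesis using 0 by auto
next
  case (Suc i)
  then show ?thesis using words_S_left[of "S ^^ Suc i" 0] pow_L[of i] by simp
qed

lemma pow_comp_words: "w \<in> words S k \<Longrightarrow> S ^^ i \<circ> w \<in> words S k"
  by (induction i) (auto simp: comp_assoc intro: words_left[OF S])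

lemma words_comp_pow: "w \<in> words S k \<Longrightarrow> w \<circ> S ^^ i \<in> words S k"
proof (induction i)
  case (Suc i)
  then have "(w \<circ> S ^^ i) \<circ> S \<in> words S k" by (intro words_right[OF S])
  then show ?case by (simp only: funpow_Suc_right comp_assoc)
qed simp

lemma generating_ops_subset_L: "generating_ops S k \<subseteq> L"
  using pow_L words_subset_L by (auto simp: generating_ops_def simp del: funpow.simps)

lemma generating_ops_comp:
  assumes f: "f \<in> generating_ops S (Suc k)" and g: "g \<in> generating_ops S k"
  shows "f \<circ> g \<in> generating_ops S (Suc k) \<and> g \<circ> f \<in> generating_ops S (Suc k)"
proof -
  have gL: "g \<in> L" using g generating_ops_subset_L by blast
  consider (w) "f \<in> words S (Suc k)" | (pp) i j where "f = S ^^ Suc i" "g = S ^^ Suc j"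
    | (pw) i where "f = S ^^ Suc i" "g \<in> words S k"
    using f g by (auto simp: generating_ops_def simp del: funpow.simps words.simps)
  then show ?thesis
  proof cases
    case w
    then show ?thesis using words_left[OF gL w] words_right[OF gL w] by (simp add: generating_ops_def del: words.simps)
  next
    case pp
    then have "f \<circ> g = S ^^ Suc (Suc (i + j))" "g \<circ> f = S ^^ Suc (Suc (i + j))"
      by (simp_all only: funpow_add[symmetric] add_Suc add_Suc_right add.commute)
    then show ?thesis by (auto simp: generating_ops_def simp del: funpow.simps words.simps)
  next
    case pw
    have "S \<circ> (S ^^ i \<circ> g) \<in> words S (Suc k)" by (intro words_S_left pow_comp_words pw)
    moreover have "(g \<circ> S ^^ i) \<circ> S \<in> words S (Suc k)" by (intro words_S_right words_comp_pow pw)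
    moreover have "f \<circ> g = S \<circ> (S ^^ i \<circ> g)" "g \<circ> f = (g \<circ> S ^^ i) \<circ> S"
      unfolding pw funpow_Suc_right by (simp_all add: fun_eq_iff funpow_swap1)
    ultimately show ?thesis by (simp add: generating_ops_def del: words.simps)
  qed
qed

lemma generating_ops_Suc_subset: "generating_ops S (Suc k) \<subseteq> generating_ops S k"
  using words_Suc_subset[of k] by (auto simp: generating_ops_def simp del: funpow.simps words.simps)

text \<open>
  The chain consists of the algebras for \<open>k = 0, \<dots>, n\<close>. Multiplying a power of \<open>S\<close> with a word
  containing \<open>k\<close> factors \<open>S\<close> produces one more factor \<open>S\<close>, and a word with \<open>k + 1\<close> factors keeps
  them in every product. Hence each algebra is an ideal of the preceding one.
\<close>

theorem subideal_chain: "norm_closure A (lin (generating_ops S n)) \<in> closed_subideals n A"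
  unfolding closed_subideals_def
proof (intro CollectI exI[of _ "\<lambda>k. norm_closure A (lin (generating_ops S k))"] conjI allI ballI impI refl)
  have ne: "generating_ops S k \<noteq> {}" for k by (auto simp: generating_ops_def)
  have lin: "linear_subset A (lin (generating_ops S k))" for k by (rule lin_linear[OF generating_ops_subset_L ne])
  have linL: "lin (generating_ops S k) \<subseteq> L" for k by (rule lin_subset_L[OF generating_ops_subset_L])
  have ideal: "ideal_of A (norm_closure A (lin (generating_ops S (Suc k)))) (norm_closure A (lin (generating_ops S k)))" for k
  proof (rule closure_ideal[OF lin linL lin_mono[OF generating_ops_Suc_subset]])
    fix f h assume fh: "f \<in> lin (generating_ops S (Suc k))" "h \<in> lin (generating_ops S k)"
    show "f \<circ> h \<in> lin (generating_ops S (Suc k)) \<and> h \<circ> f \<in> lin (generating_ops S (Suc k))"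
      using lin_comp[OF generating_ops_subset_L generating_ops_subset_L generating_ops_subset_L _ fh]
        lin_comp[OF generating_ops_subset_L generating_ops_subset_L generating_ops_subset_L _ fh(2,1)] generating_ops_comp by blast
  qed
  show L0: "norm_closure A (lin (generating_ops S 0)) = carr A"
    using closure_subset_L subset_closure[OF linL[of 0]] lin.base[of _ "generating_ops S 0"]
    by (fastforce simp: generating_ops_def)
  show "norm_closed A (norm_closure A (lin (generating_ops S k)))" for k by (rule closure_closed[OF linL])
  show "subalgebra A (norm_closure A (lin (generating_ops S k)))" for k
  proof (cases k)
    case 0
    show ?thesis using closure_linear[OF lin[of 0]] unfolding 0 L0 by (auto simp: subalgebra_def L_comp)
  next
    case (Suc i)
    from ideal[of i] show ?thesis unfolding Suc subalgebra_def ideal_of_def by blast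
  qed
  show "ideal_of A (norm_closure A (lin (generating_ops S k))) (norm_closure A (lin (generating_ops S (k - 1))))"
    if "k \<in> {1..n}" for k
    using that ideal[of "k - 1"] by simp
qed

text \<open>
  This separates operators from the algebras of the chain.
\<close>

lemma functional_vanishes_on_closure:
  fixes \<beta> :: "('b \<Rightarrow> 'b) \<Rightarrow> 'k"
  assumes add: "\<And>T U. T \<in> L \<Longrightarrow> U \<in> L \<Longrightarrow> \<beta> (\<lambda>x. T x + U x) = \<beta> T + \<beta> U"
    and scale: "\<And>c T. T \<in> L \<Longrightarrow> \<beta> (\<lambda>x. s c (T x)) = c * \<beta> T"
    and bound: "\<And>T e. T \<in> L \<Longrightarrow> 0 \<le> e \<Longrightarrow> (\<And>x. norm (T x) \<le> e * norm x) \<Longrightarrow> norm (\<beta> T) \<le> C * e"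
    and generating_ops: "\<And>T. T \<in> generating_ops S k \<Longrightarrow> \<beta> T = 0"
    and T: "T \<in> norm_closure A (lin (generating_ops S k))"
  shows "\<beta> T = 0"
proof -
  have linL: "lin (generating_ops S k) \<subseteq> L" by (rule lin_subset_L[OF generating_ops_subset_L])
  have z: "\<beta> U = 0" if "U \<in> lin (generating_ops S k)" for U
    using that
  proof induction
    case (add f g)
    then show ?case using assms(1)[of f g] linL by auto
  next
    case (scale f c)
    then show ?case using assms(2)[of f c] linL by auto
  qed (rule generating_ops)
  have TL: "T \<in> L" using T closure_subset_L by auto
  have "norm (\<beta> T) \<le> C * e" if e: "0 < e" for e
  proof -
    from T e obtain U where U: "U \<in> lin (generating_ops S k)" "\<And>x. norm (T x - U x) \<le> e * norm x"
      unfolding closure_iff[OF linL] by blast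
    have UL: "U \<in> L" using U(1) linL by auto
    have "\<beta> T = \<beta> U + \<beta> (\<lambda>x. T x - U x)" using add[OF UL L_diff[OF TL UL]] by simp
    then show ?thesis using z[OF U(1)] bound[OF L_diff[OF TL UL] _ U(2)] e by simp
  qed
  then have "norm (\<beta> T) \<le> 0"
    by (intro tendsto_lowerbound[of "\<lambda>e. C * e" 0 "at_right 0"])
      (auto intro!: tendsto_eq_intros simp: eventually_at_right_less intro: eventually_mono[OF eventually_at_right_less])
  then show ?thesis by simp
qed

end

text \<open>
  As \<open>S\<close> lies in all members of the chain, each multiplication by \<open>S\<close> from the right leads from
  one member of the chain to the next smaller one.
\<close>

lemma subideal_absorbs:
  assumes M: "M \<in> closed_subideals n A" and S: "S \<in> M" and a: "a \<in> L"
  shows "a \<circ> S ^^ n \<in> M"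
proof -
  from M obtain J where J: "J 0 = L" "J n = M"
    and ideal: "\<And>k. k \<in> {1..n} \<Longrightarrow> ideal_of A (J k) (J (k - 1))"
    by (auto simp: closed_subideals_def)
  have dec: "J (n - i) \<supseteq> M" if "i \<le> n" for i
    using that
  proof (induction i)
    case (Suc i)
    then have "J (n - i) \<subseteq> J (n - i - 1)" using ideal[of "n - i"] by (auto simp: ideal_of_def)
    with Suc show ?case by auto
  qed (simp add: J)
  have "a \<circ> S ^^ k \<in> J k" if "k \<le> n" for k
    using that
  proof (induction k)
    case (Suc k)
    have "S \<in> J (Suc k)" using dec[of "n - Suc k"] S Suc.prems by auto
    moreover have "a \<circ> S ^^ k \<in> J k" by (rule Suc.IH[OF Suc_leD[OF Suc.prems]])
    moreover have "ideal_of A (J (Suc k)) (J k)" using ideal[of "Suc k"] Suc.prems by simp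
    ultimately have "(a \<circ> S ^^ k) \<circ> S \<in> J (Suc k)"
      unfolding ideal_of_def op_algebra_simps by blast
    then show ?case by (simp only: funpow_Suc_right comp_assoc)
  qed (simp add: J a)
  with J show ?thesis by auto
qed

end

lemma closed_subideals_Suc: "closed_subideals n A \<subseteq> closed_subideals (Suc n) A"
proof
  fix M assume "M \<in> closed_subideals n A"
  then obtain J where J: "J 0 = carr A" "J n = M" "\<And>k. k \<le> n \<Longrightarrow> subalgebra A (J k) \<and> norm_closed A (J k)"
    "\<And>k. k \<in> {1..n} \<Longrightarrow> ideal_of A (J k) (J (k - 1))"
    by (auto simp: closed_subideals_def)
  have "ideal_of A M M" using J(3)[of n] J(2) by (auto simp: ideal_of_def subalgebra_def)
  then show "M \<in> closed_subideals (Suc n) A"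
    unfolding closed_subideals_def using J
    by (intro CollectI exI[of _ "\<lambda>k. J (min k n)"]) (auto simp: min_def le_Suc_eq)
qed

section \<open>Spaces of null sequences spanned by the rows\<close>

lemma subspace_closure_real:
  fixes S :: "'a::real_normed_vector set"
  assumes "subspace S"
  shows "subspace (closure S)"
  unfolding subspace_def
proof (intro conjI ballI allI)
  show "0 \<in> closure S" using subspace_0[OF assms] closure_subset by blast
next
  fix x y assume "x \<in> closure S" "y \<in> closure S"
  then obtain f g where "\<forall>n. f n \<in> S" "f \<longlonglongrightarrow> x" "\<forall>n. g n \<in> S" "g \<longlonglongrightarrow> y"
    unfolding closure_sequential by blast
  then show "x + y \<in> closure S"
    unfolding closure_sequential
    by (intro exI[of _ "\<lambda>n. f n + g n"]) (auto intro: tendsto_add subspace_add[OF assms])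
next
  fix c :: real and x assume "x \<in> closure S"
  then obtain f where "\<forall>n. f n \<in> S" "f \<longlonglongrightarrow> x"
    unfolding closure_sequential by blast
  then show "c *\<^sub>R x \<in> closure S"
    unfolding closure_sequential
    by (intro exI[of _ "\<lambda>n. c *\<^sub>R f n"]) (auto intro: tendsto_scaleR subspace_scale[OF assms])
qed

lemma bounded_linear_into_closed_subspace:
  assumes f: "bounded_linear f" and "f ` S \<subseteq> closure T"
  shows "f ` closure S \<subseteq> closure T"
  using closure_bounded_linear_image_subset[OF f, of S] closure_mono[OF assms(2)] by simp

lemma bounded_linear_c0_scale: "bounded_linear (c0_scale c :: (nat \<Rightarrow>\<^sub>C 'k::rc_field) \<Rightarrow> _)"
proof (rule bounded_linear_intro[where K = "norm c"])
  show "c0_scale c (x + y) = c0_scale c x + c0_scale c y" for x y :: "nat \<Rightarrow>\<^sub>C 'k"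
    by (rule c0.scale_right_distrib)
  show "c0_scale c (r *\<^sub>R x) = r *\<^sub>R c0_scale c x" for r and x :: "nat \<Rightarrow>\<^sub>C 'k"
    by (rule bcontfun_eqI) simp
  show "norm (c0_scale c x) \<le> norm x * norm c" for x :: "nat \<Rightarrow>\<^sub>C 'k"
    using norm_c0_scale[of c x] by (simp add: mult.commute)
qed

lemma scaleR_eq_c0_scale: "r *\<^sub>R x = c0_scale (of_real r) (x :: nat \<Rightarrow>\<^sub>C 'k::rc_field)"
  by (rule bcontfun_eqI) (simp add: scaleR_conv_of_real)

lemma c0_subspace_real: "c0.subspace S \<Longrightarrow> subspace S"
  unfolding subspace_def c0.subspace_def scaleR_eq_c0_scale by blast

lemma subspace_c0: "c0.subspace (c0 :: (nat \<Rightarrow>\<^sub>C 'k::rc_field) set)"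
  unfolding c0.subspace_def
proof (intro conjI ballI allI)
  fix c :: 'k and x :: "nat \<Rightarrow>\<^sub>C 'k" assume "x \<in> c0"
  then have "(\<lambda>i. c * x i) \<longlonglongrightarrow> 0" by (simp add: c0_def tendsto_mult_right_zero)
  moreover have "apply_bcontfun (c0_scale c x) = (\<lambda>i. c * x i)" by (rule ext) simp
  ultimately show "c0_scale c x \<in> c0" by (simp only: c0_def mem_Collect_eq)
qed (auto simp: c0_def intro: tendsto_add_zero)

lemma closed_c0: "closed (c0 :: (nat \<Rightarrow>\<^sub>C 'k::rc_field) set)"
proof -
  have "x \<in> c0" if x: "x \<in> closure c0" for x :: "nat \<Rightarrow>\<^sub>C 'k"
    unfolding c0_def mem_Collect_eq
  proof (rule LIMSEQ_I)
    fix e :: real assume "0 < e"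
    then have e: "0 < e / 2" by simp
    with x obtain y where y: "y \<in> c0" "dist y x < e / 2"
      unfolding closure_approachable by blast
    from y(1) have "apply_bcontfun y \<longlonglongrightarrow> 0" by (simp add: c0_def)
    then obtain N where N: "\<And>n. n \<ge> N \<Longrightarrow> norm (y n) < e / 2"
      using LIMSEQ_D[OF _ e, of y 0] by auto
    have "norm (x n - 0) < e" if "n \<ge> N" for n
    proof -
      have "norm (x n) \<le> norm (y n) + dist (y n) (x n)"
        by (metis dist_norm norm_minus_commute norm_triangle_sub)
      also have "dist (y n) (x n) \<le> dist y x" by (rule dist_bounded)
      finally show ?thesis using N[OF that] y(2) by simp
    qed
    then show "\<exists>N. \<forall>n\<ge>N. norm (x n - 0) < e" by blast
  qed
  then have "closure (c0 :: (nat \<Rightarrow>\<^sub>C 'k) set) \<subseteq> c0" by blast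
  then show ?thesis by (simp add: closure_subset_eq)
qed

lemma finite_support_c0:
  fixes x :: "nat \<Rightarrow>\<^sub>C 'k::rc_field"
  assumes "finite {i. x i \<noteq> 0}"
  shows "x \<in> c0"
proof -
  obtain N where "\<And>i. x i \<noteq> 0 \<Longrightarrow> i < N"
    using assms finite_nat_set_iff_bounded by auto
  then have "eventually (\<lambda>i. x i = 0) sequentially"
    unfolding eventually_sequentially by (intro exI[of _ N]) force
  then show ?thesis by (simp add: c0_def tendsto_eventually)
qed

text \<open>
  Coordinates of sequences are numbered by triples: the summand, the level, and the position
  within the level.
\<close>

definition enc :: "nat \<Rightarrow> nat \<Rightarrow> nat \<Rightarrow> nat" where
  "enc m k c = prod_encode (m, prod_encode (k, c))"

definition slot :: "nat \<Rightarrow> nat" where "slot i = fst (prod_decode i)"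
definition lev :: "nat \<Rightarrow> nat" where "lev i = fst (prod_decode (snd (prod_decode i)))"
definition pos :: "nat \<Rightarrow> nat" where "pos i = snd (prod_decode (snd (prod_decode i)))"

lemma enc_simps [simp]: "slot (enc m k c) = m" "lev (enc m k c) = k" "pos (enc m k c) = c"
  by (simp_all add: enc_def slot_def lev_def pos_def)

lemma enc_slot_lev_pos [simp]: "enc (slot i) (lev i) (pos i) = i"
  by (simp add: enc_def slot_def lev_def pos_def)

text \<open>
  The diagonal operator \<open>D\<close> multiplies level \<open>k\<close> by \<open>\<rho> ^ k\<close>. The condition \<open>1 < 2 * \<rho> ^ (2 * n)\<close>
  says that the rows of \<open>Y\<close> remain summable after division by the \<open>n\<close>-th power of \<open>D\<close>, and
  \<open>2 * \<rho> ^ (2 * (n + 1)) < 1\<close> says that the entries of the \<open>(n + 1)\<close>-st power of \<open>D\<close> are square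
  summable over the coordinates.
\<close>

locale davie_space =
  fixes Y :: "nat \<Rightarrow> nat \<Rightarrow> nat \<Rightarrow> nat \<Rightarrow> real" and n :: nat and \<rho> :: real
  assumes Y_pos: "2 ^ (k' + 2) \<le> c' \<Longrightarrow> Y k c k' c' = 0"
    and Y_far: "k + 1 < k' \<Longrightarrow> Y k c k' c' = 0"
    and Y_bound: "c < 2 ^ (k + 2) \<Longrightarrow> \<bar>Y k c k' c'\<bar> \<le> 4 * (real k + 1) / (2 ^ k * sqrt (2 ^ k))"
    and Y_diag: "c < 2 ^ (k + 2) \<Longrightarrow> Y k c k c = (if k = 0 then 1 / 4 else 0)"
    and Y_square: "(\<Sum>k'\<le>k + 1. \<Sum>c'<2 ^ (k' + 2). Y k c k' c' * Y k' c' k'' c'') = 0"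
    and n: "1 \<le> n" and \<rho>: "0 < \<rho>" "\<rho> < 1"
    and \<rho>_low: "1 < 2 * \<rho> ^ (2 * n)" and \<rho>_high: "2 * \<rho> ^ (2 * (n + 1)) < 1"
begin

definition row_norm_bound :: "nat \<Rightarrow> real" where "row_norm_bound k = 4 * (real k + 1) / (2 ^ k * sqrt (2 ^ k))"

lemma row_norm_bound_nonneg: "0 \<le> row_norm_bound k"
  by (simp add: row_norm_bound_def)

text \<open>
  Row \<open>(k, c)\<close> of the matrix, after \<open>m\<close> applications of \<open>D\<close>, placed in summand \<open>m\<close>. Summand
  \<open>n + 1\<close> is a second copy of summand \<open>n\<close>, whence the minimum.
\<close>

definition E :: "nat \<Rightarrow> nat \<Rightarrow> nat \<Rightarrow> (nat \<Rightarrow>\<^sub>C 'k::rc_field)" where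
  "E m k c = Bcontfun (\<lambda>i. if slot i = m then of_real (\<rho> ^ (min m n * lev i) * Y k c (lev i) (pos i)) else 0)"

lemma E_term_bound:
  assumes "c < 2 ^ (k + 2)"
  shows "norm (if slot i = m then of_real (\<rho> ^ (min m n * lev i) * Y k c (lev i) (pos i)) else 0 :: 'k::rc_field) \<le> row_norm_bound k"
proof -
  have "\<bar>\<rho> ^ (min m n * lev i) * Y k c (lev i) (pos i)\<bar> \<le> 1 * row_norm_bound k"
    unfolding abs_mult row_norm_bound_def using \<rho>
    by (intro mult_mono Y_bound assms) (auto intro: power_le_one)
  then show ?thesis using row_norm_bound_nonneg[of k] by (simp del: of_real_mult of_real_power)
qed

lemma E_apply:
  assumes "c < 2 ^ (k + 2)"
  shows "apply_bcontfun (E m k c :: nat \<Rightarrow>\<^sub>C 'k::rc_field) i =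
    (if slot i = m then of_real (\<rho> ^ (min m n * lev i) * Y k c (lev i) (pos i)) else 0)"
  unfolding E_def by (subst apply_Bcontfun_nat[OF E_term_bound[OF assms]]) simp

lemma norm_E: "c < 2 ^ (k + 2) \<Longrightarrow> norm (E m k c :: nat \<Rightarrow>\<^sub>C 'k::rc_field) \<le> row_norm_bound k"
  by (rule norm_bound) (simp only: E_apply E_term_bound)

lemma E_c0:
  assumes c: "c < 2 ^ (k + 2)"
  shows "(E m k c :: nat \<Rightarrow>\<^sub>C 'k::rc_field) \<in> c0"
proof (rule finite_support_c0, rule finite_subset)
  show "{i. apply_bcontfun (E m k c :: nat \<Rightarrow>\<^sub>C 'k) i \<noteq> 0} \<subseteq>
    (\<lambda>(k', c'). enc m k' c') ` (SIGMA k':{..k + 1}. {..<2 ^ (k' + 2)})"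
  proof
    fix i assume "i \<in> {i. apply_bcontfun (E m k c :: nat \<Rightarrow>\<^sub>C 'k) i \<noteq> 0}"
    then have i: "slot i = m" "Y k c (lev i) (pos i) \<noteq> 0"
      by (auto simp: E_apply[OF c] split: if_splits)
    have "lev i \<le> k + 1" "pos i < 2 ^ (lev i + 2)"
      using i(2) Y_far[of k "lev i" c "pos i"] Y_pos[of "lev i" "pos i" k c] by (auto simp: not_less[symmetric])
    moreover have "i = enc m (lev i) (pos i)" using i(1) by auto
    ultimately show "i \<in> (\<lambda>(k', c'). enc m k' c') ` (SIGMA k':{..k + 1}. {..<2 ^ (k' + 2)})"
      by (intro image_eqI[of _ _ "(lev i, pos i)"]) auto
  qed
qed auto

definition generators :: "(nat \<Rightarrow>\<^sub>C 'k::rc_field) set" where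
  "generators = {E m k c | m k c. m \<le> n + 1 \<and> c < 2 ^ (k + 2)}"

definition W :: "(nat \<Rightarrow>\<^sub>C 'k::rc_field) set" where
  "W = closure (c0.span generators)"

lemma W_closed: "closed W"
  by (simp add: W_def)

lemma W_c0: "W \<subseteq> c0"
  unfolding W_def
  by (intro closure_minimal closed_c0 c0.span_minimal subspace_c0) (auto simp: generators_def E_c0)

lemma E_W: "m \<le> n + 1 \<Longrightarrow> c < 2 ^ (k + 2) \<Longrightarrow> E m k c \<in> W"
  unfolding W_def by (intro subsetD[OF closure_subset] c0.span_base) (auto simp: generators_def)

lemma subspace_W: "subspace (W :: (nat \<Rightarrow>\<^sub>C 'k::rc_field) set)"
  unfolding W_def by (intro subspace_closure_real c0_subspace_real c0.subspace_span)

lemma W_scale: "x \<in> W \<Longrightarrow> c0_scale c x \<in> (W :: (nat \<Rightarrow>\<^sub>C 'k::rc_field) set)"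
proof -
  have "c0_scale c ` c0.span generators \<subseteq> closure (c0.span generators :: (nat \<Rightarrow>\<^sub>C 'k) set)"
    using closure_subset c0.span_scale by blast
  then show "x \<in> W \<Longrightarrow> c0_scale c x \<in> W"
    unfolding W_def using bounded_linear_into_closed_subspace[OF bounded_linear_c0_scale] by blast
qed

lemma c0_subspace_W: "c0.subspace (W :: (nat \<Rightarrow>\<^sub>C 'k::rc_field) set)"
  using subspace_W W_scale by (auto simp: c0.subspace_def subspace_def)

sublocale W: op_space c0_scale "W :: (nat \<Rightarrow>\<^sub>C 'k::rc_field) set"
proof
  show "norm (c0_scale c x) \<le> norm c * norm x" for c and x :: "nat \<Rightarrow>\<^sub>C 'k" by (rule norm_c0_scale)
qed (use subspace_W W_scale in \<open>auto simp: subspace_def\<close>)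

lemma maps_W:
  fixes f :: "(nat \<Rightarrow>\<^sub>C 'k::rc_field) \<Rightarrow> (nat \<Rightarrow>\<^sub>C 'k)"
  assumes f: "bounded_linear f" and sc: "\<And>c x. f (c0_scale c x) = c0_scale c (f x)"
    and gen: "\<And>m k c. m \<le> n + 1 \<Longrightarrow> c < 2 ^ (k + 2) \<Longrightarrow> f (E m k c) \<in> W"
    and x: "x \<in> W"
  shows "f x \<in> W"
proof -
  have "f y \<in> W" if "y \<in> c0.span generators" for y
    using that
  proof (induction rule: c0.span_induct)
    case base
    show ?case using f subspace_W
      by (auto simp: c0.subspace_def sc linear_simps subspace_def intro: W_scale)
  next
    case (step x)
    then show ?case using gen by (auto simp: generators_def)
  qed
  then have "f ` c0.span generators \<subseteq> closure (c0.span generators)" by (auto simp: W_def)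
  then show ?thesis using bounded_linear_into_closed_subspace[OF f] x unfolding W_def by blast
qed

definition restrict_W :: "((nat \<Rightarrow>\<^sub>C 'k::rc_field) \<Rightarrow> (nat \<Rightarrow>\<^sub>C 'k)) \<Rightarrow> (nat \<Rightarrow>\<^sub>C 'k) \<Rightarrow> (nat \<Rightarrow>\<^sub>C 'k)" where
  "restrict_W f x = (if x \<in> W then f x else 0)"

lemma restrict_W_op:
  fixes f :: "(nat \<Rightarrow>\<^sub>C 'k::rc_field) \<Rightarrow> (nat \<Rightarrow>\<^sub>C 'k)"
  assumes f: "bounded_linear f" and sc: "\<And>c x. f (c0_scale c x) = c0_scale c (f x)"
    and gen: "\<And>m k c. m \<le> n + 1 \<Longrightarrow> c < 2 ^ (k + 2) \<Longrightarrow> f (E m k c) \<in> W"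
  shows "restrict_W f \<in> bounded_ops c0_scale W c0_scale W"
proof -
  from f obtain K where "\<And>x. norm (f x) \<le> norm x * K" using bounded_linear.bounded by blast
  then show ?thesis
    using maps_W[OF assms] f
    by (intro W.bounded_opI[where K = K])
      (auto simp: restrict_W_def W.add_X W_scale sc linear_simps mult.commute)
qed

text \<open>
  The operator \<open>D\<close> from each summand \<open>m - 1\<close> to summand \<open>m \<le> n\<close>, restricted to levels from \<open>t\<close> on.
\<close>

definition shift_value :: "nat \<Rightarrow> (nat \<Rightarrow>\<^sub>C 'k::rc_field) \<Rightarrow> nat \<Rightarrow> 'k" where
  "shift_value t x i = (if 1 \<le> slot i \<and> slot i \<le> n \<and> pos i < 2 ^ (lev i + 2) \<and> t \<le> lev i
     then of_real (\<rho> ^ lev i) * x (enc (slot i - 1) (lev i) (pos i)) else 0)"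

definition shift :: "nat \<Rightarrow> (nat \<Rightarrow>\<^sub>C 'k::rc_field) \<Rightarrow> (nat \<Rightarrow>\<^sub>C 'k)" where
  "shift t x = Bcontfun (shift_value t x)"

lemma shift_value_bound: "norm (shift_value t x i) \<le> \<rho> ^ t * norm x"
proof (cases "shift_value t x i = 0")
  case False
  then have *: "shift_value t x i = of_real (\<rho> ^ lev i) * x (enc (slot i - 1) (lev i) (pos i))" "t \<le> lev i"
    by (auto simp: shift_value_def split: if_splits)
  have "norm (shift_value t x i) = \<rho> ^ lev i * norm (x (enc (slot i - 1) (lev i) (pos i)))"
    using \<rho> by (simp add: *(1) norm_mult norm_power)
  also have "\<dots> \<le> \<rho> ^ t * norm x"
    using *(2) \<rho> by (intro mult_mono power_decreasing norm_bounded) auto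
  finally show ?thesis .
qed (use \<rho> in simp)

lemma shift_apply: "apply_bcontfun (shift t x) i = shift_value t x i"
  unfolding shift_def by (subst apply_Bcontfun_nat[OF shift_value_bound]) simp

lemma norm_shift: "norm (shift t x) \<le> \<rho> ^ t * norm x"
  by (rule norm_bound) (simp only: shift_apply shift_value_bound)

lemma bounded_linear_shift: "bounded_linear (shift t :: (nat \<Rightarrow>\<^sub>C 'k::rc_field) \<Rightarrow> _)"
proof (rule bounded_linear_intro[where K = "\<rho> ^ t"])
  show "shift t (x + y) = shift t x + shift t y" for x y :: "nat \<Rightarrow>\<^sub>C 'k"
    by (rule bcontfun_eqI) (simp add: shift_apply shift_value_def distrib_left)
  show "shift t (r *\<^sub>R x) = r *\<^sub>R shift t x" for r and x :: "nat \<Rightarrow>\<^sub>C 'k"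
    by (rule bcontfun_eqI) (simp add: shift_apply shift_value_def)
  show "norm (shift t x) \<le> norm x * \<rho> ^ t" for x :: "nat \<Rightarrow>\<^sub>C 'k"
    using norm_shift[of t x] by (simp add: mult.commute)
qed

lemma shift_scale: "shift t (c0_scale c x) = c0_scale c (shift t x)"
  by (rule bcontfun_eqI) (simp add: shift_apply shift_value_def)

lemma shift_E:
  assumes "c < 2 ^ (k + 2)"
  shows "shift 0 (E m k c) = (if m < n then E (m + 1) k c else (0 :: nat \<Rightarrow>\<^sub>C 'k::rc_field))"
proof (rule bcontfun_eqI)
  fix i
  show "apply_bcontfun (shift 0 (E m k c)) i =
    apply_bcontfun (if m < n then E (m + 1) k c else (0 :: nat \<Rightarrow>\<^sub>C 'k)) i"
  proof (cases "pos i < 2 ^ (lev i + 2)")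
    case True
    show ?thesis
    proof (cases "m < n \<and> slot i = m + 1")
      case True': True
      then have "min (m + 1) n = m + 1" "min m n = m" by auto
      with True True' assms show ?thesis
        by (simp add: shift_apply shift_value_def E_apply power_add)
    next
      case False
      with True assms show ?thesis by (auto simp: shift_apply shift_value_def E_apply)
    qed
  next
    case False
    with assms show ?thesis by (auto simp: shift_apply shift_value_def E_apply Y_pos)
  qed
qed

text \<open>
  The identification of summand \<open>n\<close> with its copy \<open>n + 1\<close>.
\<close>

definition move_value :: "(nat \<Rightarrow>\<^sub>C 'k::rc_field) \<Rightarrow> nat \<Rightarrow> 'k" where
  "move_value x i = (if slot i = n + 1 then x (enc n (lev i) (pos i)) else 0)"

definition move :: "(nat \<Rightarrow>\<^sub>C 'k::rc_field) \<Rightarrow> (nat \<Rightarrow>\<^sub>C 'k)" where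
  "move x = Bcontfun (move_value x)"

lemma move_value_bound: "norm (move_value x i) \<le> norm x"
  by (simp add: move_value_def norm_bounded)

lemma move_apply: "apply_bcontfun (move x) i = move_value x i"
  unfolding move_def by (subst apply_Bcontfun_nat[OF move_value_bound]) simp

lemma bounded_linear_move: "bounded_linear (move :: (nat \<Rightarrow>\<^sub>C 'k::rc_field) \<Rightarrow> _)"
proof (rule bounded_linear_intro[where K = 1])
  show "move (x + y) = move x + move y" for x y :: "nat \<Rightarrow>\<^sub>C 'k"
    by (rule bcontfun_eqI) (simp add: move_apply move_value_def)
  show "move (r *\<^sub>R x) = r *\<^sub>R move x" for r and x :: "nat \<Rightarrow>\<^sub>C 'k"
    by (rule bcontfun_eqI) (simp add: move_apply move_value_def)
  show "norm (move x) \<le> norm x * 1" for x :: "nat \<Rightarrow>\<^sub>C 'k"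
    unfolding mult_1_right by (rule norm_bound) (simp only: move_apply move_value_bound)
qed

lemma move_scale: "move (c0_scale c x) = c0_scale c (move x)"
  by (rule bcontfun_eqI) (simp add: move_apply move_value_def)

lemma move_E:
  assumes "c < 2 ^ (k + 2)"
  shows "move (E m k c) = (if m = n then E (n + 1) k c else (0 :: nat \<Rightarrow>\<^sub>C 'k::rc_field))"
  by (rule bcontfun_eqI) 
    (cases "m = n", simp_all add: move_apply move_value_def E_apply[OF assms])

definition S :: "(nat \<Rightarrow>\<^sub>C 'k::rc_field) \<Rightarrow> (nat \<Rightarrow>\<^sub>C 'k)" where "S = restrict_W (shift 0)"
definition R :: "(nat \<Rightarrow>\<^sub>C 'k::rc_field) \<Rightarrow> (nat \<Rightarrow>\<^sub>C 'k)" where "R = restrict_W move"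

lemma S_op: "S \<in> bounded_ops c0_scale W c0_scale (W :: (nat \<Rightarrow>\<^sub>C 'k::rc_field) set)"
  unfolding S_def
  by (intro restrict_W_op bounded_linear_shift shift_scale) (auto simp: shift_E E_W W.zero_X)

lemma R_op: "R \<in> bounded_ops c0_scale W c0_scale (W :: (nat \<Rightarrow>\<^sub>C 'k::rc_field) set)"
  unfolding R_def
  by (intro restrict_W_op bounded_linear_move move_scale) (auto simp: move_E E_W W.zero_X)

lemma S_apply: "x \<in> W \<Longrightarrow> apply_bcontfun (S x) i = shift_value 0 x i"
  by (simp add: S_def restrict_W_def shift_apply)

lemma S_pow_E:
  assumes "c < 2 ^ (k + 2)" "j \<le> n"
  shows "(S ^^ j) (E 0 k c) = (E j k c :: nat \<Rightarrow>\<^sub>C 'k::rc_field)"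
  using assms(2)
proof (induction j)
  case (Suc j)
  then show ?case using assms(1) by (simp add: S_def restrict_W_def E_W shift_E)
qed simp

lemma R_S_pow_E: "c < 2 ^ (k + 2) \<Longrightarrow> (R \<circ> S ^^ n) (E 0 k c) = (E (n + 1) k c :: nat \<Rightarrow>\<^sub>C 'k::rc_field)"
  by (simp add: S_pow_E R_def restrict_W_def E_W move_E)

end

section \<open>The trace functional\<close>

lemma apply_bcontfun_sum:
  fixes f :: "'i \<Rightarrow> (nat \<Rightarrow>\<^sub>C 'k::rc_field)"
  shows "apply_bcontfun (\<Sum>i\<in>I. f i) x = (\<Sum>i\<in>I. f i x)"
  by (induction I rule: infinite_finite_induct) auto

context davie_space
begin

text \<open>
  The product of the norm of a row of level \<open>k\<close>, the number of rows of that level and the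
  \<open>n\<close>-th power of \<open>1 / \<rho> ^ k\<close> is of order \<open>k * \<tau> ^ k\<close>.
\<close>

definition \<tau> :: real where "\<tau> = 1 / (\<rho> ^ n * sqrt 2)"

lemma \<tau>: "0 < \<tau>" "\<tau> < 1"
proof -
  have "1 < (\<rho> ^ n * sqrt 2)\<^sup>2"
    using \<rho>_low by (simp add: power_mult_distrib power_mult[symmetric] mult.commute)
  moreover have "0 < \<rho> ^ n * sqrt 2" using \<rho> by simp
  ultimately have "1 < \<rho> ^ n * sqrt 2"
    using power_less_imp_less_base[of 1 2 "\<rho> ^ n * sqrt 2"] by simp
  then show "0 < \<tau>" "\<tau> < 1" using \<rho> by (simp_all add: \<tau>_def)
qed

text \<open>
  A bound for the norm of the trace functional.
\<close>

definition C\<^sub>\<beta> :: real where "C\<^sub>\<beta> = 16 / (1 - \<tau>)\<^sup>2"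

definition weighted_sum :: "nat \<Rightarrow> (nat \<Rightarrow> nat \<Rightarrow> 'k) \<Rightarrow> 'k::rc_field" where
  "weighted_sum m \<phi> = (\<Sum>k. of_real ((1 / \<rho> ^ min m n) ^ k) * (\<Sum>c<2 ^ (k + 2). \<phi> k c))"

definition row_bounded :: "real \<Rightarrow> (nat \<Rightarrow> nat \<Rightarrow> 'k::rc_field) \<Rightarrow> bool" where
  "row_bounded e \<phi> \<longleftrightarrow> 0 \<le> e \<and> (\<forall>k c. c < 2 ^ (k + 2) \<longrightarrow> norm (\<phi> k c) \<le> e * row_norm_bound k)"

lemma weighted_sum_term_bound:
  assumes "row_bounded e \<phi>"
  shows "norm (of_real ((1 / \<rho> ^ min m n) ^ k) * (\<Sum>c<2 ^ (k + 2). \<phi> k c)) \<le> e * 16 * (real (Suc k) * \<tau> ^ k)"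
proof -
  have "\<rho> ^ n \<le> \<rho> ^ min m n" using \<rho> by (intro power_decreasing) auto
  then have w: "(1 / \<rho> ^ min m n) ^ k \<le> (1 / \<rho> ^ n) ^ k"
    using \<rho> by (intro power_mono) (auto simp: frac_le)
  have "norm (\<Sum>c<2 ^ (k + 2). \<phi> k c) \<le> (\<Sum>c<(2::nat) ^ (k + 2). e * row_norm_bound k)"
    using assms by (intro sum_norm_le) (auto simp: row_bounded_def)
  also have "\<dots> = e * 16 * (real (Suc k) / sqrt (2 ^ k))"
    by (simp add: row_norm_bound_def power_add)
  finally have "norm (of_real ((1 / \<rho> ^ min m n) ^ k) * (\<Sum>c<2 ^ (k + 2). \<phi> k c))
      \<le> (1 / \<rho> ^ n) ^ k * (e * 16 * (real (Suc k) / sqrt (2 ^ k)))"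
    unfolding norm_mult norm_of_real using w \<rho> by (intro mult_mono) auto
  also have "\<dots> = e * 16 * (real (Suc k) * \<tau> ^ k)"
    by (simp add: \<tau>_def power_divide power_mult_distrib real_sqrt_power)
  finally show ?thesis .
qed

lemma majorant_sums: "(\<lambda>k. e * 16 * (real (Suc k) * \<tau> ^ k)) sums (e * C\<^sub>\<beta>)"
  using sums_mult[OF geometric_deriv_sums[of \<tau>], of "e * 16"] \<tau> by (simp add: C\<^sub>\<beta>_def)

lemma weighted_sum_summable:
  assumes "row_bounded e \<phi>"
  shows "summable (\<lambda>k. of_real ((1 / \<rho> ^ min m n) ^ k) * (\<Sum>c<2 ^ (k + 2). \<phi> k c))"
  by (rule summable_comparison_test'[OF sums_summable[OF majorant_sums[of e]]])
    (rule weighted_sum_term_bound[OF assms])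

lemma norm_weighted_sum: assumes "row_bounded e \<phi>" shows "norm (weighted_sum m \<phi>) \<le> C\<^sub>\<beta> * e"
proof -
  have "norm (weighted_sum m \<phi>) \<le> (\<Sum>k. e * 16 * (real (Suc k) * \<tau> ^ k))"
    unfolding weighted_sum_def by (intro norm_suminf_le weighted_sum_term_bound assms sums_summable[OF majorant_sums])
  then show ?thesis using sums_unique[OF majorant_sums[of e]] by (simp add: mult.commute)
qed

lemma weighted_sum_add:
  assumes "row_bounded e \<phi>" "row_bounded d \<psi>"
  shows "weighted_sum m (\<lambda>k c. \<phi> k c + \<psi> k c) = weighted_sum m \<phi> + weighted_sum m \<psi>"
proof -
  have "weighted_sum m (\<lambda>k c. \<phi> k c + \<psi> k c) = (\<Sum>k. of_real ((1 / \<rho> ^ min m n) ^ k) * (\<Sum>c<2 ^ (k + 2). \<phi> k c)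
      + of_real ((1 / \<rho> ^ min m n) ^ k) * (\<Sum>c<2 ^ (k + 2). \<psi> k c))"
    unfolding weighted_sum_def by (intro suminf_cong) (simp only: sum.distrib distrib_left)
  also have "\<dots> = weighted_sum m \<phi> + weighted_sum m \<psi>"
    unfolding weighted_sum_def by (rule suminf_add[OF weighted_sum_summable[OF assms(1)] weighted_sum_summable[OF assms(2)], symmetric])
  finally show ?thesis .
qed

lemma weighted_sum_scale:
  fixes \<phi> :: "nat \<Rightarrow> nat \<Rightarrow> 'k::rc_field"
  assumes "row_bounded e \<phi>"
  shows "weighted_sum m (\<lambda>k c. a * \<phi> k c) = a * weighted_sum m \<phi>"
proof -
  let ?w = "\<lambda>k. of_real ((1 / \<rho> ^ min m n) ^ k) :: 'k"
  have 1: "?w k * (\<Sum>c<2 ^ (k + 2). a * \<phi> k c) = a * (?w k * (\<Sum>c<2 ^ (k + 2). \<phi> k c))" for k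
  proof -
    have 2: "(\<Sum>c<2 ^ (k + 2). a * \<phi> k c) = a * (\<Sum>c<2 ^ (k + 2). \<phi> k c)"
      by (rule sum_distrib_left[symmetric])
    show ?thesis
      unfolding 2 by (rule mult.left_commute)
  qed
  have "weighted_sum m (\<lambda>k c. a * \<phi> k c) = (\<Sum>k. a * (?w k * (\<Sum>c<2 ^ (k + 2). \<phi> k c)))"
    unfolding weighted_sum_def 1 by (rule refl)
  also have "\<dots> = a * weighted_sum m \<phi>"
    unfolding weighted_sum_def by (rule suminf_mult[OF weighted_sum_summable[OF assms]])
  finally show ?thesis .
qed

text \<open>
  The trace of the component of \<open>T\<close> from summand \<open>0\<close> to summand \<open>m\<close>, after the powers of \<open>D\<close>
  that distinguish these summands have been divided out.
\<close>

definition \<beta> :: "nat \<Rightarrow> ((nat \<Rightarrow>\<^sub>C 'k) \<Rightarrow> (nat \<Rightarrow>\<^sub>C 'k)) \<Rightarrow> 'k::rc_field" where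
  "\<beta> m T = weighted_sum m (\<lambda>k c. T (E 0 k c) (enc m k c))"

lemma row_bounded_op:
  fixes T :: "(nat \<Rightarrow>\<^sub>C 'k::rc_field) \<Rightarrow> (nat \<Rightarrow>\<^sub>C 'k)"
  assumes "0 \<le> e" "\<And>x. x \<in> W \<Longrightarrow> norm (T x) \<le> e * norm x"
  shows "row_bounded e (\<lambda>k c. T (E 0 k c) (enc m k c))"
  unfolding row_bounded_def
proof (intro conjI allI impI assms(1))
  fix k c :: nat assume c: "c < 2 ^ (k + 2)"
  have "norm (T (E 0 k c) (enc m k c)) \<le> norm (T (E 0 k c))" by (rule norm_bounded)
  also have "\<dots> \<le> e * norm (E 0 k c :: nat \<Rightarrow>\<^sub>C 'k)" using c by (intro assms E_W) auto
  also have "\<dots> \<le> e * row_norm_bound k" by (intro mult_left_mono norm_E c assms)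
  finally show "norm (T (E 0 k c) (enc m k c)) \<le> e * row_norm_bound k" .
qed

lemma norm_\<beta>:
  fixes T :: "(nat \<Rightarrow>\<^sub>C 'k::rc_field) \<Rightarrow> (nat \<Rightarrow>\<^sub>C 'k)"
  assumes "0 \<le> e" "\<And>x. x \<in> W \<Longrightarrow> norm (T x) \<le> e * norm x"
  shows "norm (\<beta> m T) \<le> C\<^sub>\<beta> * e"
  unfolding \<beta>_def by (rule norm_weighted_sum[OF row_bounded_op[OF assms]])

lemma \<beta>_add:
  fixes T U :: "(nat \<Rightarrow>\<^sub>C 'k::rc_field) \<Rightarrow> (nat \<Rightarrow>\<^sub>C 'k)"
  assumes "\<And>x. x \<in> W \<Longrightarrow> norm (T x) \<le> e * norm x" "\<And>x. x \<in> W \<Longrightarrow> norm (U x) \<le> d * norm x" "0 \<le> e" "0 \<le> d"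
  shows "\<beta> m (\<lambda>x. T x + U x) = \<beta> m T + \<beta> m U"
  unfolding \<beta>_def plus_bcontfun.rep_eq by (rule weighted_sum_add[OF row_bounded_op[OF assms(3,1)] row_bounded_op[OF assms(4,2)]])

lemma \<beta>_scale:
  fixes T :: "(nat \<Rightarrow>\<^sub>C 'k::rc_field) \<Rightarrow> (nat \<Rightarrow>\<^sub>C 'k)"
  assumes "\<And>x. x \<in> W \<Longrightarrow> norm (T x) \<le> e * norm x" "0 \<le> e"
  shows "\<beta> m (\<lambda>x. c0_scale a (T x)) = a * \<beta> m T"
  unfolding \<beta>_def apply_c0_scale by (rule weighted_sum_scale[OF row_bounded_op[OF assms(2,1)]])

lemma \<beta>_cong: "(\<And>x. x \<in> W \<Longrightarrow> T x = U x) \<Longrightarrow> \<beta> m T = \<beta> m U"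
  unfolding \<beta>_def weighted_sum_def
  by (intro suminf_cong arg_cong2[where f = "(*)"] sum.cong refl) (simp add: E_W)

lemma \<beta>_L_add:
  assumes "T \<in> W.L" "U \<in> W.L"
  shows "\<beta> m (\<lambda>x. T x + U x) = \<beta> m T + \<beta> m U"
proof -
  obtain e where "0 < e" "\<And>x. norm (T x) \<le> e * norm x" using W.op_bound[OF assms(1)] by blast
  moreover obtain d where "0 < d" "\<And>x. norm (U x) \<le> d * norm x" using W.op_bound[OF assms(2)] by blast
  ultimately show ?thesis by (intro \<beta>_add[of T e U d]) auto
qed

lemma \<beta>_L_scale:
  assumes "T \<in> W.L"
  shows "\<beta> m (\<lambda>x. c0_scale a (T x)) = a * \<beta> m T"
proof -
  obtain e where "0 < e" "\<And>x. norm (T x) \<le> e * norm x" using W.op_bound[OF assms] by blast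
  then show ?thesis by (intro \<beta>_scale[of T e]) auto
qed

lemma weight_cancel: "(1 / \<rho> ^ min m n) ^ k * \<rho> ^ (min m n * k) = 1"
  using \<rho> by (simp add: power_divide power_mult)

lemma weighted_sum_diagonal: "weighted_sum m (\<lambda>k c. (E m k c :: nat \<Rightarrow>\<^sub>C 'k::rc_field) (enc m k c)) = 1"
proof -
  have t: "of_real ((1 / \<rho> ^ min m n) ^ k) * (\<Sum>c<2 ^ (k + 2). (E m k c :: nat \<Rightarrow>\<^sub>C 'k) (enc m k c))
      = (if k = 0 then 1 else 0)" for k
  proof -
    have "of_real ((1 / \<rho> ^ min m n) ^ k) * (\<Sum>c<2 ^ (k + 2). (E m k c :: nat \<Rightarrow>\<^sub>C 'k) (enc m k c)) =
      of_real ((1 / \<rho> ^ min m n) ^ k) * (\<Sum>c<(2::nat) ^ (k + 2). of_real (\<rho> ^ (min m n * k) * (if k = 0 then 1 / 4 else 0)))"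
      by (intro arg_cong2[where f = "(*)"] sum.cong refl) (simp add: E_apply Y_diag)
    also have "\<dots> = of_real ((1 / \<rho> ^ min m n) ^ k * \<rho> ^ (min m n * k) * (2 ^ (k + 2) * (if k = 0 then 1 / 4 else 0)))"
      by simp
    also have "\<dots> = (if k = 0 then 1 else 0)" unfolding weight_cancel by simp
    finally show ?thesis .
  qed
  show ?thesis unfolding weighted_sum_def t by (subst suminf_finite[of "{0}"]) auto
qed

text \<open>
  The left hand side is a bounded linear functional of \<open>z\<close>, so it suffices to consider
  \<open>z = E m k0 c0\<close>. There the weights cancel, and the sum is \<open>f\<close> applied to row \<open>(k0, c0)\<close> of the
  square of \<open>Y\<close>. Real linearity of \<open>f\<close> is enough, because \<open>Y\<close> has real entries; this allows the
  real-linear projections that come from Hilbertian seminorms.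
\<close>

lemma row_pairing_vanishes:
  fixes f :: "(nat \<Rightarrow>\<^sub>C 'k::rc_field) \<Rightarrow> 'k"
  assumes add: "\<And>x y. x \<in> W \<Longrightarrow> y \<in> W \<Longrightarrow> f (x + y) = f x + f y"
    and scale: "\<And>r x. x \<in> W \<Longrightarrow> f (r *\<^sub>R x) = of_real r * f x"
    and bound: "\<And>x. x \<in> W \<Longrightarrow> norm (f x) \<le> K * norm x" "0 \<le> K"
    and z: "z \<in> W"
  shows "weighted_sum m (\<lambda>k c. f (E 0 k c) * z (enc m k c)) = 0"
proof -
  define \<Psi> where "\<Psi> z = weighted_sum m (\<lambda>k c. f (E 0 k c) * z (enc m k c))" for z :: "nat \<Rightarrow>\<^sub>C 'k"
  have d: "row_bounded (K * norm z) (\<lambda>k c. f (E 0 k c) * z (enc m k c))" for z :: "nat \<Rightarrow>\<^sub>C 'k"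
    unfolding row_bounded_def
  proof (intro conjI allI impI)
    show "0 \<le> K * norm z" using bound(2) by simp
    fix k c :: nat assume c: "c < 2 ^ (k + 2)"
    have "norm (f (E 0 k c)) \<le> K * norm (E 0 k c :: nat \<Rightarrow>\<^sub>C 'k)" using c by (intro bound E_W) auto
    also have "\<dots> \<le> K * row_norm_bound k" by (intro mult_left_mono norm_E c bound)
    finally have "norm (f (E 0 k c)) * norm (z (enc m k c)) \<le> (K * row_norm_bound k) * norm z"
      using bound(2) row_norm_bound_nonneg[of k] by (intro mult_mono norm_bounded) auto
    then show "norm (f (E 0 k c) * z (enc m k c)) \<le> K * norm z * row_norm_bound k"
      by (simp add: norm_mult mult_ac)
  qed
  have \<Psi>_add: "\<Psi> (x + y) = \<Psi> x + \<Psi> y" for x y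
    using weighted_sum_add[OF d[of x] d[of y], of m] by (simp add: \<Psi>_def distrib_left)
  have \<Psi>_scale: "\<Psi> (c0_scale a x) = a * \<Psi> x" for a x
    using weighted_sum_scale[OF d[of x], of m a] by (simp add: \<Psi>_def mult_ac)
  have lin: "bounded_linear \<Psi>"
  proof (rule bounded_linear_intro[where K = "C\<^sub>\<beta> * K"])
    show "\<Psi> (r *\<^sub>R x) = r *\<^sub>R \<Psi> x" for r x
      unfolding scaleR_eq_c0_scale \<Psi>_scale by (simp add: scaleR_conv_of_real)
    show "norm (\<Psi> x) \<le> norm x * (C\<^sub>\<beta> * K)" for x
      using norm_weighted_sum[OF d[of x], of m] by (simp add: \<Psi>_def mult_ac)
  qed (rule \<Psi>_add)
  have f0: "f 0 = 0" using scale[of 0 0] W.zero_X by simp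
  have f_sum: "f (\<Sum>i\<in>I. g i) = (\<Sum>i\<in>I. f (g i))" if "\<And>i. i \<in> I \<Longrightarrow> g i \<in> W" for I :: "nat set" and g
    using that
  proof (induction I rule: infinite_finite_induct)
    case (insert i I)
    then have "(\<Sum>i\<in>I. g i) \<in> W" by (intro subspace_sum[OF subspace_W]) auto
    with insert show ?case by (simp add: add)
  qed (simp_all add: f0)
  have gen: "\<Psi> (E m' k0 c0) = 0" if c0: "c0 < 2 ^ (k0 + 2)" for m' k0 c0
  proof (cases "m' = m")
    case False
    then show ?thesis by (simp add: \<Psi>_def weighted_sum_def E_apply[OF c0])
  next
    case True
    have "\<Psi> (E m' k0 c0) = (\<Sum>k. \<Sum>c<2 ^ (k + 2). of_real (Y k0 c0 k c) * f (E 0 k c))"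
      unfolding \<Psi>_def weighted_sum_def
    proof (intro suminf_cong)
      fix k
      have "of_real ((1 / \<rho> ^ min m n) ^ k) * (\<Sum>c<2 ^ (k + 2). f (E 0 k c) * (E m' k0 c0) (enc m k c)) =
        (\<Sum>c<2 ^ (k + 2). of_real ((1 / \<rho> ^ min m n) ^ k * \<rho> ^ (min m n * k)) * (of_real (Y k0 c0 k c) * f (E 0 k c)))"
        unfolding sum_distrib_left using True
        by (intro sum.cong refl) (simp add: E_apply[OF c0] mult_ac)
      then show "of_real ((1 / \<rho> ^ min m n) ^ k) * (\<Sum>c<2 ^ (k + 2). f (E 0 k c) * (E m' k0 c0) (enc m k c)) =
        (\<Sum>c<2 ^ (k + 2). of_real (Y k0 c0 k c) * f (E 0 k c))"
        unfolding weight_cancel by simp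
    qed
    also have "\<dots> = (\<Sum>k\<le>k0 + 1. \<Sum>c<2 ^ (k + 2). of_real (Y k0 c0 k c) * f (E 0 k c))"
      by (rule suminf_finite) (auto simp: Y_far not_le intro!: sum.neutral)
    also have "\<dots> = (\<Sum>k\<le>k0 + 1. f (\<Sum>c<2 ^ (k + 2). Y k0 c0 k c *\<^sub>R E 0 k c))"
      by (intro sum.cong refl, subst f_sum)
        (auto simp: scale E_W intro!: subspace_scale[OF subspace_W])
    also have "\<dots> = f (\<Sum>k\<le>k0 + 1. \<Sum>c<2 ^ (k + 2). Y k0 c0 k c *\<^sub>R E 0 k c)"
      by (rule f_sum[symmetric]) (auto intro!: subspace_sum[OF subspace_W] subspace_scale[OF subspace_W] E_W)
    also have "(\<Sum>k\<le>k0 + 1. \<Sum>c<2 ^ (k + 2). Y k0 c0 k c *\<^sub>R E 0 k c) = (0 :: nat \<Rightarrow>\<^sub>C 'k)"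
    proof (rule bcontfun_eqI)
      fix i
      have "apply_bcontfun (\<Sum>k\<le>k0 + 1. \<Sum>c<2 ^ (k + 2). Y k0 c0 k c *\<^sub>R (E 0 k c :: nat \<Rightarrow>\<^sub>C 'k)) i =
        (\<Sum>k\<le>k0 + 1. \<Sum>c<2 ^ (k + 2). if slot i = 0 then of_real (Y k0 c0 k c * Y k c (lev i) (pos i)) else 0)"
        unfolding apply_bcontfun_sum
        by (intro sum.cong refl) (simp add: E_apply scaleR_conv_of_real)
      also have "\<dots> = (if slot i = 0 then of_real (\<Sum>k\<le>k0 + 1. \<Sum>c<2 ^ (k + 2). Y k0 c0 k c * Y k c (lev i) (pos i)) else 0)"
        by simp
      finally show "apply_bcontfun (\<Sum>k\<le>k0 + 1. \<Sum>c<2 ^ (k + 2). Y k0 c0 k c *\<^sub>R (E 0 k c :: nat \<Rightarrow>\<^sub>C 'k)) i = apply_bcontfun 0 i"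
        unfolding Y_square by simp
    qed
    finally show ?thesis by (simp add: f0)
  qed
  have "\<Psi> y = 0" if "y \<in> c0.span generators" for y
    using that
  proof (induction rule: c0.span_induct)
    case base
    show ?case using \<Psi>_add \<Psi>_scale \<Psi>_scale[of 0 0] by (auto simp: c0.subspace_def)
  next
    case (step x)
    then show ?case using gen by (auto simp: generators_def)
  qed
  moreover have "closed {y. \<Psi> y = 0}"
    using bounded_linear.continuous_on[OF lin continuous_on_id]
    by (intro closed_Collect_eq) auto
  ultimately have "W \<subseteq> {y. \<Psi> y = 0}" unfolding W_def by (intro closure_minimal) auto
  with z show ?thesis by (auto simp: \<Psi>_def)
qed

lemma \<beta>_rank_one:
  fixes f :: "(nat \<Rightarrow>\<^sub>C 'k::rc_field) \<Rightarrow> 'k"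
  assumes "\<And>x y. x \<in> W \<Longrightarrow> y \<in> W \<Longrightarrow> f (x + y) = f x + f y"
    and "\<And>r x. x \<in> W \<Longrightarrow> f (r *\<^sub>R x) = of_real r * f x"
    and "\<And>x. x \<in> W \<Longrightarrow> norm (f x) \<le> K * norm x" "0 \<le> K" and "z \<in> W"
  shows "\<beta> m (\<lambda>x. c0_scale (f x) z) = 0"
  unfolding \<beta>_def apply_c0_scale by (rule row_pairing_vanishes[OF assms])

end

section \<open>Words with many factors are approximable\<close>

lemma abs_le_sqrt_sum_squares:
  assumes "finite F" "g \<in> F"
  shows "\<bar>g x\<bar> \<le> sqrt (\<Sum>h\<in>F. (h x :: real)\<^sup>2)"
proof (rule real_le_rsqrt)
  show "\<bar>g x\<bar>\<^sup>2 \<le> (\<Sum>h\<in>F. (h x)\<^sup>2)"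
    using member_le_sum[OF assms(2), of "\<lambda>h. (h x)\<^sup>2"] assms(1) by simp
qed

context davie_space
begin

lemma \<beta>_R_S_pow: "\<beta> (n + 1) (R \<circ> S ^^ n) = (1 :: 'k::rc_field)"
proof -
  have "\<beta> (n + 1) (R \<circ> S ^^ n) = weighted_sum (n + 1) (\<lambda>k c. (E (n + 1) k c :: nat \<Rightarrow>\<^sub>C 'k) (enc (n + 1) k c))"
    unfolding \<beta>_def weighted_sum_def
    by (intro suminf_cong arg_cong2[where f = "(*)"] sum.cong refl) (simp only: lessThan_iff R_S_pow_E)
  then show ?thesis by (simp only: weighted_sum_diagonal)
qed

lemma \<beta>_S_pow: "\<beta> (n + 1) (S ^^ Suc j) = (0 :: 'k::rc_field)"
proof -
  have "apply_bcontfun (S y) (enc (n + 1) k c) = 0" for y :: "nat \<Rightarrow>\<^sub>C 'k" and k c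
    by (simp add: S_def restrict_W_def shift_apply shift_value_def)
  then show ?thesis by (simp add: \<beta>_def weighted_sum_def)
qed

definition level_set :: "nat \<Rightarrow> nat set" where
  "level_set t = {i. 1 \<le> slot i \<and> slot i \<le> n \<and> pos i < 2 ^ (lev i + 2) \<and> lev i = t}"

lemma level_set: "finite (level_set t)" "real (card (level_set t)) \<le> 4 * real n * 2 ^ t"
proof -
  have sub: "level_set t \<subseteq> (\<lambda>(m, c). enc m t c) ` ({1..n} \<times> {..<2 ^ (t + 2)})"
  proof
    fix i assume i: "i \<in> level_set t"
    then have "i = enc (slot i) t (pos i)" by (auto simp: level_set_def)
    with i show "i \<in> (\<lambda>(m, c). enc m t c) ` ({1..n} \<times> {..<2 ^ (t + 2)})"
      by (intro image_eqI[of _ _ "(slot i, pos i)"]) (auto simp: level_set_def)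
  qed
  then show "finite (level_set t)" by (rule finite_subset) auto
  have "card (level_set t) \<le> card ((\<lambda>(m, c). enc m t c) ` ({1..n} \<times> {..<(2::nat) ^ (t + 2)}))"
    by (rule card_mono[OF _ sub]) auto
  also have "\<dots> \<le> card ({1..n} \<times> {..<(2::nat) ^ (t + 2)})" by (rule card_image_le) auto
  also have "\<dots> = 4 * n * 2 ^ t" by (simp add: card_cartesian_product)
  finally have "real (card (level_set t)) \<le> real (4 * n * 2 ^ t)" by (rule of_nat_mono)
  then show "real (card (level_set t)) \<le> 4 * real n * 2 ^ t" by simp
qed

lemma shift_Suc_diff:
  "apply_bcontfun (shift t x - shift (Suc t) x) i = (if i \<in> level_set t then shift t x i else 0)"
  by (auto simp: shift_apply shift_value_def level_set_def)

text \<open>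
  \<open>T t\<close> is a word with \<open>k\<close> factors in which every shift is restricted to levels from \<open>t\<close> on, and
  in which the other factors have been extended to all bounded sequences. The difference of
  \<open>T t\<close> and \<open>T (Suc t)\<close> is a sum of \<open>k\<close> terms that factor through the coordinates of level \<open>t\<close>.
  So it is controlled by the square sum of about \<open>2 ^ t\<close> functionals, and each of the \<open>k\<close> shifts
  contributes the factor \<open>\<rho> ^ t\<close>.
\<close>

definition dominated :: "nat \<Rightarrow> ((nat \<Rightarrow>\<^sub>C 'k::rc_field) \<Rightarrow> (nat \<Rightarrow>\<^sub>C 'k)) \<Rightarrow> bool" where
  "dominated k w \<longleftrightarrow> (\<exists>T C F. 0 < C \<and> (\<forall>t. bounded_linear (T t)) \<and> (\<forall>x\<in>W. T 0 x = w x) \<and>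
     (\<forall>t x. norm (T t x) \<le> C * (\<rho> ^ k) ^ t * norm x) \<and>
     (\<forall>t. finite (F t) \<and> real (card (F t)) \<le> C * 2 ^ t \<and> (\<forall>g\<in>F t. linear g \<and> (\<forall>x. \<bar>g x\<bar> \<le> norm x))) \<and>
     (\<forall>t x. norm (T t x - T (Suc t) x) \<le> C * (\<rho> ^ k) ^ t * sqrt (\<Sum>g\<in>F t. (g x)\<^sup>2)))"

lemma dominatedE:
  assumes "dominated k w"
  obtains T C F where "0 < C" "\<And>t. bounded_linear (T t)" "\<And>x. x \<in> W \<Longrightarrow> T 0 x = w x"
    "\<And>t x. norm (T t x) \<le> C * (\<rho> ^ k) ^ t * norm x"
    "\<And>t. finite (F t)" "\<And>t. real (card (F t)) \<le> C * 2 ^ t"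
    "\<And>t g. g \<in> F t \<Longrightarrow> linear g" "\<And>t g x. g \<in> F t \<Longrightarrow> \<bar>g x\<bar> \<le> norm x"
    "\<And>t x. norm (T t x - T (Suc t) x) \<le> C * (\<rho> ^ k) ^ t * sqrt (\<Sum>g\<in>F t. (g x)\<^sup>2)"
proof -
  from assms obtain T C F where *: "0 < C \<and> (\<forall>t. bounded_linear (T t)) \<and> (\<forall>x\<in>W. T 0 x = w x) \<and>
     (\<forall>t x. norm (T t x) \<le> C * (\<rho> ^ k) ^ t * norm x) \<and>
     (\<forall>t. finite (F t) \<and> real (card (F t)) \<le> C * 2 ^ t \<and> (\<forall>g\<in>F t. linear g \<and> (\<forall>x. \<bar>g x\<bar> \<le> norm x))) \<and>
     (\<forall>t x. norm (T t x - T (Suc t) x) \<le> C * (\<rho> ^ k) ^ t * sqrt (\<Sum>g\<in>F t. (g x)\<^sup>2))"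
    unfolding dominated_def by (elim exE)
  show ?thesis by (rule that[of C T F]) (use * in simp_all)
qed

lemma bounded_extension:
  fixes b :: "(nat \<Rightarrow>\<^sub>C 'k::rc_field) \<Rightarrow> (nat \<Rightarrow>\<^sub>C 'k)"
  assumes b: "b \<in> W.L"
  obtains U K where "bounded_linear U" "\<And>x. x \<in> W \<Longrightarrow> U x = b x" "0 < K" "\<And>x. norm (U x) \<le> K * norm x"
proof -
  obtain K where K: "0 < K" "\<And>x. norm (b x) \<le> K * norm x" using W.op_bound[OF b] by blast
  have sc: "b (r *\<^sub>R x) = r *\<^sub>R b x" if "x \<in> W" for r x
    unfolding scaleR_eq_c0_scale by (rule W.op_scale[OF b that])
  obtain U where U: "bounded_linear U" "\<And>x. x \<in> W \<Longrightarrow> U x = b x"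
    using extend_bounded_operator[OF subspace_W less_imp_le[OF K(1)] W.op_add[OF b] sc K(2)] by blast
  obtain M where "0 < M" "\<And>x. norm (U x) \<le> norm x * M" using bounded_linear.pos_bounded[OF U(1)] by blast
  with U show ?thesis by (intro that[of U M]) (auto simp: mult.commute)
qed

lemma dominated_op:
  assumes b: "b \<in> W.L"
  shows "dominated 0 b"
proof -
  obtain U K where U: "bounded_linear U" "\<And>x. x \<in> W \<Longrightarrow> U x = b x" "0 < K" "\<And>x. norm (U x) \<le> K * norm x"
    using bounded_extension[OF b] by blast
  then show ?thesis
    unfolding dominated_def by (intro exI[of _ "\<lambda>_. U"] exI[of _ K] exI[of _ "\<lambda>_. {}"]) auto
qed

text \<open>
  With \<open>T' t = A \<circ> shift t \<circ> T t\<close> the difference \<open>T' t - T' (Suc t)\<close> splits into two parts. The first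
  one is \<open>A \<circ> (shift t - shift (Suc t)) \<circ> T t\<close>, which sees only the coordinates of level \<open>t\<close> and
  contributes the normalised real and imaginary parts of these coordinates as new functionals. The
  second one is \<open>A \<circ> shift (Suc t) \<circ> (T t - T (Suc t))\<close>, which is controlled by the old ones.
\<close>

lemma dominated_step:
  fixes a w :: "(nat \<Rightarrow>\<^sub>C 'k::rc_field) \<Rightarrow> (nat \<Rightarrow>\<^sub>C 'k)"
  assumes a: "a \<in> W.L" and w: "w \<in> W.L" and dw: "dominated k w"
  shows "dominated (Suc k) (a \<circ> S \<circ> w)"
proof -
  obtain A K where A: "bounded_linear A" "\<And>x. x \<in> W \<Longrightarrow> A x = a x" and K: "0 < K" "\<And>x. norm (A x) \<le> K * norm x"
    using bounded_extension[OF a] by blast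
  obtain T C F where C: "0 < C" and T: "\<And>t. bounded_linear (T t)" "\<And>x. x \<in> W \<Longrightarrow> T 0 x = w x"
    and T_norm: "\<And>t x. norm (T t x) \<le> C * (\<rho> ^ k) ^ t * norm x"
    and F: "\<And>t. finite (F t)" "\<And>t. real (card (F t)) \<le> C * 2 ^ t"
      "\<And>t g. g \<in> F t \<Longrightarrow> linear g" "\<And>t g x. g \<in> F t \<Longrightarrow> \<bar>g x\<bar> \<le> norm x"
    and T_diff: "\<And>t x. norm (T t x - T (Suc t) x) \<le> C * (\<rho> ^ k) ^ t * sqrt (\<Sum>g\<in>F t. (g x)\<^sup>2)"
    by (rule dominatedE[OF dw], rule that) assumption+
  obtain u v :: "'k \<Rightarrow> real" and \<iota> :: 'k where uv: "linear u" "linear v"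
    "\<And>z. \<bar>u z\<bar> \<le> norm z" "\<And>z. \<bar>v z\<bar> \<le> norm z" "\<And>z. z = u z *\<^sub>R 1 + v z *\<^sub>R \<iota>" "norm \<iota> \<le> 1"
    by (rule rc_field_components, rule that) assumption+
  define D where "D t = C * (\<rho> ^ Suc k) ^ t" for t
  have D: "0 < D t" for t using C \<rho> by (simp add: D_def)
  have shift_T: "norm (shift s (T t x)) \<le> D t * norm x" if "t \<le> s" for s t x
  proof -
    have "norm (shift s (T t x)) \<le> \<rho> ^ s * norm (T t x)" by (rule norm_shift)
    also have "\<dots> \<le> \<rho> ^ t * (C * (\<rho> ^ k) ^ t * norm x)"
      using \<rho> that by (intro mult_mono T_norm power_decreasing) auto
    also have "\<dots> = D t * norm x" by (simp add: D_def power_mult_distrib mult_ac)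
    finally show ?thesis .
  qed
  define f where "f t p i x = p (shift t (T t x) i) / D t" for t i x and p :: "'k \<Rightarrow> real"
  have f: "linear (f t p i)" "\<bar>f t p i x\<bar> \<le> norm x" if p: "linear p" "\<And>z. \<bar>p z\<bar> \<le> norm z" for t p i x
  proof -
    interpret T: bounded_linear "T t" by (rule T)
    interpret sh: bounded_linear "shift t :: (nat \<Rightarrow>\<^sub>C 'k) \<Rightarrow> _" by (rule bounded_linear_shift)
    show "linear (f t p i)"
    proof (rule linearI)
      show "f t p i (x + y) = f t p i x + f t p i y" for x y
        by (simp add: f_def T.add sh.add linear_add[OF p(1)] add_divide_distrib)
      show "f t p i (r *\<^sub>R x) = r *\<^sub>R f t p i x" for r x
        by (simp add: f_def T.scaleR sh.scaleR linear_scale[OF p(1)])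
    qed
    have "\<bar>p (shift t (T t x) i)\<bar> \<le> D t * norm x"
      using order_trans[OF p(2) order_trans[OF norm_bounded shift_T[OF order_refl]]] .
    then show "\<bar>f t p i x\<bar> \<le> norm x"
      using D[of t] by (simp add: f_def divide_le_eq mult.commute)
  qed
  define G where "G t = F t \<union> (f t u ` level_set t \<union> f t v ` level_set t)" for t
  define T' where "T' t x = A (shift t (T t x))" for t x
  \<comment> \<open>The first summand serves the norm estimates, the others count the functionals.\<close>
  define C' where "C' = 3 * K * C + C + 8 * real n"
  have C': "0 < C'" using C K by (simp add: C'_def add_pos_nonneg)
  have G_fin: "finite (G t)" for t by (simp add: G_def F level_set)
  have sq: "sqrt (\<Sum>g\<in>F t. (g x)\<^sup>2) \<le> sqrt (\<Sum>g\<in>G t. (g x)\<^sup>2)" for t x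
    using G_fin[of t] by (intro real_sqrt_le_mono sum_mono2) (auto simp: G_def)
  have new: "norm (shift t (T t x) - shift (Suc t) (T t x)) \<le> 2 * D t * sqrt (\<Sum>g\<in>G t. (g x)\<^sup>2)" for t x
  proof (rule norm_bound)
    fix i
    show "norm (apply_bcontfun (shift t (T t x) - shift (Suc t) (T t x)) i) \<le> 2 * D t * sqrt (\<Sum>g\<in>G t. (g x)\<^sup>2)"
    proof (cases "i \<in> level_set t")
      case False
      then show ?thesis using D[of t] unfolding shift_Suc_diff by (simp add: sum_nonneg)
    next
      case True
      let ?z = "shift t (T t x) i"
      have p: "\<bar>p ?z\<bar> \<le> D t * sqrt (\<Sum>g\<in>G t. (g x)\<^sup>2)" if "f t p i \<in> G t" for p
      proof -
        have "\<bar>p ?z\<bar> = D t * \<bar>f t p i x\<bar>" using D[of t] by (simp add: f_def)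
        also have "\<dots> \<le> D t * sqrt (\<Sum>g\<in>G t. (g x)\<^sup>2)"
          using D[of t] by (intro mult_left_mono abs_le_sqrt_sum_squares G_fin that) auto
        finally show ?thesis .
      qed
      have "norm ?z = norm (u ?z *\<^sub>R 1 + v ?z *\<^sub>R \<iota>)" using uv(5)[of ?z] by simp
      also have "\<dots> \<le> norm (u ?z *\<^sub>R (1::'k)) + norm (v ?z *\<^sub>R \<iota>)" by (rule norm_triangle_ineq)
      also have "\<dots> \<le> \<bar>u ?z\<bar> + \<bar>v ?z\<bar>" using uv(6) by (simp add: mult_left_le)
      also have "\<dots> \<le> D t * sqrt (\<Sum>g\<in>G t. (g x)\<^sup>2) + D t * sqrt (\<Sum>g\<in>G t. (g x)\<^sup>2)"
        using True by (intro add_mono p) (auto simp: G_def)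
      finally show ?thesis using True unfolding shift_Suc_diff by simp
    qed
  qed
  show ?thesis
    unfolding dominated_def
  proof (intro exI[of _ T'] exI[of _ C'] exI[of _ G] conjI allI ballI C')
    show "bounded_linear (T' t)" for t
      unfolding T'_def by (rule bounded_linear_compose[OF A(1) bounded_linear_compose[OF bounded_linear_shift T(1)]])
    show "T' 0 x = (a \<circ> S \<circ> w) x" if x: "x \<in> W" for x
    proof -
      have wx: "w x \<in> W" by (rule W.op_mem[OF w x])
      then have "S (w x) = shift 0 (w x)" by (simp add: S_def restrict_W_def)
      moreover have "S (w x) \<in> W" by (rule W.op_mem[OF S_op wx])
      ultimately show ?thesis using T(2)[OF x] A(2)[of "S (w x)"] by (simp add: T'_def)
    qed
    have KD: "K * (3 * D t) \<le> C' * (\<rho> ^ Suc k) ^ t" for t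
    proof -
      have "3 * K * C * (\<rho> ^ Suc k) ^ t \<le> C' * (\<rho> ^ Suc k) ^ t"
        using \<rho> C by (intro mult_right_mono) (auto simp: C'_def)
      then show ?thesis by (simp add: D_def mult_ac)
    qed
    show "norm (T' t x) \<le> C' * (\<rho> ^ Suc k) ^ t * norm x" for t x
    proof -
      have "norm (T' t x) \<le> K * norm (shift t (T t x))" unfolding T'_def by (rule K)
      also have "\<dots> \<le> K * (D t * norm x)" using K by (intro mult_left_mono shift_T) auto
      also have "\<dots> \<le> K * (3 * D t) * norm x" using K(1) D[of t] by (simp add: mult.assoc)
      also have "\<dots> \<le> C' * (\<rho> ^ Suc k) ^ t * norm x" by (intro mult_right_mono KD) auto
      finally show ?thesis .
    qed
    show "finite (G t)" for t by (rule G_fin)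
    show "real (card (G t)) \<le> C' * 2 ^ t" for t
    proof -
      have "card (G t) \<le> card (F t) + (card (f t u ` level_set t) + card (f t v ` level_set t))"
        unfolding G_def by (intro order_trans[OF card_Un_le] add_mono order_refl card_Un_le)
      also have "\<dots> \<le> card (F t) + (card (level_set t) + card (level_set t))"
        by (intro add_mono order_refl card_image_le level_set)
      finally have "real (card (G t)) \<le> real (card (F t)) + (real (card (level_set t)) + real (card (level_set t)))"
        by (metis of_nat_add of_nat_mono)
      also have "\<dots> \<le> C * 2 ^ t + (4 * real n * 2 ^ t + 4 * real n * 2 ^ t)" by (intro add_mono F level_set)
      also have "\<dots> = (C + 8 * real n) * 2 ^ t" by (simp add: algebra_simps)
      also have "\<dots> \<le> C' * 2 ^ t" using C K by (intro mult_right_mono) (auto simp: C'_def)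
      finally show ?thesis .
    qed
    show "linear g" if "g \<in> G t" for t g
      using that F(3) f(1)[OF uv(1,3)] f(1)[OF uv(2,4)] by (auto simp: G_def)
    show "\<bar>g x\<bar> \<le> norm x" if "g \<in> G t" for t g x
      using that F(4) f(2)[OF uv(1,3)] f(2)[OF uv(2,4)] by (auto simp: G_def)
    show "norm (T' t x - T' (Suc t) x) \<le> C' * (\<rho> ^ Suc k) ^ t * sqrt (\<Sum>g\<in>G t. (g x)\<^sup>2)" for t x
    proof -
      let ?q = "sqrt (\<Sum>g\<in>G t. (g x)\<^sup>2)"
      interpret sh: bounded_linear "shift (Suc t) :: (nat \<Rightarrow>\<^sub>C 'k) \<Rightarrow> _" by (rule bounded_linear_shift)
      interpret A: bounded_linear A by (rule A)
      have "T' t x - T' (Suc t) x =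
        A ((shift t (T t x) - shift (Suc t) (T t x)) + shift (Suc t) (T t x - T (Suc t) x))"
        by (simp add: T'_def A.diff A.add sh.diff)
      then have "norm (T' t x - T' (Suc t) x) \<le>
        K * norm ((shift t (T t x) - shift (Suc t) (T t x)) + shift (Suc t) (T t x - T (Suc t) x))"
        by (simp only: K)
      also have "\<dots> \<le> K * (2 * D t * ?q + D t * ?q)"
      proof (intro mult_left_mono order_trans[OF norm_triangle_ineq] add_mono new)
        have "norm (shift (Suc t) (T t x - T (Suc t) x)) \<le> \<rho> ^ Suc t * norm (T t x - T (Suc t) x)"
          by (rule norm_shift)
        also have "\<dots> \<le> \<rho> ^ t * (C * (\<rho> ^ k) ^ t * ?q)"
          using \<rho> C by (intro mult_mono order_trans[OF T_diff] mult_left_mono sq power_decreasing) auto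
        also have "\<dots> = D t * ?q" by (simp add: D_def power_mult_distrib mult_ac)
        finally show "norm (shift (Suc t) (T t x - T (Suc t) x)) \<le> D t * ?q" .
      qed (use K in auto)
      also have "\<dots> = K * (3 * D t) * ?q" by (simp add: algebra_simps)
      also have "\<dots> \<le> C' * (\<rho> ^ Suc k) ^ t * ?q" by (intro mult_right_mono KD) (simp add: sum_nonneg)
      finally show ?thesis .
    qed
  qed
qed

lemma dominated_words:
  "w \<in> W.words S k \<Longrightarrow> dominated k (w :: (nat \<Rightarrow>\<^sub>C 'k::rc_field) \<Rightarrow> _)"
proof (induction k arbitrary: w)
  case 0
  then show ?case by (simp add: dominated_op)
next
  case (Suc k)
  then obtain a b where ab: "w = a \<circ> S \<circ> b" "a \<in> W.L" "b \<in> W.words S k" by auto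
  then have "b \<in> W.L" using W.words_subset_L[OF S_op, of k] by blast
  then show ?case unfolding ab(1) by (rule dominated_step[OF ab(2) _ Suc.IH[OF ab(3)]])
qed

lemma \<beta>_sum_zero:
  fixes T :: "'i \<Rightarrow> (nat \<Rightarrow>\<^sub>C 'k::rc_field) \<Rightarrow> (nat \<Rightarrow>\<^sub>C 'k)"
  assumes "finite I" "\<And>i. i \<in> I \<Longrightarrow> \<beta> m (T i) = 0"
    and "\<And>i. i \<in> I \<Longrightarrow> \<exists>e\<ge>0. \<forall>x\<in>W. norm (T i x) \<le> e * norm x"
  shows "(\<exists>e\<ge>0. \<forall>x\<in>W. norm (\<Sum>i\<in>I. T i x) \<le> e * norm x) \<and> \<beta> m (\<lambda>x. \<Sum>i\<in>I. T i x) = 0"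
  using assms
proof (induction I)
  case empty
  show ?case by (auto simp: \<beta>_def weighted_sum_def intro!: exI[of _ 0])
next
  case (insert i I)
  then obtain d e where d: "0 \<le> d" "\<And>x. x \<in> W \<Longrightarrow> norm (T i x) \<le> d * norm x"
    and e: "0 \<le> e" "\<And>x. x \<in> W \<Longrightarrow> norm (\<Sum>i\<in>I. T i x) \<le> e * norm x" and z: "\<beta> m (\<lambda>x. \<Sum>i\<in>I. T i x) = 0"
    by (metis insertCI)
  have "norm (T i x + (\<Sum>i\<in>I. T i x)) \<le> (d + e) * norm x" if "x \<in> W" for x
    using norm_triangle_ineq[of "T i x" "\<Sum>i\<in>I. T i x"] d(2)[OF that] e(2)[OF that]
    by (simp add: distrib_right)
  moreover have "\<beta> m (\<lambda>x. T i x + (\<Sum>i\<in>I. T i x)) = 0"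
    using \<beta>_add[OF d(2) e(2) d(1) e(1), of m] z insert.prems(1)[of i] by simp
  ultimately show ?case
    using insert.hyps d(1) e(1) by (auto intro!: exI[of _ "d + e"])
qed

text \<open>
  Summing the differences of the truncations dominates \<open>w\<close> by a Hilbertian seminorm. The
  coefficients at level \<open>t\<close> have the size \<open>\<sigma> ^ t\<close> for \<open>\<sigma> = \<rho> ^ (n + 1)\<close> and there are about \<open>2 ^ t\<close>
  functionals, so that \<open>2 * \<sigma>\<^sup>2 < 1\<close> leaves room for weights \<open>q ^ t\<close> with \<open>\<sigma>\<^sup>2 < q\<close> and \<open>2 * q < 1\<close>.
  Composing \<open>w\<close> with orthogonal projections of finite rank then approximates \<open>w\<close> in norm by finite
  sums of real-linear operators of rank one, on which the trace functional is zero.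
\<close>

theorem \<beta>_words:
  fixes w :: "(nat \<Rightarrow>\<^sub>C 'k::rc_field) \<Rightarrow> (nat \<Rightarrow>\<^sub>C 'k)"
  assumes w: "w \<in> W.words S (n + 1)"
  shows "\<beta> m w = 0"
proof -
  have wL: "w \<in> W.L" using w W.words_subset_L[OF S_op, of "n + 1"] by blast
  obtain T C F where C: "0 < C" and "\<And>t. bounded_linear (T t)" and T: "\<And>x. x \<in> W \<Longrightarrow> T 0 x = w x"
    and T_norm: "\<And>t x. norm (T t x) \<le> C * (\<rho> ^ (n + 1)) ^ t * norm x"
    and F: "\<And>t. finite (F t)" "\<And>t. real (card (F t)) \<le> C * 2 ^ t"
      "\<And>t g. g \<in> F t \<Longrightarrow> linear g" "\<And>t g x. g \<in> F t \<Longrightarrow> \<bar>g x\<bar> \<le> norm x"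
    and T_diff: "\<And>t x. norm (T t x - T (Suc t) x) \<le> C * (\<rho> ^ (n + 1)) ^ t * sqrt (\<Sum>g\<in>F t. (g x)\<^sup>2)"
    by (rule dominatedE[OF dominated_words[OF w]], rule that) assumption+
  define \<sigma> where "\<sigma> = \<rho> ^ (n + 1)"
  have \<sigma>: "0 < \<sigma>" "\<sigma> < 1" "2 * \<sigma>\<^sup>2 < 1"
    using \<rho> \<rho>_high power_strict_decreasing[of 0 "n + 1" \<rho>]
    by (simp_all add: \<sigma>_def power_mult[symmetric] mult.commute del: power_Suc)
  \<comment> \<open>Any number strictly between \<open>\<sigma>\<^sup>2\<close> and \<open>1 / 2\<close> would do.\<close>
  define q where "q = (\<sigma>\<^sup>2 + 1 / 2) / 2"
  have q: "0 < q" "2 * q < 1" "\<sigma>\<^sup>2 < q" using \<sigma> by (auto simp: q_def add_pos_pos)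
  interpret F: weighted_functionals F q C
    by (rule weighted_functionals.intro) (use F q in auto)
  define r where "r = \<sigma> / sqrt q"
  have r: "0 < r" "r < 1"
    using \<sigma> q real_less_rsqrt[of \<sigma> q] by (auto simp: r_def)
  define D where "D = C / (1 - r)"
  have D: "0 < D" using C r by (simp add: D_def)
  have hilbert: "norm (w x) \<le> D * sqrt (F.B x x)" if x: "x \<in> W" for x
  proof -
    let ?s = "sqrt (F.B x x)"
    have step: "norm (T t x - T (Suc t) x) \<le> C * ?s * r ^ t" for t
    proof -
      have "(\<Sum>g\<in>F t. (g x)\<^sup>2) \<le> F.B x x / q ^ t"
        using F.level_le_B[of t x] q by (simp add: pos_le_divide_eq mult.commute)
      then have "sqrt (\<Sum>g\<in>F t. (g x)\<^sup>2) \<le> ?s / sqrt q ^ t"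
        by (metis real_sqrt_divide real_sqrt_le_mono real_sqrt_power)
      then have "C * \<sigma> ^ t * sqrt (\<Sum>g\<in>F t. (g x)\<^sup>2) \<le> C * \<sigma> ^ t * (?s / sqrt q ^ t)"
        using C \<sigma> by (intro mult_left_mono) auto
      also have "\<dots> = C * ?s * r ^ t" by (simp add: r_def power_divide)
      finally show ?thesis using T_diff[of t x] unfolding \<sigma>_def[symmetric] by (rule order_trans[rotated])
    qed
    have tel: "norm (w x) \<le> D * ?s + C * \<sigma> ^ M * norm x" for M
    proof -
      have "w x = (\<Sum>t<M. T t x - T (Suc t) x) + T M x"
        using T[OF x] sum_lessThan_telescope'[of "\<lambda>t. T t x" M] by simp
      then have "norm (w x) \<le> norm (\<Sum>t<M. T t x - T (Suc t) x) + norm (T M x)"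
        using norm_triangle_ineq by metis
      also have "\<dots> \<le> (\<Sum>t<M. C * ?s * r ^ t) + C * \<sigma> ^ M * norm x"
        using T_norm[of M x] unfolding \<sigma>_def[symmetric] by (intro add_mono sum_norm_le step)
      also have "(\<Sum>t<M. C * ?s * r ^ t) \<le> D * ?s"
      proof -
        have "(\<Sum>t<M. r ^ t) \<le> 1 / (1 - r)"
          using r by (simp add: sum_gp_strict divide_right_mono)
        then have "C * ?s * (\<Sum>t<M. r ^ t) \<le> C * ?s * (1 / (1 - r))"
          using C F.nonneg[of x] by (intro mult_left_mono) auto
        then show ?thesis by (simp add: D_def sum_distrib_left)
      qed
      finally show ?thesis by simp
    qed
    have "(\<lambda>M. D * ?s + C * \<sigma> ^ M * norm x) \<longlonglongrightarrow> D * ?s + C * 0 * norm x"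
      using \<sigma> by (intro tendsto_intros LIMSEQ_realpow_zero) auto
    then show ?thesis using tel by (intro LIMSEQ_le_const[of _ "D * ?s"]) auto
  qed
  have small: "norm (\<beta> m w) \<le> C\<^sub>\<beta> * (D * \<eta>)" if \<eta>: "0 < \<eta>" for \<eta>
  proof -
    obtain I where I: "finite I" "I \<subseteq> W"
      "\<And>x. x \<in> W \<Longrightarrow> F.B (x - F.project I x) (x - F.project I x) \<le> (\<eta> * norm x)\<^sup>2"
      using F.finite_rank_projection[OF subspace_W \<eta>] by blast
    have proj_W: "F.project I x \<in> W" for x
      unfolding F.project_def using I(2) by (intro subspace_sum[OF subspace_W] subspace_scale[OF subspace_W]) auto
    define V where "V b x = c0_scale (of_real (F.B x b)) (w b)" for b x
    have bd: "norm (V b x) \<le> C / (1 - 2 * q) * norm b * norm (w b) * norm x" for b x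
    proof -
      have "norm (V b x) \<le> \<bar>F.B x b\<bar> * norm (w b)"
        unfolding V_def using norm_c0_scale[of "of_real (F.B x b) :: 'k" "w b"] by simp
      also have "\<dots> \<le> C / (1 - 2 * q) * norm x * norm b * norm (w b)"
        by (intro mult_right_mono F.B_bound) auto
      finally show ?thesis by (simp only: mult_ac)
    qed
    have Vz: "\<beta> m (V b) = 0" if "b \<in> I" for b
      unfolding V_def
    proof (rule \<beta>_rank_one[where K = "C / (1 - 2 * q) * norm b"])
      show "norm (of_real (F.B x b) :: 'k) \<le> C / (1 - 2 * q) * norm b * norm x" for x
        using F.B_bound[of x b] by (simp add: mult_ac)
      show "0 \<le> C / (1 - 2 * q) * norm b" using C q by simp
      show "w b \<in> W" by (rule W.op_range[OF wL])
    qed (simp_all add: F.add_left F.scale_left)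
    have "(\<exists>e\<ge>0. \<forall>x\<in>W. norm (\<Sum>b\<in>I. V b x) \<le> e * norm x) \<and> \<beta> m (\<lambda>x. \<Sum>b\<in>I. V b x) = 0"
    proof (rule \<beta>_sum_zero[OF I(1) Vz])
      show "\<exists>e\<ge>0. \<forall>x\<in>W. norm (V b x) \<le> e * norm x" for b
        using bd C q by (intro exI[of _ "C / (1 - 2 * q) * norm b * norm (w b)"]) auto
    qed
    then obtain e where e: "0 \<le> e" "\<And>x. x \<in> W \<Longrightarrow> norm (\<Sum>b\<in>I. V b x) \<le> e * norm x"
      and z: "\<beta> m (\<lambda>x. \<Sum>b\<in>I. V b x) = 0" by blast
    have w_proj: "w (F.project I x) = (\<Sum>b\<in>I. V b x)" for x
    proof -
      have "w (\<Sum>b\<in>J. F.B x b *\<^sub>R b) = (\<Sum>b\<in>J. V b x)" if "J \<subseteq> I" for J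
        using finite_subset[OF that I(1)] that
      proof (induction J)
        case (insert b J)
        have "(\<Sum>b\<in>J. F.B x b *\<^sub>R b) \<in> W" "F.B x b *\<^sub>R b \<in> W" "b \<in> W"
          using insert.prems I(2) by (auto intro!: subspace_sum[OF subspace_W] subspace_scale[OF subspace_W])
        then show ?case
          using insert by (simp add: W.op_add[OF wL] V_def scaleR_eq_c0_scale W.op_scale[OF wL])
      qed (simp add: W.op_zero[OF wL])
      then show ?thesis unfolding F.project_def by blast
    qed
    have diff: "norm (w x - (\<Sum>b\<in>I. V b x)) \<le> D * \<eta> * norm x" if x: "x \<in> W" for x
    proof -
      have "w x - (\<Sum>b\<in>I. V b x) = w (x - F.project I x)"
        using W.op_diff[OF wL x proj_W] by (simp add: w_proj)
      then have "norm (w x - (\<Sum>b\<in>I. V b x)) \<le> D * sqrt (F.B (x - F.project I x) (x - F.project I x))"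
        using hilbert[OF W.diff_X[OF x proj_W]] by simp
      also have "\<dots> \<le> D * sqrt ((\<eta> * norm x)\<^sup>2)"
        using D I(3)[OF x] by (intro mult_left_mono real_sqrt_le_mono) auto
      also have "\<dots> = D * \<eta> * norm x" using \<eta> by simp
      finally show ?thesis .
    qed
    have "\<beta> m w = \<beta> m (\<lambda>x. (w x - (\<Sum>b\<in>I. V b x)) + (\<Sum>b\<in>I. V b x))" by simp
    also have "\<dots> = \<beta> m (\<lambda>x. w x - (\<Sum>b\<in>I. V b x))"
      using \<beta>_add[OF diff e(2) _ e(1), of m] D \<eta> z by simp
    finally show ?thesis using norm_\<beta>[OF _ diff, of m] D \<eta> by simp
  qed
  have "norm (\<beta> m w) \<le> 0"
  proof (rule field_le_epsilon)
    fix e :: real assume e: "0 < e"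
    have "0 < C\<^sub>\<beta>" using \<tau> by (simp add: C\<^sub>\<beta>_def)
    then show "norm (\<beta> m w) \<le> 0 + e" using small[of "e / (C\<^sub>\<beta> * D)"] e D by simp
  qed
  then show ?thesis by simp
qed

end

section \<open>Failure of the approximation property\<close>

context davie_space
begin

lemma \<beta>_one: "\<beta> 0 W.one = (1 :: 'k::rc_field)"
proof -
  have "\<beta> 0 W.one = weighted_sum 0 (\<lambda>k c. (E 0 k c :: nat \<Rightarrow>\<^sub>C 'k) (enc 0 k c))"
    unfolding \<beta>_def weighted_sum_def
    by (intro suminf_cong arg_cong2[where f = "(*)"] sum.cong refl) (simp add: W.one_def E_W)
  then show ?thesis by (simp only: weighted_sum_diagonal)
qed

text \<open>
  Gaussian elimination: if \<open>b\<close> has the nonzero coordinate \<open>i\<close>, then subtracting the multiple of \<open>b\<close>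
  with the same coordinate \<open>i\<close> removes \<open>b\<close> from the spanning set of the range. The coefficient of
  \<open>b\<close> is obtained from a coordinate of \<open>T x\<close>, so it is a bounded functional.
\<close>

lemma \<beta>_finite_rank:
  fixes T :: "(nat \<Rightarrow>\<^sub>C 'k::rc_field) \<Rightarrow> (nat \<Rightarrow>\<^sub>C 'k)"
  assumes "finite B" "B \<subseteq> W" "T \<in> W.L" "T ` W \<subseteq> c0.span B"
  shows "\<beta> m T = 0"
  using assms
proof (induction "card B" arbitrary: B T rule: less_induct)
  case less
  note fin = less.prems(1) and BW = less.prems(2) and TL = less.prems(3) and ran = less.prems(4)
  show ?case
  proof (cases "B = {}")
    case True
    then have "\<beta> m T = \<beta> m (\<lambda>_. 0)" using ran by (intro \<beta>_cong) auto
    then show ?thesis by (simp add: \<beta>_def weighted_sum_def)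
  next
    case False
    then obtain b B' where B: "B = insert b B'" "b \<notin> B'" by (metis Set.set_insert all_not_in_conv)
    have fin': "finite B'" using fin B by simp
    have cB: "card B' < card B" using fin B by simp
    have bW: "b \<in> W" and B'W: "B' \<subseteq> W" using BW B by auto
    show ?thesis
    proof (cases "b = 0")
      case True
      then have "c0.span B = c0.span B'" by (simp add: B(1) c0.span_insert_0)
      then show ?thesis using less.hyps[OF cB fin' B'W TL] ran by simp
    next
      case False
      then obtain i where i: "b i \<noteq> 0" by (metis bcontfun_eqI zero_bcontfun.rep_eq)
      obtain K where K: "0 < K" "\<And>x. norm (T x) \<le> K * norm x" using W.op_bound[OF TL] by blast
      define f where "f x = T x i / b i" for x
      define V where "V x = c0_scale (f x) b" for x
      have f_add: "f (x + y) = f x + f y" if "x \<in> W" "y \<in> W" for x y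
        using W.op_add[OF TL that] by (simp add: f_def add_divide_distrib)
      have f_scale: "f (c0_scale c x) = c * f x" if "x \<in> W" for c x
        using W.op_scale[OF TL that] by (simp add: f_def)
      have f_bound: "norm (f x) \<le> K / norm (b i) * norm x" for x
      proof -
        have "norm (T x i) \<le> K * norm x" by (rule order_trans[OF norm_bounded K(2)])
        then show ?thesis by (simp add: f_def norm_divide divide_right_mono)
      qed
      have VL: "V \<in> W.L"
      proof (rule W.bounded_opI[where K = "K / norm (b i) * norm b"])
        show "V x = 0" if "x \<notin> W" for x using W.op_outside[OF TL that] by (simp add: V_def f_def)
        show "norm (V x) \<le> K / norm (b i) * norm b * norm x" for x
        proof -
          have "norm (V x) \<le> norm (f x) * norm b" unfolding V_def by (rule norm_c0_scale)
          also have "\<dots> \<le> K / norm (b i) * norm x * norm b" by (intro mult_right_mono f_bound) auto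
          finally show ?thesis by (simp add: mult_ac)
        qed
      qed (use bW in \<open>simp_all add: V_def f_add f_scale W_scale c0.scale_left_distrib\<close>)
      have Vz: "\<beta> m V = 0"
        unfolding V_def
      proof (rule \<beta>_rank_one[OF f_add _ f_bound _ bW])
        show "f (r *\<^sub>R x) = of_real r * f x" if "x \<in> W" for r x
          unfolding scaleR_eq_c0_scale by (rule f_scale[OF that])
      qed (use K in auto)
      \<comment> \<open>\<open>P\<close> annihilates \<open>b\<close> and makes coordinate \<open>i\<close> zero.\<close>
      define P where "P z = z - c0_scale (z i / b i) b" for z :: "nat \<Rightarrow>\<^sub>C 'k"
      define T' where "T' x = T x - V x" for x
      have T'L: "T' \<in> W.L" unfolding T'_def by (rule W.L_diff[OF TL VL])
      have "c0.subspace {z. P z \<in> c0.span (P ` B')}"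
        unfolding c0.subspace_def
      proof (intro conjI allI ballI)
        show "0 \<in> {z. P z \<in> c0.span (P ` B')}" by (simp add: P_def c0.span_zero)
      next
        fix x y assume "x \<in> {z. P z \<in> c0.span (P ` B')}" "y \<in> {z. P z \<in> c0.span (P ` B')}"
        moreover have "P (x + y) = P x + P y" by (simp add: P_def add_divide_distrib c0.scale_left_distrib)
        ultimately show "x + y \<in> {z. P z \<in> c0.span (P ` B')}" by (simp add: c0.span_add)
      next
        fix c x assume "x \<in> {z. P z \<in> c0.span (P ` B')}"
        moreover have "P (c0_scale c x) = c0_scale c (P x)" by (simp add: P_def c0.scale_right_diff_distrib)
        ultimately show "c0_scale c x \<in> {z. P z \<in> c0.span (P ` B')}" by (simp add: c0.span_scale)
      qed
      moreover have "P b = 0" using i by (simp add: P_def)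
      then have "B \<subseteq> {z. P z \<in> c0.span (P ` B')}" by (auto simp: B(1) c0.span_zero intro: c0.span_base)
      ultimately have "c0.span B \<subseteq> {z. P z \<in> c0.span (P ` B')}" by (intro c0.span_minimal)
      moreover have "T' x = P (T x)" for x by (simp add: T'_def P_def V_def f_def)
      ultimately have "T' ` W \<subseteq> c0.span (P ` B')" using ran by auto
      moreover have "card (P ` B') < card B" using card_image_le[OF fin', of P] cB by simp
      moreover have "P ` B' \<subseteq> W" using B'W bW by (auto simp: P_def intro!: W.diff_X W_scale)
      ultimately have "\<beta> m T' = 0" using less.hyps[of "P ` B'" T'] fin' T'L by simp
      moreover have "\<beta> m T = \<beta> m (\<lambda>x. T' x + V x)" by (simp add: T'_def)
      ultimately show ?thesis using \<beta>_L_add[OF T'L VL, of m] Vz by simp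
    qed
  qed
qed

text \<open>
  The trace functional is zero on operators of finite rank and one on the identity. Its value is a
  sum over the rows \<open>E 0 k c\<close>, whose norms are so small that the rows can be multiplied by \<open>\<mu> k\<close>
  and still tend to zero, whereas \<open>1 / \<mu> k\<close> is summable over all rows. Approximation of the
  identity on the compact set of the multiplied rows therefore approximates the trace.
\<close>

lemma no_approximation_property: "\<not> approximation_property c0_scale (W :: (nat \<Rightarrow>\<^sub>C 'k::rc_field) set)"
proof
  assume AP: "approximation_property c0_scale (W :: (nat \<Rightarrow>\<^sub>C 'k) set)"
  define \<mu> where "\<mu> k = (real (Suc k))\<^sup>2 * 2 ^ k" for k
  define z where "z k c = \<mu> k *\<^sub>R (E 0 k c :: nat \<Rightarrow>\<^sub>C 'k)" for k c
  have \<mu>: "0 < \<mu> k" for k by (simp add: \<mu>_def)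
  have zW: "z k c \<in> W" if "c < 2 ^ (k + 2)" for k c
    unfolding z_def using that by (intro subspace_scale[OF subspace_W] E_W) auto
  have z_norm: "norm (z k c) \<le> 4 * real (Suc k) ^ 3 / sqrt 2 ^ k" if "c < 2 ^ (k + 2)" for k c
  proof -
    have "norm (z k c) \<le> \<mu> k * row_norm_bound k"
      unfolding z_def using \<mu>[of k] norm_E[OF that, of 0] by (simp add: mult_left_mono)
    also have "\<dots> = 4 * real (Suc k) ^ 3 / sqrt 2 ^ k"
      by (simp add: \<mu>_def row_norm_bound_def real_sqrt_power power2_eq_square power3_eq_cube)
    finally show ?thesis .
  qed
  define h where "h i = (case prod_decode i of (k, c) \<Rightarrow> if c < 2 ^ (k + 2) then z k c else 0)" for i
  have "h \<longlonglongrightarrow> 0"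
  proof (rule LIMSEQ_I)
    fix e :: real assume e: "0 < e"
    have "(\<lambda>k. 4 * real (Suc k) ^ 3 / sqrt 2 ^ k) \<longlonglongrightarrow> 0" by real_asymp
    from LIMSEQ_D[OF this e] obtain k0 where k0: "\<And>k. k \<ge> k0 \<Longrightarrow> 4 * real (Suc k) ^ 3 / sqrt 2 ^ k < e"
      by auto
    have "finite (prod_encode ` (SIGMA k:{..<k0}. {..<(2::nat) ^ (k + 2)}))" by auto
    then obtain N where N: "\<And>i. i \<in> prod_encode ` (SIGMA k:{..<k0}. {..<(2::nat) ^ (k + 2)}) \<Longrightarrow> i < N"
      unfolding finite_nat_set_iff_bounded by blast
    have "norm (h i - 0) < e" if "i \<ge> N" for i
    proof -
      obtain k c where kc: "prod_decode i = (k, c)" by fastforce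
      then have i: "i = prod_encode (k, c)" by (metis prod_decode_inverse)
      show ?thesis
      proof (cases "c < 2 ^ (k + 2)")
        case True
        have "\<not> k < k0" using N[of i] True that by (auto simp: i)
        then show ?thesis using z_norm[OF True] k0[of k] True kc by (simp add: h_def)
      qed (use e kc in \<open>simp add: h_def\<close>)
    qed
    then show "\<exists>N. \<forall>i\<ge>N. norm (h i - 0) < e" by blast
  qed
  then have "compact (insert 0 (range h))"
    using compactin_sequence_with_limit[of euclidean h 0 "range h"] by simp
  moreover have "insert 0 (range h) \<subseteq> W"
    using zW W.zero_X by (auto simp: h_def split: prod.splits)
  moreover define Q where "Q = (\<Sum>k. 1 / (real (Suc k))\<^sup>2)"
  have summ: "summable (\<lambda>k. 1 / (real (Suc k))\<^sup>2)"
    using inverse_power_summable[of 2, where 'a = real] by (subst summable_Suc_iff) (simp add: inverse_eq_divide)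
  have Q: "0 < Q" unfolding Q_def by (intro suminf_pos summ) auto
  \<comment> \<open>With \<open>4 * 2 ^ k\<close> rows at level \<open>k\<close>, the error in the trace will be at most \<open>4 * \<epsilon> * Q = 1 / 2\<close>.\<close>
  define \<epsilon> where "\<epsilon> = 1 / (8 * Q)"
  have \<epsilon>: "0 < \<epsilon>" using Q by (simp add: \<epsilon>_def)
  ultimately obtain T :: "(nat \<Rightarrow>\<^sub>C 'k) \<Rightarrow> (nat \<Rightarrow>\<^sub>C 'k)" where T: "T \<in> W.L" "finite_rank c0_scale W T"
    and close: "\<And>x. x \<in> insert 0 (range h) \<Longrightarrow> norm (T x - x) < \<epsilon>"
    using AP unfolding approximation_property_def by meson
  define U where "U x = W.one x - T x" for x
  have UL: "U \<in> W.L" unfolding U_def by (rule W.L_diff[OF W.L_one T(1)])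
  have "\<beta> 0 T = 0" using T by (auto simp: finite_rank_def intro: \<beta>_finite_rank)
  moreover have "\<beta> 0 W.one = \<beta> 0 (\<lambda>x. U x + T x)" by (simp add: U_def)
  ultimately have U1: "\<beta> 0 U = 1" using \<beta>_L_add[OF UL T(1), of 0] \<beta>_one[where 'k = 'k] by simp
  have UE: "norm (U (E 0 k c)) \<le> \<epsilon> / \<mu> k" if c: "c < 2 ^ (k + 2)" for k c
  proof -
    have EW: "(E 0 k c :: nat \<Rightarrow>\<^sub>C 'k) \<in> W" using c by (intro E_W) auto
    have "h (prod_encode (k, c)) = z k c" using c by (simp add: h_def)
    then have "z k c \<in> insert 0 (range h)" by (metis insertI2 rangeI)
    then have "norm (T (z k c) - z k c) < \<epsilon>" by (rule close)
    moreover have "U (z k c) = - (T (z k c) - z k c)" using zW[OF c] by (simp add: U_def W.one_def)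
    ultimately have "norm (U (z k c)) < \<epsilon>" by (simp only: norm_minus_cancel)
    moreover have "U (z k c) = \<mu> k *\<^sub>R U (E 0 k c)"
      unfolding z_def scaleR_eq_c0_scale by (rule W.op_scale[OF UL EW])
    ultimately show ?thesis using \<mu>[of k] by (simp add: pos_le_divide_eq mult.commute)
  qed
  have "norm (\<beta> 0 U) \<le> (\<Sum>k. 4 * \<epsilon> * (1 / (real (Suc k))\<^sup>2))"
    unfolding \<beta>_def weighted_sum_def
  proof (rule norm_suminf_le)
    fix k
    have "norm (\<Sum>c<2 ^ (k + 2). U (E 0 k c) (enc 0 k c)) \<le> (\<Sum>c<(2::nat) ^ (k + 2). \<epsilon> / \<mu> k)"
      by (intro sum_norm_le order_trans[OF norm_bounded UE]) auto
    also have "\<dots> = 4 * \<epsilon> * (1 / (real (Suc k))\<^sup>2)" by (simp add: \<mu>_def power_add)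
    finally show "norm (of_real ((1 / \<rho> ^ min 0 n) ^ k) * (\<Sum>c<2 ^ (k + 2). U (E 0 k c) (enc 0 k c)))
        \<le> 4 * \<epsilon> * (1 / (real (Suc k))\<^sup>2)" by simp
  qed (intro summable_mult summ)
  also have "\<dots> = 4 * \<epsilon> * Q" unfolding Q_def by (rule suminf_mult[OF summ])
  also have "\<dots> < 1" using Q by (simp add: \<epsilon>_def)
  finally show False using U1 by simp
qed

end

section \<open>Quasi-nuclear operators\<close>

lemma onorm_bounded_ops_nonneg:
  assumes "T \<in> bounded_ops s X t Y"
  shows "0 \<le> onorm T"
proof (cases "\<exists>x::'a::real_normed_vector. x \<noteq> 0")
  case True
  then obtain x :: 'a where x: "0 < norm x" by auto
  have "0 \<le> onorm T * norm x"
    using norm_bounded_ops_le[OF assms, of x] norm_ge_zero[of "T x"] by linarith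
  then show ?thesis using x by (simp add: zero_le_mult_iff)
next
  case False
  then have "norm (T x) / norm x = 0" for x by simp
  then have "(\<lambda>x. norm (T x) / norm x) = (\<lambda>_. 0)" by (rule ext)
  then show ?thesis by (simp only: onorm_def) simp
qed

lemma dual_summable:
  assumes "\<And>k. \<phi> k \<in> dual_space s X" "summable (\<lambda>k. onorm (\<phi> k) powr p)" "0 \<le> p"
  shows "summable (\<lambda>k. norm (\<phi> k x) powr p)"
proof (rule summable_comparison_test'[OF summable_mult2[OF assms(2), of "norm x powr p"]])
  fix k
  have op: "\<phi> k \<in> bounded_ops s X (*) UNIV" using assms(1)[of k] by (simp add: dual_space_def)
  have "norm (\<phi> k x) powr p \<le> (onorm (\<phi> k) * norm x) powr p"
    by (intro powr_mono2 norm_bounded_ops_le[OF op] assms(3)) auto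
  also have "\<dots> = onorm (\<phi> k) powr p * norm x powr p"
    by (rule powr_mult)
  finally show "norm (norm (\<phi> k x) powr p) \<le> onorm (\<phi> k) powr p * norm x powr p" by simp
qed

lemma dual_space_scale:
  fixes s :: "'k::real_normed_field \<Rightarrow> 'a \<Rightarrow> 'a::real_normed_vector"
  assumes "\<phi> \<in> dual_space s X"
  shows "(\<lambda>x. c * \<phi> x) \<in> dual_space s X" "onorm (\<lambda>x. c * \<phi> x) \<le> norm c * onorm \<phi>"
proof -
  have op: "\<phi> \<in> bounded_ops s X (*) UNIV" using assms by (simp add: dual_space_def)
  have le: "norm (c * \<phi> x) \<le> norm c * onorm \<phi> * norm x" for x
    using mult_left_mono[OF norm_bounded_ops_le[OF op, of x], of "norm c"] by (simp add: norm_mult mult.assoc)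
  show 1: "(\<lambda>x. c * \<phi> x) \<in> dual_space s X"
    using op le unfolding dual_space_def bounded_ops_def
    by (auto simp: distrib_left mult.left_commute intro!: exI[of _ "norm c * onorm \<phi>"])
  show "onorm (\<lambda>x. c * \<phi> x) \<le> norm c * onorm \<phi>"
    using onorm_bounded_ops_le[OF 1[unfolded dual_space_def] _ le] onorm_bounded_ops_nonneg[OF op] by simp
qed

lemma quasi_nuclearI:
  fixes s :: "'k::real_normed_field \<Rightarrow> 'a \<Rightarrow> 'a::real_normed_vector"
  assumes p: "1 \<le> p" and T: "T \<in> bounded_ops s X t Y" and K: "0 \<le> K"
    and \<phi>: "\<And>k::nat. \<phi> k \<in> dual_space s X" "summable (\<lambda>k. onorm (\<phi> k) powr p)"
    and le: "\<And>x. x \<in> X \<Longrightarrow> norm (T x) \<le> K * (\<Sum>k. norm (\<phi> k x) powr p) powr (1 / p)"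
  shows "T \<in> quasi_nuclear p s X t Y"
proof -
  let ?\<psi> = "\<lambda>k x. of_real K * \<phi> k x"
  have dual: "?\<psi> k \<in> dual_space s X" and on: "onorm (?\<psi> k) \<le> K * onorm (\<phi> k)" for k
    using dual_space_scale[OF \<phi>(1)[of k], of "of_real K"] K by simp_all
  have op: "\<phi> k \<in> bounded_ops s X (*) UNIV" "?\<psi> k \<in> bounded_ops s X (*) UNIV" for k
    using \<phi>(1)[of k] dual[of k] by (simp_all add: dual_space_def)
  have summ_\<psi>: "summable (\<lambda>k. onorm (?\<psi> k) powr p)"
  proof (rule summable_comparison_test'[OF summable_mult[OF \<phi>(2), of "K powr p"]])
    fix k
    have "onorm (?\<psi> k) powr p \<le> (K * onorm (\<phi> k)) powr p"
      using p by (intro powr_mono2 on onorm_bounded_ops_nonneg[OF op(2)]) auto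
    also have "\<dots> = K powr p * onorm (\<phi> k) powr p"
      by (rule powr_mult)
    finally show "norm (onorm (?\<psi> k) powr p) \<le> K powr p * onorm (\<phi> k) powr p" by simp
  qed
  have le_\<psi>: "norm (T x) \<le> (\<Sum>k. norm (?\<psi> k x) powr p) powr (1 / p)" if "x \<in> X" for x
  proof -
    have summ: "summable (\<lambda>k. norm (\<phi> k x) powr p)" using p by (intro dual_summable[OF \<phi>]) auto
    have "norm (?\<psi> k x) powr p = K powr p * norm (\<phi> k x) powr p" for k
      using K by (simp add: norm_mult powr_mult)
    then have "(\<Sum>k. norm (?\<psi> k x) powr p) = K powr p * (\<Sum>k. norm (\<phi> k x) powr p)"
      using suminf_mult[OF summ] by simp
    then have "(\<Sum>k. norm (?\<psi> k x) powr p) powr (1 / p) = K * (\<Sum>k. norm (\<phi> k x) powr p) powr (1 / p)"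
      using K p by (simp add: powr_mult powr_powr suminf_nonneg[OF summ])
    then show ?thesis using le[OF that] by simp
  qed
  show ?thesis
    unfolding quasi_nuclear_def using T dual summ_\<psi> le_\<psi>
    by (intro CollectI conjI exI[of _ ?\<psi>] allI ballI)
qed

text \<open>
  The two sequences of functionals are interleaved. The factor two absorbs the sum of the two
  roots in place of the triangle inequality in \<open>l\<^sup>p\<close>.
\<close>

lemma quasi_nuclear_add:
  fixes s :: "'k::real_normed_field \<Rightarrow> 'a \<Rightarrow> 'a::real_normed_vector"
  assumes p: "1 \<le> p" and T: "T \<in> quasi_nuclear p s X t Y" and U: "U \<in> quasi_nuclear p s X t Y"
    and TU: "(\<lambda>x. T x + U x) \<in> bounded_ops s X t Y"
  shows "(\<lambda>x. T x + U x) \<in> quasi_nuclear p s X t Y"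
proof -
  from T obtain \<phi> :: "nat \<Rightarrow> 'a \<Rightarrow> 'k" where \<phi>: "\<And>k. \<phi> k \<in> dual_space s X"
    "summable (\<lambda>k. onorm (\<phi> k) powr p)" "\<And>x. x \<in> X \<Longrightarrow> norm (T x) \<le> (\<Sum>k. norm (\<phi> k x) powr p) powr (1 / p)"
    by (auto simp: quasi_nuclear_def)
  from U obtain \<psi> :: "nat \<Rightarrow> 'a \<Rightarrow> 'k" where \<psi>: "\<And>k. \<psi> k \<in> dual_space s X"
    "summable (\<lambda>k. onorm (\<psi> k) powr p)" "\<And>x. x \<in> X \<Longrightarrow> norm (U x) \<le> (\<Sum>k. norm (\<psi> k x) powr p) powr (1 / p)"
    by (auto simp: quasi_nuclear_def)
  define \<omega> where "\<omega> i = (if even i then \<psi> (i div 2) else \<phi> ((i - 1) div 2))" for i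
  have inter: "(\<lambda>i. h (\<omega> i)) sums ((\<Sum>k. h (\<phi> k)) + (\<Sum>k. h (\<psi> k)))"
    if "summable (\<lambda>k. h (\<phi> k))" "summable (\<lambda>k. h (\<psi> k))" for h :: "('a \<Rightarrow> 'k) \<Rightarrow> real"
    using sums_if[OF summable_sums[OF that(1)] summable_sums[OF that(2)]]
    unfolding \<omega>_def by (simp add: if_distrib[of h])
  show ?thesis
  proof (rule quasi_nuclearI[OF p TU, of 2 \<omega>])
    show "\<omega> k \<in> dual_space s X" for k using \<phi>(1) \<psi>(1) by (simp add: \<omega>_def)
    show "summable (\<lambda>k. onorm (\<omega> k) powr p)" using inter[OF \<phi>(2) \<psi>(2)] by (rule sums_summable)
    show "norm (T x + U x) \<le> 2 * (\<Sum>k. norm (\<omega> k x) powr p) powr (1 / p)" if x: "x \<in> X" for x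
    proof -
      let ?A = "\<Sum>k. norm (\<phi> k x) powr p" and ?B = "\<Sum>k. norm (\<psi> k x) powr p"
      have s: "summable (\<lambda>k. norm (\<phi> k x) powr p)" "summable (\<lambda>k. norm (\<psi> k x) powr p)"
        using p by (auto intro: dual_summable[OF \<phi>(1,2)] dual_summable[OF \<psi>(1,2)])
      have "(\<Sum>k. norm (\<omega> k x) powr p) = ?A + ?B"
        using inter[of "\<lambda>g. norm (g x) powr p"] s by (simp add: sums_iff)
      moreover have AB: "0 \<le> ?A" "0 \<le> ?B" using s by (auto intro: suminf_nonneg)
      then have "?A powr (1 / p) \<le> (?A + ?B) powr (1 / p)" "?B powr (1 / p) \<le> (?A + ?B) powr (1 / p)"
        using p by (auto intro!: powr_mono2)
      ultimately show ?thesis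
        using \<phi>(3)[OF x] \<psi>(3)[OF x] norm_triangle_ineq[of "T x" "U x"] by simp
    qed
  qed simp
qed

lemma quasi_nuclear_scale:
  fixes s :: "'k::real_normed_field \<Rightarrow> 'a \<Rightarrow> 'a::real_normed_vector"
  assumes p: "1 \<le> p" and T: "T \<in> quasi_nuclear p s X t Y" and cT: "(\<lambda>x. t c (T x)) \<in> bounded_ops s X t Y"
    and nrm: "\<And>y. norm (t c y) \<le> norm c * norm y"
  shows "(\<lambda>x. t c (T x)) \<in> quasi_nuclear p s X t Y"
proof -
  from T obtain \<phi> :: "nat \<Rightarrow> 'a \<Rightarrow> 'k" where \<phi>: "\<And>k. \<phi> k \<in> dual_space s X"
    "summable (\<lambda>k. onorm (\<phi> k) powr p)" "\<And>x. x \<in> X \<Longrightarrow> norm (T x) \<le> (\<Sum>k. norm (\<phi> k x) powr p) powr (1 / p)"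
    by (auto simp: quasi_nuclear_def)
  show ?thesis
  proof (rule quasi_nuclearI[OF p cT _ \<phi>(1,2)])
    show "norm (t c (T x)) \<le> norm c * (\<Sum>k. norm (\<phi> k x) powr p) powr (1 / p)" if "x \<in> X" for x
      using order_trans[OF nrm mult_left_mono[OF \<phi>(3)[OF that] norm_ge_zero]] .
  qed simp
qed

context davie_space
begin

definition diag :: "nat \<Rightarrow> real" where
  "diag i = (if i \<in> level_set (lev i) then \<rho> ^ lev i else 0)"

lemma shift_value_diag: "norm (shift_value 0 x i) \<le> diag i * norm x"
proof (cases "i \<in> level_set (lev i)")
  case True
  then have "norm (shift_value 0 x i) = \<rho> ^ lev i * norm (x (enc (slot i - 1) (lev i) (pos i)))"
    using \<rho> by (simp add: shift_value_def level_set_def norm_mult norm_power)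
  also have "\<dots> \<le> \<rho> ^ lev i * norm x" using \<rho> by (intro mult_left_mono norm_bounded) auto
  finally show ?thesis using True by (simp add: diag_def)
next
  case False
  then show ?thesis by (auto simp: shift_value_def level_set_def diag_def)
qed

text \<open>
  Level \<open>k\<close> has about \<open>2 ^ k\<close> coordinates, on each of which \<open>D\<close> is \<open>\<rho> ^ k\<close>.
\<close>

lemma diag_summable:
  assumes p: "2 * \<rho> powr p < 1"
  shows "summable (\<lambda>i. diag i powr p)"
proof (rule summableI_nonneg_bounded)
  fix N
  let ?g = "\<lambda>k. 4 * real n * (2 * \<rho> powr p) ^ k"
  obtain M where M: "\<And>i. i < N \<Longrightarrow> lev i < M"
    using finite_nat_set_iff_bounded[of "lev ` {..<N}"] by auto
  have "(\<Sum>i<N. diag i powr p) = (\<Sum>k<M. \<Sum>i\<in>{i \<in> {..<N}. lev i = k}. diag i powr p)"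
    using M by (intro sum.group[symmetric]) auto
  also have "\<dots> \<le> (\<Sum>k<M. ?g k)"
  proof (rule sum_mono)
    fix k
    have "(\<Sum>i\<in>{i \<in> {..<N}. lev i = k}. diag i powr p) \<le> (\<Sum>i\<in>level_set k. (\<rho> powr p) ^ k)"
    proof -
      have "(\<Sum>i\<in>{i \<in> {..<N}. lev i = k}. diag i powr p) = (\<Sum>i\<in>{i \<in> {..<N}. lev i = k} \<inter> level_set k. (\<rho> powr p) ^ k)"
        using \<rho> by (intro sum.mono_neutral_cong_right)
          (auto simp: diag_def powr_realpow[symmetric] powr_powr mult.commute)
      also have "\<dots> \<le> (\<Sum>i\<in>level_set k. (\<rho> powr p) ^ k)"
        using level_set(1)[of k] by (intro sum_mono2) auto
      finally show ?thesis .
    qed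
    also have "\<dots> = real (card (level_set k)) * (\<rho> powr p) ^ k" by simp
    also have "\<dots> \<le> (4 * real n * 2 ^ k) * (\<rho> powr p) ^ k" by (intro mult_right_mono level_set) auto
    also have "\<dots> = ?g k" by (simp add: power_mult_distrib)
    finally show "(\<Sum>i\<in>{i \<in> {..<N}. lev i = k}. diag i powr p) \<le> ?g k" .
  qed
  also have "\<dots> \<le> (\<Sum>k. ?g k)"
    using p by (intro sum_le_suminf summable_mult summable_geometric) auto
  finally show "(\<Sum>i<N. diag i powr p) \<le> (\<Sum>k. ?g k)" .
qed simp

lemma word_quasi_nuclear:
  fixes a b :: "(nat \<Rightarrow>\<^sub>C 'k::rc_field) \<Rightarrow> (nat \<Rightarrow>\<^sub>C 'k)"
  assumes p: "1 \<le> p" "2 * \<rho> powr p < 1" and a: "a \<in> W.L" and b: "b \<in> W.L"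
  shows "a \<circ> S \<circ> b \<in> quasi_nuclear p c0_scale W c0_scale W"
proof -
  obtain K where K: "0 < K" "\<And>x. norm (a x) \<le> K * norm x" using W.op_bound[OF a] by blast
  obtain M where M: "0 < M" "\<And>x. norm (b x) \<le> M * norm x" using W.op_bound[OF b] by blast
  have Sb: "S \<circ> b \<in> W.L" by (rule W.L_comp[OF S_op b])
  define \<phi> where "\<phi> i x = (S \<circ> b) x i" for i :: nat and x :: "nat \<Rightarrow>\<^sub>C 'k"
  have diag_nonneg: "0 \<le> diag i" for i using \<rho> by (simp add: diag_def)
  have le: "norm (\<phi> i x) \<le> diag i * M * norm x" for i x
  proof -
    have "norm (\<phi> i x) \<le> diag i * norm (b x)"
      using shift_value_diag[of "b x" i] S_apply[OF W.op_range[OF b], of x i] by (simp add: \<phi>_def)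
    also have "\<dots> \<le> diag i * (M * norm x)" by (intro mult_left_mono M diag_nonneg)
    finally show ?thesis by (simp only: mult.assoc)
  qed
  have dual: "\<phi> i \<in> dual_space c0_scale W" for i
    unfolding dual_space_def bounded_ops_def
  proof (intro CollectI conjI allI impI ballI exI)
    show "norm (\<phi> i x) \<le> diag i * M * norm x" for x by (rule le)
  qed (use Sb in \<open>simp_all add: \<phi>_def W.op_outside W.op_add W.op_scale del: comp_apply\<close>)
  have summ: "summable (\<lambda>i. onorm (\<phi> i) powr p)"
  proof (rule summable_comparison_test'[OF summable_mult2[OF diag_summable[OF p(2)], of "M powr p"]])
    fix i
    have op: "\<phi> i \<in> bounded_ops c0_scale W (*) UNIV" using dual by (simp add: dual_space_def)
    have "onorm (\<phi> i) \<le> diag i * M"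
      using diag_nonneg[of i] M(1) le by (intro onorm_bounded_ops_le[OF op]) auto
    then have "onorm (\<phi> i) powr p \<le> (diag i * M) powr p"
      using p by (intro powr_mono2 onorm_bounded_ops_nonneg[OF op]) auto
    also have "\<dots> = diag i powr p * M powr p" by (rule powr_mult)
    finally show "norm (onorm (\<phi> i) powr p) \<le> diag i powr p * M powr p" by simp
  qed
  show ?thesis
  proof (rule quasi_nuclearI[OF p(1) _ _ dual summ])
    show "a \<circ> S \<circ> b \<in> W.L" by (intro W.L_comp a b S_op)
    show "0 \<le> K" using K by simp
    fix x :: "nat \<Rightarrow>\<^sub>C 'k"
    let ?q = "(\<Sum>i. norm (\<phi> i x) powr p) powr (1 / p)"
    have s: "summable (\<lambda>i. norm (\<phi> i x) powr p)" using p by (intro dual_summable[OF dual summ]) auto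
    have "norm ((S \<circ> b) x) \<le> ?q"
    proof (rule norm_bound)
      fix i
      have "(\<Sum>j\<in>{i}. norm (\<phi> j x) powr p) \<le> (\<Sum>i. norm (\<phi> i x) powr p)"
        by (rule sum_le_suminf[OF s]) auto
      then have "(norm (\<phi> i x) powr p) powr (1 / p) \<le> ?q"
        using p by (intro powr_mono2) auto
      then show "norm ((S \<circ> b) x i) \<le> ?q" using p by (simp add: powr_powr \<phi>_def)
    qed
    then have "K * norm ((S \<circ> b) x) \<le> K * ?q" using K by (intro mult_left_mono) auto
    then show "norm ((a \<circ> S \<circ> b) x) \<le> K * ?q" using K(2)[of "S (b x)"] by simp
  qed
qed

lemma generating_ops_quasi_nuclear:
  fixes T :: "(nat \<Rightarrow>\<^sub>C 'k::rc_field) \<Rightarrow> (nat \<Rightarrow>\<^sub>C 'k)"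
  assumes p: "1 \<le> p" "2 * \<rho> powr p < 1" and T: "T \<in> W.lin (W.generating_ops S (Suc k))"
  shows "T \<in> quasi_nuclear p c0_scale W c0_scale W"
  using T
proof induction
  case (base T)
  then have "T \<in> W.words S 1 \<or> T \<in> W.words S (Suc k)"
    using W.pow_words[OF S_op] by (auto simp: W.generating_ops_def simp del: funpow.simps W.words.simps)
  then obtain a b where "T = a \<circ> S \<circ> b" "a \<in> W.L" "b \<in> W.L"
    using W.words_subset_L[OF S_op, of k] by auto
  then show ?case using word_quasi_nuclear[OF p, of a b] by (simp only:)
next
  case (add T U)
  then show ?case
    by (intro quasi_nuclear_add[OF p(1)] W.L_add) (auto simp: quasi_nuclear_def)
next
  case (scale T c)
  then show ?case
    by (intro quasi_nuclear_scale[OF p(1)] W.L_scale norm_c0_scale) (auto simp: quasi_nuclear_def)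
qed

end

section \<open>Retracts and sums\<close>

lemma bounded_ops_comp:
  assumes f: "f \<in> bounded_ops s X t Y" and g: "g \<in> bounded_ops t Y u Z"
  shows "g \<circ> f \<in> bounded_ops s X u Z"
proof -
  have g0: "g 0 = 0" using norm_bounded_ops_le[OF g, of 0] by simp
  have "norm (g (f x)) \<le> onorm g * onorm f * norm x" for x
  proof -
    have "norm (g (f x)) \<le> onorm g * norm (f x)" by (rule norm_bounded_ops_le[OF g])
    also have "\<dots> \<le> onorm g * (onorm f * norm x)"
      by (intro mult_left_mono norm_bounded_ops_le[OF f] onorm_bounded_ops_nonneg[OF g])
    finally show ?thesis by (simp only: mult.assoc)
  qed
  with f g show ?thesis
    unfolding bounded_ops_def by (auto simp: g0 image_subset_iff)
qed

lemma closed_subidealsD: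
  "M \<in> closed_subideals n A \<Longrightarrow> subalgebra A M \<and> norm_closed A M"
  by (auto simp: closed_subideals_def)

context davie_space
begin

text \<open>
  The shift \<open>\<iota> \<circ> S \<circ> \<pi>\<close> generates the algebra. Compressing by \<open>\<pi>\<close> and \<open>\<iota>\<close> maps words in this shift to
  words in \<open>S\<close> with the same number of factors, so that the trace functional of the compression
  vanishes on the algebra: on powers, since \<open>S\<close> does not map into summand \<open>n + 1\<close>, and on words with
  \<open>n + 1\<close> factors. If the algebra were an \<open>n\<close>-subideal, it would contain the product of
  \<open>\<iota> \<circ> R \<circ> \<pi>\<close> with the \<open>n\<close>-th power of the shift, for which the functional has the value one.
\<close>

theorem retract_subideal:
  fixes s :: "'k::rc_field \<Rightarrow> 'b::real_normed_vector \<Rightarrow> 'b"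
    and \<iota> :: "(nat \<Rightarrow>\<^sub>C 'k) \<Rightarrow> 'b" and \<pi> :: "'b \<Rightarrow> (nat \<Rightarrow>\<^sub>C 'k)"
  assumes X: "op_space s X" and \<iota>: "\<iota> \<in> bounded_ops c0_scale W s X"
    and \<pi>: "\<pi> \<in> bounded_ops s X c0_scale W" and \<pi>\<iota>: "\<And>x. x \<in> W \<Longrightarrow> \<pi> (\<iota> x) = x"
  shows "norm_closure (op_algebra s X) (op_space.lin s (op_space.generating_ops s X (\<iota> \<circ> S \<circ> \<pi>) (n + 1)))
    \<in> closed_subideals (n + 1) (op_algebra s X) - closed_subideals n (op_algebra s X)"
proof -
  interpret X: op_space s X by (rule X)
  define P where "P = \<iota> \<circ> S \<circ> \<pi>"
  have PL: "P \<in> X.L"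
    unfolding P_def by (rule bounded_ops_comp[OF \<pi> bounded_ops_comp[OF S_op \<iota>]])
  define M where "M = norm_closure X.A (X.lin (X.generating_ops P (n + 1)))"
  have compress: "\<pi> \<circ> T \<circ> \<iota> \<in> W.L" if "T \<in> X.L" for T
    by (rule bounded_ops_comp[OF \<iota> bounded_ops_comp[OF that \<pi>]])
  have words: "\<pi> \<circ> w \<circ> \<iota> \<in> W.words S k" if "w \<in> X.words P k" for w k
    using that
  proof (induction k arbitrary: w)
    case 0
    then show ?case using compress[of w] unfolding W.words.simps X.words.simps by blast
  next
    case (Suc k)
    from Suc.prems obtain a b where w: "w = a \<circ> P \<circ> b" "a \<in> X.L" "b \<in> X.words P k"
      unfolding X.words.simps by blast
    have "\<pi> \<circ> w \<circ> \<iota> = (\<pi> \<circ> a \<circ> \<iota>) \<circ> S \<circ> (\<pi> \<circ> b \<circ> \<iota>)" by (simp add: w(1) P_def comp_assoc)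
    moreover have "\<pi> \<circ> a \<circ> \<iota> \<in> W.L" by (rule compress[OF w(2)])
    moreover have "\<pi> \<circ> b \<circ> \<iota> \<in> W.words S k" by (rule Suc.IH[OF w(3)])
    ultimately show ?case unfolding W.words.simps by blast
  qed
  have SW: "(S ^^ j) x \<in> W" if "x \<in> W" for j x
  proof (cases j)
    case (Suc i)
    show ?thesis unfolding Suc funpow.simps comp_apply by (rule W.op_range[OF S_op])
  qed (use that in simp)
  have pow: "(P ^^ j) (\<iota> x) = \<iota> ((S ^^ j) x)" if x: "x \<in> W" for j x
  proof (induction j)
    case (Suc j)
    have "(P ^^ Suc j) (\<iota> x) = P (\<iota> ((S ^^ j) x))" using Suc.IH by simp
    also have "\<dots> = \<iota> ((S ^^ Suc j) x)" by (simp add: P_def \<pi>\<iota>[OF SW[OF x]])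
    finally show ?case .
  qed simp
  define B where "B T = \<beta> (n + 1) (\<pi> \<circ> T \<circ> \<iota>)" for T
  have \<iota>X: "\<iota> x \<in> X" if "x \<in> W" for x using \<iota> that by (auto simp: bounded_ops_def)
  have vanish: "B T = 0" if T: "T \<in> M" for T
  proof (rule X.functional_vanishes_on_closure[OF PL, of B "C\<^sub>\<beta> * (onorm \<pi> * onorm \<iota>)" "n + 1"])
    show "B (\<lambda>x. T x + U x) = B T + B U" if TU: "T \<in> X.L" "U \<in> X.L" for T U
    proof -
      have "B (\<lambda>x. T x + U x) = \<beta> (n + 1) (\<lambda>x. (\<pi> \<circ> T \<circ> \<iota>) x + (\<pi> \<circ> U \<circ> \<iota>) x)"
        unfolding B_def using \<pi> X.op_range[OF TU(1)] X.op_range[OF TU(2)]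
        by (intro \<beta>_cong) (simp add: bounded_ops_def)
      also have "\<dots> = B T + B U"
        unfolding B_def by (rule \<beta>_L_add[OF compress[OF TU(1)] compress[OF TU(2)]])
      finally show ?thesis .
    qed
    show "B (\<lambda>x. s c (T x)) = c * B T" if T: "T \<in> X.L" for c T
    proof -
      have "B (\<lambda>x. s c (T x)) = \<beta> (n + 1) (\<lambda>x. c0_scale c ((\<pi> \<circ> T \<circ> \<iota>) x))"
        unfolding B_def using \<pi> X.op_range[OF T] by (intro \<beta>_cong) (simp add: bounded_ops_def)
      also have "\<dots> = c * B T" unfolding B_def by (rule \<beta>_L_scale[OF compress[OF T]])
      finally show ?thesis .
    qed
    show "norm (B T) \<le> C\<^sub>\<beta> * (onorm \<pi> * onorm \<iota>) * e"
      if T: "T \<in> X.L" and e: "0 \<le> e" and le: "\<And>x. norm (T x) \<le> e * norm x" for T e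
    proof -
      have "norm ((\<pi> \<circ> T \<circ> \<iota>) x) \<le> (onorm \<pi> * onorm \<iota> * e) * norm x" for x
      proof -
        have "norm (\<pi> (T (\<iota> x))) \<le> onorm \<pi> * norm (T (\<iota> x))" by (rule norm_bounded_ops_le[OF \<pi>])
        also have "\<dots> \<le> onorm \<pi> * (e * (onorm \<iota> * norm x))"
          using e by (intro mult_left_mono order_trans[OF le] norm_bounded_ops_le[OF \<iota>] onorm_bounded_ops_nonneg[OF \<pi>])
        finally show ?thesis by (simp add: mult_ac)
      qed
      then have "norm (B T) \<le> C\<^sub>\<beta> * (onorm \<pi> * onorm \<iota> * e)"
        unfolding B_def using e onorm_bounded_ops_nonneg[OF \<pi>] onorm_bounded_ops_nonneg[OF \<iota>]
        by (intro norm_\<beta>) auto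
      then show ?thesis by (simp only: mult.assoc)
    qed
    show "B T = 0" if "T \<in> X.generating_ops P (n + 1)" for T
    proof -
      consider j where "T = P ^^ Suc j" | "T \<in> X.words P (n + 1)"
        using \<open>T \<in> X.generating_ops P (n + 1)\<close> by (auto simp: X.generating_ops_def simp del: funpow.simps X.words.simps)
      then show ?thesis
      proof cases
        case 1
        have "B T = \<beta> (n + 1) (S ^^ Suc j)"
          unfolding B_def 1
          by (intro \<beta>_cong) (simp only: comp_apply pow \<pi>\<iota>[OF SW])
        then show ?thesis by (simp only: \<beta>_S_pow)
      next
        case 2
        then show ?thesis unfolding B_def by (intro \<beta>_words words)
      qed
    qed
    show "T \<in> norm_closure X.A (X.lin (X.generating_ops P (n + 1)))" using T by (simp add: M_def)
  qed
  have "M \<in> closed_subideals (n + 1) X.A" unfolding M_def by (rule X.subideal_chain[OF PL])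
  moreover have "M \<notin> closed_subideals n X.A"
  proof
    assume M: "M \<in> closed_subideals n X.A"
    have linL: "X.lin (X.generating_ops P (n + 1)) \<subseteq> X.L" by (rule X.lin_subset_L[OF X.generating_ops_subset_L[OF PL]])
    have "P ^^ Suc 0 \<in> X.generating_ops P (n + 1)" unfolding X.generating_ops_def by blast
    then have "P \<in> X.lin (X.generating_ops P (n + 1))" using X.lin.base by fastforce
    then have "P \<in> M" unfolding M_def using X.subset_closure[OF linL] by blast
    moreover have "\<iota> \<circ> R \<circ> \<pi> \<in> X.L" by (rule bounded_ops_comp[OF \<pi> bounded_ops_comp[OF R_op \<iota>]])
    ultimately have "(\<iota> \<circ> R \<circ> \<pi>) \<circ> P ^^ n \<in> M" by (rule X.subideal_absorbs[OF M])
    then have "B ((\<iota> \<circ> R \<circ> \<pi>) \<circ> P ^^ n) = 0" by (rule vanish)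
    moreover have "B ((\<iota> \<circ> R \<circ> \<pi>) \<circ> P ^^ n) = \<beta> (n + 1) (R \<circ> S ^^ n)"
      unfolding B_def by (intro \<beta>_cong) (simp add: pow \<pi>\<iota> SW W.op_range[OF R_op])
    ultimately show False using \<beta>_R_S_pow[where 'k = 'k] by simp
  qed
  ultimately show ?thesis by (simp add: M_def P_def)
qed

end

text \<open>
  The ratio is \<open>2 powr (- \<alpha>)\<close> for any \<open>\<alpha>\<close> strictly between \<open>1 / p\<close> and \<open>1 / (2 * n)\<close>. The
  bound \<open>p \<le> 2 * (n + 1)\<close> turns \<open>p * \<alpha> > 1\<close> into \<open>2 * (n + 1) * \<alpha> > 1\<close>.
\<close>

lemma interpolating_ratio:
  assumes "1 \<le> n" "2 * real n < p" "p \<le> 2 * (real n + 1)"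
  obtains \<rho> :: real where "0 < \<rho>" "\<rho> < 1" "1 < 2 * \<rho> ^ (2 * n)" "2 * \<rho> ^ (2 * (n + 1)) < 1" "2 * \<rho> powr p < 1"
proof -
  have n: "0 < real n" and p: "0 < p" using assms by auto
  have "1 / p < 1 / (2 * real n)" using assms n by (intro divide_strict_left_mono) auto
  then obtain \<alpha> where \<alpha>: "1 / p < \<alpha>" "\<alpha> < 1 / (2 * real n)" using dense by blast
  have a0: "0 < \<alpha>" using \<alpha>(1) p by (meson divide_pos_pos less_trans zero_less_one)
  define \<rho> where "\<rho> = 2 powr (- \<alpha>)"
  have \<rho>: "0 < \<rho>" "\<rho> < 1"
    using a0 powr_less_mono[of "- \<alpha>" 0 2] by (auto simp: \<rho>_def)
  have half: "2 powr (- 1) = (1 / 2 :: real)" by (simp add: powr_minus)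
  have "\<alpha> * (2 * real n) < 1" using \<alpha>(2) n by (simp add: pos_less_divide_eq)
  then have "2 powr (- 1) < 2 powr (- \<alpha> * real (2 * n))" by (intro powr_less_mono) auto
  also have "2 powr (- \<alpha> * real (2 * n)) = \<rho> powr real (2 * n)"
    unfolding \<rho>_def by (rule powr_powr[symmetric])
  also have "\<dots> = \<rho> ^ (2 * n)" by (rule powr_realpow[OF \<rho>(1)])
  finally have low: "1 < 2 * \<rho> ^ (2 * n)" unfolding half by simp
  have "1 < \<alpha> * p" using \<alpha>(1) p by (simp add: pos_divide_less_eq)
  then have "2 powr (- \<alpha> * p) < 2 powr (- 1 :: real)" by (intro powr_less_mono) auto
  then have P: "\<rho> powr p < 1 / 2" unfolding half by (simp add: \<rho>_def powr_powr)
  have "\<rho> ^ (2 * (n + 1)) = \<rho> powr real (2 * (n + 1))" by (rule powr_realpow[OF \<rho>(1), symmetric])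
  also have "\<dots> \<le> \<rho> powr p" using \<rho> assms by (intro powr_mono') auto
  finally have "2 * \<rho> ^ (2 * (n + 1)) < 1" using P by linarith
  with \<rho> low P show ?thesis by (intro that[of \<rho>]) auto
qed

text \<open>
  The first part is the claim about a single space. The second part, about all spaces that contain
  \<open>Z\<close> as a retract, will be applied to a sum in which \<open>Z\<close> is one of the summands.
\<close>

lemma exists_subspace_with_subideal:
  fixes n :: nat and p :: real
  assumes np: "1 \<le> n" "2 * real n < p" "p \<le> 2 * (real n + 1)"
  shows "\<exists>Z :: (nat \<Rightarrow>\<^sub>C 'k::rc_field) set.
    (Z \<subseteq> c0 \<and> c0.subspace Z \<and> closed Z \<and> \<not> approximation_property c0_scale Z \<and>
     (\<exists>M. M \<subseteq> norm_closure (op_algebra c0_scale Z) (quasi_nuclear p c0_scale Z c0_scale Z) \<and>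
        M \<in> closed_subideals (n + 1) (op_algebra c0_scale Z) - closed_subideals n (op_algebra c0_scale Z))) \<and>
    (\<forall>(s :: 'k \<Rightarrow> 'b::real_normed_vector \<Rightarrow> 'b) X \<iota> \<pi>. op_space s X \<longrightarrow> \<iota> \<in> bounded_ops c0_scale Z s X \<longrightarrow>
       \<pi> \<in> bounded_ops s X c0_scale Z \<longrightarrow> (\<forall>x\<in>Z. \<pi> (\<iota> x) = x) \<longrightarrow>
       closed_subideals n (op_algebra s X) \<subset> closed_subideals (n + 1) (op_algebra s X))"
proof -
  obtain Y :: "nat \<Rightarrow> nat \<Rightarrow> nat \<Rightarrow> nat \<Rightarrow> real" where Y:
    "\<And>k c k' c'. 2 ^ (k' + 2) \<le> c' \<Longrightarrow> Y k c k' c' = 0"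
    "\<And>k c k' c'. k + 1 < k' \<Longrightarrow> Y k c k' c' = 0"
    "\<And>k c k' c'. c < 2 ^ (k + 2) \<Longrightarrow> \<bar>Y k c k' c'\<bar> \<le> 4 * (real k + 1) / (2 ^ k * sqrt (2 ^ k))"
    "\<And>k c. c < 2 ^ (k + 2) \<Longrightarrow> Y k c k c = (if k = 0 then 1 / 4 else 0)"
    "\<And>k c k'' c''. (\<Sum>k'\<le>k + 1. \<Sum>c'<2 ^ (k' + 2). Y k c k' c' * Y k' c' k'' c'') = 0"
    by (rule nilpotent_matrix_with_trace_one, rule that) assumption+
  obtain \<rho> :: real where \<rho>: "0 < \<rho>" "\<rho> < 1" "1 < 2 * \<rho> ^ (2 * n)" "2 * \<rho> ^ (2 * (n + 1)) < 1"
    and \<rho>p: "2 * \<rho> powr p < 1"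
    by (rule interpolating_ratio[OF np], rule that) assumption+
  interpret davie_space Y n \<rho>
    by (rule davie_space.intro) (fact Y np(1) \<rho>)+
  have p: "1 \<le> p" using np by linarith
  define Z where "Z = (W :: (nat \<Rightarrow>\<^sub>C 'k) set)"
  let ?A = "op_algebra c0_scale Z"
  let ?M = "norm_closure ?A (W.lin (W.generating_ops S (n + 1)))"
  have eq: "W.one \<circ> S \<circ> W.one = (S :: (nat \<Rightarrow>\<^sub>C 'k) \<Rightarrow> _)"
    by (simp only: W.one_comp[OF S_op] W.comp_one[OF S_op])
  have idem: "W.one (W.one x) = x" if "x \<in> W" for x :: "nat \<Rightarrow>\<^sub>C 'k"
    using that by (simp add: W.one_def)
  have "?M \<in> closed_subideals (n + 1) ?A - closed_subideals n ?A"
    using retract_subideal[OF W.op_space_axioms W.L_one W.L_one idem] unfolding Z_def eq .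
  moreover have "?M \<subseteq> norm_closure ?A (quasi_nuclear p c0_scale Z c0_scale Z)"
    unfolding Z_def using generating_ops_quasi_nuclear[OF p \<rho>p, where k = n] by (intro W.closure_mono) auto
  moreover have "closed_subideals n (op_algebra s X) \<subset> closed_subideals (n + 1) (op_algebra s X)"
    if "op_space s X" "\<iota> \<in> bounded_ops c0_scale Z s X" "\<pi> \<in> bounded_ops s X c0_scale Z" "\<forall>x\<in>Z. \<pi> (\<iota> x) = x"
    for s :: "'k \<Rightarrow> 'b \<Rightarrow> 'b" and X \<iota> \<pi>
    using retract_subideal[OF that(1) that(2,3)[unfolded Z_def]] that(4) closed_subideals_Suc[of n "op_algebra s X"]
    unfolding Z_def by auto
  moreover have "Z \<subseteq> c0" "c0.subspace Z" "closed Z" "\<not> approximation_property c0_scale Z"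
    unfolding Z_def by (rule W_c0 c0_subspace_W W_closed no_approximation_property)+
  ultimately show ?thesis by (intro exI[of _ Z] conjI exI[of _ ?M] allI impI)
qed

definition place :: "nat \<Rightarrow> 'b::real_normed_vector \<Rightarrow> (nat \<Rightarrow>\<^sub>C 'b)" where
  "place j x = Bcontfun (\<lambda>i. if i = j then x else 0)"

lemma place_apply [simp]: "apply_bcontfun (place j x) i = (if i = j then x else 0)"
  unfolding place_def by (subst apply_Bcontfun_nat[of _ "norm x"]) auto

lemma c0_sum_op_space:
  fixes Z :: "nat \<Rightarrow> (nat \<Rightarrow>\<^sub>C 'k::rc_field) set"
  assumes Z: "\<And>i. c0.subspace (Z i)"
  shows "op_space c0_sum_scale (c0_sum Z)"
proof (intro op_space.intro op_space_axioms.intro)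
  show "vector_space (c0_sum_scale :: 'k \<Rightarrow> _)" by (rule c0_sum.vector_space_axioms)
  have le: "norm (c0_scale c (f i)) \<le> norm c * norm (f i)" for c :: 'k and f :: "nat \<Rightarrow>\<^sub>C (nat \<Rightarrow>\<^sub>C 'k)" and i
    by (rule norm_c0_scale)
  show "norm (c0_sum_scale c f) \<le> norm c * norm f" for c :: 'k and f
    by (rule norm_bound) (auto intro!: order_trans[OF le] mult_left_mono norm_bounded)
  show "0 \<in> c0_sum Z" using Z by (simp add: c0_sum_def c0.subspace_def)
  show "f + g \<in> c0_sum Z" if "f \<in> c0_sum Z" "g \<in> c0_sum Z" for f g
    using that Z by (auto simp: c0_sum_def c0.subspace_def intro: tendsto_add_zero)
  show "c0_sum_scale c f \<in> c0_sum Z" if f: "f \<in> c0_sum Z" for c f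
  proof -
    have "(\<lambda>i. norm (c0_sum_scale c f i)) \<longlonglongrightarrow> 0"
    proof (rule tendsto_sandwich[of "\<lambda>_. 0" _ _ "\<lambda>i. norm c * norm (f i)"])
      show "(\<lambda>i. norm c * norm (f i)) \<longlonglongrightarrow> 0"
        using f by (intro tendsto_mult_right_zero tendsto_norm_zero) (simp add: c0_sum_def)
    qed (auto simp: le)
    then have "apply_bcontfun (c0_sum_scale c f) \<longlonglongrightarrow> 0" by (rule tendsto_norm_zero_cancel)
    then show ?thesis using f Z by (simp add: c0_sum_def c0.subspace_def)
  qed
qed

lemma c0_sum_retract:
  fixes Z :: "nat \<Rightarrow> (nat \<Rightarrow>\<^sub>C 'k::rc_field) set"
  assumes Z: "\<And>i. c0.subspace (Z i)"
  obtains \<iota> \<pi> where "\<iota> \<in> bounded_ops c0_scale (Z j) c0_sum_scale (c0_sum Z)"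
    "\<pi> \<in> bounded_ops c0_sum_scale (c0_sum Z) c0_scale (Z j)" "\<And>x. x \<in> Z j \<Longrightarrow> \<pi> (\<iota> x) = x"
proof -
  define \<iota> where "\<iota> x = (if x \<in> Z j then place j x else 0)" for x
  define \<pi> where "\<pi> f = (if f \<in> c0_sum Z then f j else 0)" for f :: "nat \<Rightarrow>\<^sub>C (nat \<Rightarrow>\<^sub>C 'k)"
  interpret X: op_space c0_sum_scale "c0_sum Z" by (rule c0_sum_op_space[OF Z])
  have zero: "0 \<in> Z i" for i using Z by (simp add: c0.subspace_def)
  have place: "place j x \<in> c0_sum Z" if "x \<in> Z j" for x
  proof -
    have "eventually (\<lambda>i. place j x i = 0) sequentially"
      unfolding eventually_sequentially by (intro exI[of _ "Suc j"]) auto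
    with that zero show ?thesis by (auto simp: c0_sum_def intro: tendsto_eventually)
  qed
  have place_add: "place j (x + y) = place j x + place j y"
    and place_scale: "place j (c0_scale c x) = c0_sum_scale c (place j x)" for x y c
    by (auto intro!: bcontfun_eqI)
  show ?thesis
  proof (rule that[of \<iota> \<pi>])
    have "norm (place j x) \<le> 1 * norm x" for x :: "nat \<Rightarrow>\<^sub>C 'k"
      by (rule norm_bound) auto
    then show "\<iota> \<in> bounded_ops c0_scale (Z j) c0_sum_scale (c0_sum Z)"
      using Z[of j] place unfolding bounded_ops_def
      by (auto simp: \<iota>_def place_add place_scale c0.subspace_def intro!: exI[of _ 1])
    have "norm (f j) \<le> 1 * norm f" for f :: "nat \<Rightarrow>\<^sub>C (nat \<Rightarrow>\<^sub>C 'k)"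
      using norm_bounded[of f j] by simp
    then show "\<pi> \<in> bounded_ops c0_sum_scale (c0_sum Z) c0_scale (Z j)"
      using X.add_X X.scale_X unfolding bounded_ops_def
      by (auto simp: \<pi>_def intro!: exI[of _ 1]) (auto simp: c0_sum_def)
    show "\<pi> (\<iota> x) = x" if "x \<in> Z j" for x
      using that place[OF that] by (simp add: \<iota>_def \<pi>_def)
  qed
qed

theorem theorem4p12:
  shows
  "(\<forall>(n::nat) (p::real). 1 \<le> n \<and> 2 * real n < p \<and> p \<le> 2 * (real n + 1) \<longrightarrow>
      (\<exists>(Z :: (nat \<Rightarrow>\<^sub>C 'k::rc_field) set) M.
         Z \<subseteq> c0 \<and> c0.subspace Z \<and> closed Z \<and>
         \<not> approximation_property c0_scale Z \<and>
         subalgebra (op_algebra c0_scale Z) M \<and>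
         norm_closed (op_algebra c0_scale Z) M \<and>
         M \<subseteq> norm_closure (op_algebra c0_scale Z)
                (quasi_nuclear p c0_scale Z c0_scale Z) \<and>
         M \<in> closed_subideals (n + 1) (op_algebra c0_scale Z)
               - closed_subideals n (op_algebra c0_scale Z)))
   \<and>
   (\<forall>p :: nat \<Rightarrow> real.
      (\<forall>n\<ge>1. 2 * real n < p n \<and> p n \<le> 2 * (real n + 1)) \<longrightarrow>
      (\<exists>(Z :: nat \<Rightarrow> (nat \<Rightarrow>\<^sub>C 'k) set) M.
         (\<forall>n\<ge>1.
            Z n \<subseteq> c0 \<and> c0.subspace (Z n) \<and> closed (Z n) \<and>
            \<not> approximation_property c0_scale (Z n) \<and>
            subalgebra (op_algebra c0_scale (Z n)) (M n) \<and>
            norm_closed (op_algebra c0_scale (Z n)) (M n) \<and>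
            M n \<subseteq> norm_closure (op_algebra c0_scale (Z n))
                     (quasi_nuclear (p n) c0_scale (Z n) c0_scale (Z n)) \<and>
            M n \<in> closed_subideals (n + 1) (op_algebra c0_scale (Z n))
                    - closed_subideals n (op_algebra c0_scale (Z n))) \<and>
         (\<forall>n\<ge>1.
            closed_subideals n (op_algebra c0_sum_scale (c0_sum (\<lambda>i. Z (i + 1))))
            \<subset> closed_subideals (n + 1)
                (op_algebra c0_sum_scale (c0_sum (\<lambda>i. Z (i + 1)))))))"
proof (intro conjI allI impI)
  fix n :: nat and p :: real
  assume "1 \<le> n \<and> 2 * real n < p \<and> p \<le> 2 * (real n + 1)"
  then obtain Z :: "(nat \<Rightarrow>\<^sub>C 'k) set" and M where
    "Z \<subseteq> c0 \<and> c0.subspace Z \<and> closed Z \<and> \<not> approximation_property c0_scale Z"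
    "M \<subseteq> norm_closure (op_algebra c0_scale Z) (quasi_nuclear p c0_scale Z c0_scale Z)"
    "M \<in> closed_subideals (n + 1) (op_algebra c0_scale Z) - closed_subideals n (op_algebra c0_scale Z)"
    using exists_subspace_with_subideal[of n p, where 'k = 'k and 'b = "nat \<Rightarrow>\<^sub>C (nat \<Rightarrow>\<^sub>C 'k)"] by blast
  then show "\<exists>(Z :: (nat \<Rightarrow>\<^sub>C 'k::rc_field) set) M.
         Z \<subseteq> c0 \<and> c0.subspace Z \<and> closed Z \<and>
         \<not> approximation_property c0_scale Z \<and>
         subalgebra (op_algebra c0_scale Z) M \<and>
         norm_closed (op_algebra c0_scale Z) M \<and>
         M \<subseteq> norm_closure (op_algebra c0_scale Z)
                (quasi_nuclear p c0_scale Z c0_scale Z) \<and>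
         M \<in> closed_subideals (n + 1) (op_algebra c0_scale Z)
               - closed_subideals n (op_algebra c0_scale Z)"
    using closed_subidealsD[of M "n + 1" "op_algebra c0_scale Z"]
    by (intro exI[of _ Z] exI[of _ M]) simp
next
  fix p :: "nat \<Rightarrow> real"
  assume p: "\<forall>n\<ge>1. 2 * real n < p n \<and> p n \<le> 2 * (real n + 1)"
  define good where "good n Z \<longleftrightarrow>
    (Z \<subseteq> c0 \<and> c0.subspace Z \<and> closed Z \<and> \<not> approximation_property c0_scale Z \<and>
     (\<exists>M. M \<subseteq> norm_closure (op_algebra c0_scale Z) (quasi_nuclear (p n) c0_scale Z c0_scale Z) \<and>
        M \<in> closed_subideals (n + 1) (op_algebra c0_scale Z) - closed_subideals n (op_algebra c0_scale Z))) \<and>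
    (\<forall>(s :: 'k \<Rightarrow> (nat \<Rightarrow>\<^sub>C (nat \<Rightarrow>\<^sub>C 'k)) \<Rightarrow> _) X \<iota> \<pi>. op_space s X \<longrightarrow> \<iota> \<in> bounded_ops c0_scale Z s X \<longrightarrow>
       \<pi> \<in> bounded_ops s X c0_scale Z \<longrightarrow> (\<forall>x\<in>Z. \<pi> (\<iota> x) = x) \<longrightarrow>
       closed_subideals n (op_algebra s X) \<subset> closed_subideals (n + 1) (op_algebra s X))"
    for n and Z :: "(nat \<Rightarrow>\<^sub>C 'k) set"
  have "\<exists>Z. 1 \<le> n \<longrightarrow> good n Z" for n
    using exists_subspace_with_subideal[of n "p n", where 'k = 'k and 'b = "nat \<Rightarrow>\<^sub>C (nat \<Rightarrow>\<^sub>C 'k)"] p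
    unfolding good_def by blast
  then obtain Z where Z: "\<And>n. 1 \<le> n \<Longrightarrow> good n (Z n)" by metis
  have "\<exists>M. 1 \<le> n \<longrightarrow> M \<subseteq> norm_closure (op_algebra c0_scale (Z n)) (quasi_nuclear (p n) c0_scale (Z n) c0_scale (Z n)) \<and>
        M \<in> closed_subideals (n + 1) (op_algebra c0_scale (Z n)) - closed_subideals n (op_algebra c0_scale (Z n))" for n
    using Z[of n] unfolding good_def by blast
  then obtain M where M: "\<And>n. 1 \<le> n \<Longrightarrow> M n \<subseteq> norm_closure (op_algebra c0_scale (Z n)) (quasi_nuclear (p n) c0_scale (Z n) c0_scale (Z n))"
    "\<And>n. 1 \<le> n \<Longrightarrow> M n \<in> closed_subideals (n + 1) (op_algebra c0_scale (Z n)) - closed_subideals n (op_algebra c0_scale (Z n))"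
    by metis
  have sub: "c0.subspace (Z (i + 1))" for i using Z[of "i + 1"] by (simp add: good_def)
  have strict: "closed_subideals n (op_algebra c0_sum_scale (c0_sum (\<lambda>i. Z (i + 1))))
      \<subset> closed_subideals (n + 1) (op_algebra c0_sum_scale (c0_sum (\<lambda>i. Z (i + 1))))" if n: "1 \<le> n" for n
  proof -
    obtain \<iota> \<pi> where "\<iota> \<in> bounded_ops c0_scale (Z ((n - 1) + 1)) c0_sum_scale (c0_sum (\<lambda>i. Z (i + 1)))"
      "\<pi> \<in> bounded_ops c0_sum_scale (c0_sum (\<lambda>i. Z (i + 1))) c0_scale (Z ((n - 1) + 1))"
      "\<And>x. x \<in> Z ((n - 1) + 1) \<Longrightarrow> \<pi> (\<iota> x) = x"
      using c0_sum_retract[of "\<lambda>i. Z (i + 1)" "n - 1", OF sub] by blast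
    then show ?thesis
      using Z[OF n] c0_sum_op_space[of "\<lambda>i. Z (i + 1)", OF sub] n unfolding good_def by simp
  qed
  show "\<exists>(Z :: nat \<Rightarrow> (nat \<Rightarrow>\<^sub>C 'k) set) M.
         (\<forall>n\<ge>1.
            Z n \<subseteq> c0 \<and> c0.subspace (Z n) \<and> closed (Z n) \<and>
            \<not> approximation_property c0_scale (Z n) \<and>
            subalgebra (op_algebra c0_scale (Z n)) (M n) \<and>
            norm_closed (op_algebra c0_scale (Z n)) (M n) \<and>
            M n \<subseteq> norm_closure (op_algebra c0_scale (Z n))
                     (quasi_nuclear (p n) c0_scale (Z n) c0_scale (Z n)) \<and>
            M n \<in> closed_subideals (n + 1) (op_algebra c0_scale (Z n))
                    - closed_subideals n (op_algebra c0_scale (Z n))) \<and>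
         (\<forall>n\<ge>1.
            closed_subideals n (op_algebra c0_sum_scale (c0_sum (\<lambda>i. Z (i + 1))))
            \<subset> closed_subideals (n + 1)
                (op_algebra c0_sum_scale (c0_sum (\<lambda>i. Z (i + 1)))))"
  proof (intro exI[of _ Z] exI[of _ M] conjI allI impI)
    fix n :: nat assume n: "1 \<le> n"
    show "Z n \<subseteq> c0" "c0.subspace (Z n)" "closed (Z n)" "\<not> approximation_property c0_scale (Z n)"
      using Z[OF n] by (simp_all add: good_def)
    show "subalgebra (op_algebra c0_scale (Z n)) (M n)" "norm_closed (op_algebra c0_scale (Z n)) (M n)"
      using closed_subidealsD[of "M n" "n + 1" "op_algebra c0_scale (Z n)"] M(2)[OF n] by auto
  qed (fact M strict)+
qed

end
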